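(* Let $h$ be a positive even integer, and let $f \in M(2,h)$ have Fourier expansion at infinity $$f(z)=\sum_{n=0}^{\infty}A_n q^n,\qquad q=e^{2\pi i z},\qquad A_0\neq 0 .$$ If $h\equiv 0 \pmod 4$, then $A_n\neq 0$ for some integer $n$ with $1\le n\le r(2,h)$. If $h\equiv 2\pmod 4$, then $A_n\neq 0$ for some integer $n$ with $1\le n\le 2r(2,h)$.
   Context: $\Gamma_0(2)$ is the group of matrices $\begin{pmatrix} a&b\\ c&d\end{pmatrix}\in SL(2,\mathbf Z)$ with $c\equiv 0 \pmod 2$. $M(2,h)$ denotes the complex vector space of entire modular forms (holomorphic on the upper half plane and at the cusps) of weight $h$ for $\Gamma_0(2)$ with trivial character, and $r(2,h)=\dim M(2,h)$, which equals $\lfloor h/4\rfloor+1$. *)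

theory Defs
  imports "HOL-Complex_Analysis.Complex_Analysis" "HOL-Number_Theory.Cong"
    "HOL-Library.Function_Algebras"
begin

unbundle no fps_syntax

definition upper_half_plane :: "complex set" where
  "upper_half_plane = {z. Im z > 0}"

definition SL2Z :: "(int^2^2) set" where
  "SL2Z = {g. det g = 1}"

definition Gamma0 :: "nat \<Rightarrow> (int^2^2) set" where
  "Gamma0 N = {g \<in> SL2Z. int N dvd g$2$1}"

definition mobius :: "int^2^2 \<Rightarrow> complex \<Rightarrow> complex" where
  "mobius g z = (of_int (g$1$1) * z + of_int (g$1$2)) / (of_int (g$2$1) * z + of_int (g$2$2))"

definition slash :: "nat \<Rightarrow> (complex \<Rightarrow> complex) \<Rightarrow> int^2^2 \<Rightarrow> complex \<Rightarrow> complex" where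
  "slash h f g z = f (mobius g z) / (of_int (g$2$1) * z + of_int (g$2$2)) ^ h"

text \<open>Holomorphy at infinity: an expansion with non-negative exponents in the local parameter
  \<open>exp (2 \<pi> i z / w)\<close> for some positive integer width \<open>w\<close>. The width is not fixed because
  \<open>slash h f g\<close> need not have period 1.\<close>

definition holomorphic_at_infinity :: "(complex \<Rightarrow> complex) \<Rightarrow> bool" where
  "holomorphic_at_infinity f \<longleftrightarrow> (\<exists>w::nat. w > 0 \<and> (\<exists>a :: nat \<Rightarrow> complex.
     \<forall>z\<in>upper_half_plane. (\<lambda>n. a n * exp (2 * of_real pi * \<i> * z / of_nat w) ^ n) sums f z))"

text \<open>The space \<open>M(N,h)\<close> with trivial character. A form is represented by its extension by zero
  to the whole complex plane, so that equality of HOL functions is equality of forms and the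
  dimension below is the right one. The condition at the cusps is imposed on \<open>slash h f g\<close> for
  all \<open>g\<close> in \<open>SL2Z\<close>; as \<open>SL2Z\<close> acts transitively on the cusps, this covers every cusp.\<close>

definition modular_forms :: "nat \<Rightarrow> nat \<Rightarrow> (complex \<Rightarrow> complex) set" where
  "modular_forms N h = {f.
     f holomorphic_on upper_half_plane \<and>
     (\<forall>g\<in>Gamma0 N. \<forall>z\<in>upper_half_plane.
        f (mobius g z) = (of_int (g$2$1) * z + of_int (g$2$2)) ^ h * f z) \<and>
     (\<forall>g\<in>SL2Z. holomorphic_at_infinity (slash h f g)) \<and>
     (\<forall>z. z \<notin> upper_half_plane \<longrightarrow> f z = 0)}"

definition fun_scale :: "complex \<Rightarrow> (complex \<Rightarrow> complex) \<Rightarrow> complex \<Rightarrow> complex" where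
  "fun_scale c f = (\<lambda>z. c * f z)"

interpretation cfun: vector_space fun_scale
  by unfold_locales (auto simp: fun_scale_def fun_eq_iff algebra_simps)

definition dim_modular_forms :: "nat \<Rightarrow> nat \<Rightarrow> nat" where
  "dim_modular_forms N h = cfun.dim (modular_forms N h)"

lemma holomorphic_at_infinity_add:
  assumes "holomorphic_at_infinity f" "holomorphic_at_infinity g"
  shows "holomorphic_at_infinity (\<lambda>z. f z + g z)"
proof -
  have refine: "\<exists>b. \<forall>z\<in>upper_half_plane.
      (\<lambda>n. b n * exp (2 * of_real pi * \<i> * z / of_nat (w * v)) ^ n) sums f z"
    if w: "w > 0" and v: "v > 0" and a: "\<forall>z\<in>upper_half_plane.
      (\<lambda>n. a n * exp (2 * of_real pi * \<i> * z / of_nat w) ^ n) sums f z"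
    for f :: "complex \<Rightarrow> complex" and a and w v :: nat
  proof (intro exI ballI)
    fix z assume z: "z \<in> upper_half_plane"
    let ?x = "exp (2 * of_real pi * \<i> * z / of_nat (w * v))"
    define b where "b = (\<lambda>n. if v dvd n then a (n div v) else 0)"
    have eq: "?x ^ (v * n) = exp (2 * of_real pi * \<i> * z / of_nat w) ^ n" for n
      using v w by (simp add: exp_of_nat_mult[symmetric] mult.assoc)
    have "(\<lambda>n. (b (v * n)) * ?x ^ (v * n)) sums f z"
      unfolding eq using a z v by (simp add: b_def)
    moreover have "strict_mono (\<lambda>n. v * n)"
      using v by (auto simp: strict_mono_def)
    moreover have "b n * ?x ^ n = 0" if "n \<notin> range (\<lambda>n. v * n)" for n
      using that by (auto simp: b_def dvd_def)
    ultimately have "(\<lambda>n. b n * ?x ^ n) sums f z"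
      using sums_mono_reindex[of "\<lambda>n. v * n" "\<lambda>n. b n * ?x ^ n" "f z"] by (simp add: mult.commute)
    then show "(\<lambda>n. (if v dvd n then a (n div v) else 0) * ?x ^ n) sums f z"
      by (simp add: b_def)
  qed
  obtain w a where w: "w > 0" "\<forall>z\<in>upper_half_plane.
      (\<lambda>n. a n * exp (2 * of_real pi * \<i> * z / of_nat w) ^ n) sums f z"
    using assms(1) unfolding holomorphic_at_infinity_def by blast
  obtain v b where v: "v > 0" "\<forall>z\<in>upper_half_plane.
      (\<lambda>n. b n * exp (2 * of_real pi * \<i> * z / of_nat v) ^ n) sums g z"
    using assms(2) unfolding holomorphic_at_infinity_def by blast
  obtain a' where a': "\<forall>z\<in>upper_half_plane.
      (\<lambda>n. a' n * exp (2 * of_real pi * \<i> * z / of_nat (w * v)) ^ n) sums f z"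
    using refine[OF w(1) v(1) w(2)] by blast
  obtain b' where b': "\<forall>z\<in>upper_half_plane.
      (\<lambda>n. b' n * exp (2 * of_real pi * \<i> * z / of_nat (w * v)) ^ n) sums g z"
    using refine[OF v(1) w(1) v(2)] unfolding mult.commute[of v w] by blast
  have "\<forall>z\<in>upper_half_plane.
      (\<lambda>n. (a' n + b' n) * exp (2 * of_real pi * \<i> * z / of_nat (w * v)) ^ n) sums (f z + g z)"
  proof
    fix z assume z: "z \<in> upper_half_plane"
    show "(\<lambda>n. (a' n + b' n) * exp (2 * of_real pi * \<i> * z / of_nat (w * v)) ^ n) sums (f z + g z)"
      unfolding distrib_right by (rule sums_add[OF a'[rule_format, OF z] b'[rule_format, OF z]])
  qed
  moreover have "w * v > 0" using w v by simp
  ultimately show ?thesis unfolding holomorphic_at_infinity_def by (intro exI conjI)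
qed

lemma holomorphic_at_infinity_cmult:
  assumes "holomorphic_at_infinity f"
  shows "holomorphic_at_infinity (\<lambda>z. c * f z)"
proof -
  obtain w a where w: "w > 0" "\<forall>z\<in>upper_half_plane.
      (\<lambda>n. a n * exp (2 * of_real pi * \<i> * z / of_nat w) ^ n) sums f z"
    using assms unfolding holomorphic_at_infinity_def by blast
  have "\<forall>z\<in>upper_half_plane.
      (\<lambda>n. (c * a n) * exp (2 * of_real pi * \<i> * z / of_nat w) ^ n) sums (c * f z)"
    using w(2) sums_mult by (fastforce simp: mult.assoc)
  with w(1) show ?thesis unfolding holomorphic_at_infinity_def by (intro exI conjI)
qed

lemma subspace_modular_forms: "cfun.subspace (modular_forms N h)"
proof -
  have sl_add: "slash h (f + f') g = (\<lambda>z. slash h f g z + slash h f' g z)" for f f' g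
    by (simp add: slash_def fun_eq_iff add_divide_distrib)
  have sl_c: "slash h (fun_scale c f) g = (\<lambda>z. c * slash h f g z)" for f c g
    by (simp add: slash_def fun_eq_iff fun_scale_def)
  have z: "holomorphic_at_infinity (slash h 0 g)" for g
    unfolding holomorphic_at_infinity_def slash_def
    by (intro exI[of _ 1] exI[of _ "\<lambda>_. 0"] conjI) auto
  have "0 \<in> modular_forms N h"
    using z by (auto simp: modular_forms_def zero_fun_def)
  moreover have "f + f' \<in> modular_forms N h"
    if f: "f \<in> modular_forms N h" and f': "f' \<in> modular_forms N h" for f f'
  proof -
    have "f + f' holomorphic_on upper_half_plane"
      using f f' holomorphic_on_add[of f upper_half_plane f']
      unfolding modular_forms_def plus_fun_def by simp
    moreover have "holomorphic_at_infinity (slash h (f + f') g)" if "g \<in> SL2Z" for g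
      unfolding sl_add using f f' that
      by (intro holomorphic_at_infinity_add) (simp_all add: modular_forms_def)
    ultimately show ?thesis
      using f f' unfolding modular_forms_def by (simp add: distrib_left)
  qed
  moreover have "fun_scale c f \<in> modular_forms N h" if f: "f \<in> modular_forms N h" for c f
  proof -
    have "fun_scale c f holomorphic_on upper_half_plane"
      using f unfolding modular_forms_def fun_scale_def by (simp add: holomorphic_on_mult)
    moreover have "holomorphic_at_infinity (slash h (fun_scale c f) g)" if "g \<in> SL2Z" for g
      unfolding sl_c using f that
      by (intro holomorphic_at_infinity_cmult) (simp_all add: modular_forms_def)
    ultimately show ?thesis
      using f unfolding modular_forms_def by (simp add: fun_scale_def)
  qed
  ultimately show ?thesis unfolding cfun.subspace_def by blast
qed

end

theory Submission imports Defs "HOL-Probability.Characteristic_Functions"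
begin

text \<open>
Write \<open>k = h div 4\<close>. For \<open>h = 4 k\<close> the space of forms has the basis \<open>phi ^ (k - i) * psi ^ i\<close>, \<open>i \<le> k\<close>, where
\<open>psi = theta2 ^ 8 / 256 = q + \<dots>\<close> has its only zero, a simple one, at infinity, and \<open>phi(z) = 2 E\<^sub>4(2z)\<close>.
Suppose that \<open>f = A\<^sub>0 + O(q ^ (k + 2))\<close>, and put \<open>J = phi / psi\<close>. Then \<open>f / psi ^ k\<close> is a polynomial in \<open>J\<close>, so
the differential \<open>(f / psi ^ k) dJ\<close> is exact and its residue at \<open>q = 0\<close> is 0. Because of the gap this
residue is \<open>A\<^sub>0\<close> times the residue of \<open>psi ^ (-k) dJ\<close>, and integration by parts identifies the latter with
\<open>k / (k + 1)\<close> times the residue of \<open>psi ^ (-k - 1) d(phi)\<close> (\<open>residue_constraint\<close>). The last residue is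
not 0 (\<open>phi_psi_residue_nonzero\<close>): after replacing \<open>q\<close> by \<open>- q\<close>, all coefficients of \<open>q / psi\<close> have
constant sign by Gauss's product \<open>psi = q \<Prod> ((1 - q ^ (2 n)) / (1 - q ^ (2 n - 1))) ^ 8\<close>, and \<open>phi\<close> is a
power series in \<open>q\<^sup>2\<close> with nonnegative coefficients. Hence \<open>A\<^sub>0 = 0\<close>.

If \<open>h \<equiv> 2\<close> modulo 4, the same argument is applied to \<open>f\<^sup>2\<close>, whose weight \<open>4 (2 k + 1)\<close> leads to the bound
\<open>2 k + 2\<close>.

The bounds in the theorem involve the dimension, so its exact value \<open>k + 1\<close> is needed for every even
weight (\<open>dim_modular_forms_even\<close>). Independence comes from explicit forms of each vanishing order at
infinity; for \<open>h \<equiv> 2\<close> modulo 4 they have an additional factor \<open>eis2\<close> of weight 2. Spanning comes from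
\<open>modular_form_eq_0_if_vanishing\<close>: a form that vanishes at infinity to order greater than \<open>h / 4\<close> is 0,
because the product of its conjugates, divided by a suitable power of the theta constants, is a
holomorphic function invariant under \<open>SL(2,Z)\<close> that tends to 0 at infinity.

The forms used are built from theta constants. The behaviour of these under \<open>z \<mapsto> -1/z\<close> is proved by Poisson
summation on the imaginary axis, and the absence of zeros by Gauss's product.
\<close>

section \<open>Poisson summation for Gaussians\<close>

unbundle no Formal_Power_Series.fps_syntax

text \<open>The trigonometric polynomial \<open>T = 1 + cos (2 \<pi> x) - cos (2 \<pi> \<epsilon>)\<close> exceeds 1 near 0 and is bounded by 1 in
absolute value away from 0. All integrals of \<open>d * T ^ N\<close> vanish; if \<open>d 0 \<noteq> 0\<close> the part near 0 would
grow exponentially with \<open>N\<close> while the rest stays bounded.\<close>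

lemma fourier_coefficients_zero_imp_zero:
  fixes d :: "real \<Rightarrow> complex"
  assumes cont: "continuous_on {-1/2..1/2} d"
    and coeff: "\<And>n::int. integral {-1/2..1/2} (\<lambda>x. d x * cis (2 * pi * of_int n * x)) = 0"
  shows "d 0 = 0"
proof (rule ccontr)
  assume d0: "d 0 \<noteq> 0"
  define r where "r x = Re (d x * cnj (d 0))" for x
  define \<delta> where "\<delta> = (cmod (d 0))\<^sup>2 / 2"
  have "\<delta> > 0" using d0 by (simp add: \<delta>_def)
  have r0: "r 0 = 2 * \<delta>" unfolding \<delta>_def cmod_power2 by (simp add: r_def power2_eq_square)
  have cr: "continuous_on {-1/2..1/2} r"
    unfolding r_def by (intro continuous_intros cont)
  have "\<exists>e>0. \<forall>x\<in>{-1/2..1/2}. dist x 0 < e \<longrightarrow> dist (r x) (r 0) < \<delta>"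
    using cr \<open>\<delta> > 0\<close> unfolding continuous_on_iff by force
  then obtain e where e: "e > 0" "\<And>x. x \<in> {-1/2..1/2} \<Longrightarrow> \<bar>x\<bar> < e \<Longrightarrow> \<bar>r x - r 0\<bar> < \<delta>"
    by (auto simp: dist_real_def)
  define \<epsilon> where "\<epsilon> = min (e/2) (1/8)"
  have eps: "0 < \<epsilon>" "\<epsilon> < e" "\<epsilon> \<le> 1/8" using e(1) by (auto simp: \<epsilon>_def)
  have rpos: "r x \<ge> \<delta>" if "\<bar>x\<bar> \<le> \<epsilon>" for x
    using e(2)[of x] that eps r0 by (auto simp: abs_le_iff abs_less_iff)
  define T where "T x = 1 + cos (2 * pi * x) - cos (2 * pi * \<epsilon>)" for x :: real
  have Tcis: "complex_of_real (T x) = (1 - of_real (cos (2 * pi * \<epsilon>)))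
      + (cis (2 * pi * x) + cis (- (2 * pi * x))) / 2" for x
    by (simp add: T_def complex_eq_iff)
  have zero: "((\<lambda>x. d x * of_real (T x) ^ N * cis (2 * pi * of_int n * x)) has_integral 0) {-1/2..1/2}" for N and n :: int
  proof (induction N arbitrary: n)
    case 0
    have "(\<lambda>x. d x * cis (2 * pi * of_int n * x)) integrable_on {-1/2..1/2}"
      by (intro integrable_continuous_real continuous_intros cont)
    then show ?case using coeff[of n] by (simp add: has_integral_iff)
  next
    case (Suc N)
    define F where "F n x = d x * of_real (T x) ^ N * cis (2 * pi * of_int n * x)" for n :: int and x
    have "d x * of_real (T x) ^ Suc N * cis (2 * pi * of_int n * x) =
       (1 - of_real (cos (2 * pi * \<epsilon>))) * F n x + (1/2) * F (n+1) x + (1/2) * F (n-1) x" for x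
    proof -
      have a: "cis (2 * pi * of_int (n+1) * x) = cis (2 * pi * x) * cis (2 * pi * of_int n * x)"
        "cis (2 * pi * of_int (n-1) * x) = cis (-(2 * pi * x)) * cis (2 * pi * of_int n * x)"
        by (simp_all add: cis_mult algebra_simps)
      show ?thesis unfolding F_def a power_Suc Tcis by (simp add: field_simps)
    qed
    moreover have "((\<lambda>x. (1 - of_real (cos (2 * pi * \<epsilon>))) * F n x + (1/2) * F (n+1) x + (1/2) * F (n-1) x) has_integral
       (1 - of_real (cos (2 * pi * \<epsilon>))) * 0 + (1/2) * 0 + (1/2) * 0) {-1/2..1/2}"
      by (intro has_integral_add has_integral_mult_right) (use Suc[folded F_def] in blast)+
    ultimately show ?case by simp
  qed
  have zr: "((\<lambda>x. r x * T x ^ N) has_integral 0) {-1/2..1/2}" for N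
  proof -
    have "((\<lambda>x. Re (cnj (d 0) * (d x * of_real (T x) ^ N * cis (2 * pi * of_int 0 * x)))) has_integral Re (cnj (d 0) * 0)) {-1/2..1/2}"
      by (intro has_integral_Re has_integral_mult_right zero)
    moreover have "Re (cnj (d 0) * (d x * of_real (T x) ^ N * cis (2 * pi * of_int 0 * x))) = r x * T x ^ N" for x
      unfolding r_def of_real_power[symmetric] by (simp add: algebra_simps)
    ultimately show ?thesis by simp
  qed
  have "bounded (r ` {-1/2..1/2})"
    by (intro compact_imp_bounded compact_continuous_image cr) auto
  then obtain M where M0: "M > 0" "\<forall>y\<in>r ` {-1/2..1/2}. norm y \<le> M"
    unfolding bounded_pos by blast
  have M: "\<bar>r x\<bar> \<le> M" if "x \<in> {-1/2..1/2}" for x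
    using bspec[OF M0(2), of "r x"] that by auto
  define \<tau> where "\<tau> = T (\<epsilon> / 2)"
  have mono: "cos (2 * pi * y) \<le> cos (2 * pi * x)" if "\<bar>x\<bar> \<le> \<bar>y\<bar>" "\<bar>y\<bar> \<le> 1/2" for x y :: real
  proof -
    have "cos (2 * pi * \<bar>y\<bar>) \<le> cos (2 * pi * \<bar>x\<bar>)"
      using that by (intro cos_monotone_0_pi_le) (auto simp: mult_left_mono)
    moreover have "cos (2 * pi * \<bar>u\<bar>) = cos (2 * pi * u)" for u :: real
      by (cases "u \<ge> 0") auto
    ultimately show ?thesis by simp
  qed
  have "cos (2 * pi * \<epsilon>) < cos (2 * pi * (\<epsilon> / 2))"
    using eps by (intro cos_monotone_0_pi) auto
  then have tau: "\<tau> > 1" by (simp add: \<tau>_def T_def)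
  have lower: "r x * T x ^ N \<ge> (if \<bar>x\<bar> \<le> \<epsilon>/2 then \<delta> * \<tau> ^ N else 0) - M"
    if x: "x \<in> {-1/2..1/2}" for x N
  proof (cases "\<bar>x\<bar> \<le> \<epsilon>")
    case True
    have T1: "T x \<ge> 1" using mono[of x \<epsilon>] True eps by (simp add: T_def)
    have rd: "r x \<ge> \<delta>" using rpos True by simp
    show ?thesis
    proof (cases "\<bar>x\<bar> \<le> \<epsilon>/2")
      case small: True
      have "\<tau> \<le> T x" using mono[of x "\<epsilon>/2"] small eps by (simp add: T_def \<tau>_def)
      then have "\<tau> ^ N \<le> T x ^ N" using tau by (intro power_mono) auto
      then have "\<delta> * \<tau> ^ N \<le> r x * T x ^ N"
        using rd \<open>\<delta> > 0\<close> tau by (intro mult_mono) auto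
      then show ?thesis using small M0(1) by simp
    next
      case big: False
      have "0 \<le> r x * T x ^ N" using rd \<open>\<delta> > 0\<close> T1 by simp
      then show ?thesis using big M0(1) by simp
    qed
  next
    case False
    have "T x \<le> 1" using mono[of \<epsilon> x] False x eps by (auto simp: T_def)
    moreover have "T x \<ge> -1"
      using cos_ge_minus_one[of "2*pi*x"] cos_le_one[of "2*pi*\<epsilon>"] by (simp only: T_def)
    ultimately have "\<bar>T x\<bar> \<le> 1" by linarith
    then have "\<bar>r x * T x ^ N\<bar> \<le> M * 1"
      unfolding abs_mult power_abs using M[OF x] M0(1) by (intro mult_mono power_le_one) auto
    then show ?thesis using False eps by auto
  qed
  have "\<delta> * \<tau> ^ N * \<epsilon> - M \<le> 0" for N
  proof -
    have "((\<lambda>x. if x \<in> {-\<epsilon>/2..\<epsilon>/2} then \<delta> * \<tau> ^ N else 0) has_integral (\<delta> * \<tau> ^ N * \<epsilon>)) {-1/2..1/2}"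
      using has_integral_const_real[of "\<delta> * \<tau> ^ N" "-\<epsilon>/2" "\<epsilon>/2"] eps
      by (subst has_integral_restrict) (auto simp: mult.commute)
    then have "((\<lambda>x. (if x \<in> {-\<epsilon>/2..\<epsilon>/2} then \<delta> * \<tau> ^ N else 0) - M) has_integral (\<delta> * \<tau> ^ N * \<epsilon> - M)) {-1/2..1/2}"
      using has_integral_const_real[of M "-1/2" "1/2"] by (intro has_integral_diff) auto
    then show ?thesis
      by (rule has_integral_le[OF _ zr[of N]]) (use lower[of _ N] in \<open>force split: if_splits\<close>)
  qed
  then have bd: "\<delta> * \<tau> ^ N * \<epsilon> \<le> M" for N by (simp add: algebra_simps)
  obtain N where "\<tau> ^ N > M / (\<delta> * \<epsilon>)"
    using real_arch_pow[OF tau] by blast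
  then have "M < \<tau> ^ N * (\<delta> * \<epsilon>)"
    using \<open>\<delta> > 0\<close> eps(1) by (simp add: pos_divide_less_eq)
  with bd[of N] show False by (simp add: mult_ac)
qed


text \<open>Symmetric partial sums, so that a series over the integers becomes the limit of a sequence.\<close>

definition bisum :: "(int \<Rightarrow> 'a::comm_monoid_add) \<Rightarrow> nat \<Rightarrow> 'a" where
  "bisum F N = F 0 + (\<Sum>k<N. F (int k + 1) + F (- int k - 1))"

lemma bisum_0 [simp]: "bisum F 0 = F 0"
  and bisum_Suc: "bisum F (Suc N) = bisum F N + (F (int N + 1) + F (- int N - 1))"
  by (simp_all add: bisum_def add.assoc)

lemma bisum_delta:
  "bisum (\<lambda>n. if n = k then c else 0) N = (if \<bar>k\<bar> \<le> int N then c else 0)"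
  by (induction N) (auto simp: bisum_Suc)

lemma has_integral_bisum:
  fixes F :: "int \<Rightarrow> real \<Rightarrow> complex"
  assumes "\<And>n. (F n has_integral I n) A"
  shows "((\<lambda>y. bisum (\<lambda>n. F n y) N) has_integral bisum I N) A"
  unfolding bisum_def by (intro has_integral_add has_integral_sum assms) auto

lemma continuous_on_bisum:
  fixes F :: "int \<Rightarrow> real \<Rightarrow> complex"
  assumes "\<And>n. continuous_on A (F n)"
  shows "continuous_on A (\<lambda>y. bisum (\<lambda>n. F n y) N)"
  unfolding bisum_def by (intro continuous_intros assms)

lemma uniform_limit_bisum:
  fixes F :: "int \<Rightarrow> real \<Rightarrow> complex"
  assumes bound: "\<And>n y. y \<in> A \<Longrightarrow> norm (F n y) \<le> C * r ^ nat \<bar>n\<bar>"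
    and r: "0 \<le> r" "r < 1"
  shows "\<exists>S. uniform_limit A (\<lambda>N y. bisum (\<lambda>n. F n y) N) S sequentially"
proof -
  have "uniform_limit A (\<lambda>N y. \<Sum>k<N. F (int k + 1) y + F (- int k - 1) y)
          (\<lambda>y. \<Sum>k. F (int k + 1) y + F (- int k - 1) y) sequentially"
  proof (rule Weierstrass_m_test)
    show "norm (F (int k + 1) y + F (- int k - 1) y) \<le> 2 * C * r * r ^ k" if "y \<in> A" for k y
      using norm_triangle_ineq[of "F (int k + 1) y" "F (- int k - 1) y"]
        bound[OF that, of "int k + 1"] bound[OF that, of "- int k - 1"]
      by (simp add: nat_add_distrib)
    show "summable (\<lambda>k. 2 * C * r * r ^ k)"
      using r by (intro summable_mult summable_geometric) auto
  qed
  then show ?thesis unfolding bisum_def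
    by (intro exI) (rule uniform_limit_add[OF uniform_limit_const])
qed

text \<open>The unit intervals tile the line; this turns the integral of a periodised function over one
period into an integral over the line.\<close>

lemma bisum_integral_unit_intervals:
  fixes F :: "real \<Rightarrow> complex"
  assumes "continuous_on UNIV F"
  shows "bisum (\<lambda>n. integral {-1/2..1/2} (\<lambda>y. F (y + of_int n))) N =
         integral {-(real N + 1/2)..real N + 1/2} F"
proof -
  have int: "F integrable_on {a..b}" for a b
    by (intro integrable_continuous_real continuous_on_subset[OF assms]) auto
  have shift: "integral {-1/2..1/2} (\<lambda>y. F (y + c)) = integral {c-1/2..c+1/2} F" for c
    using integral_shift_real_ivl[of "c-1/2" c "c+1/2" F] by simp
  show ?thesis
  proof (induction N)
    case 0
    then show ?case by simp
  next
    case (Suc N)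
    let ?M = "real N + 1/2"
    have 1: "integral {-(?M+1)..?M+1} F = integral {-(?M+1)..-?M} F + integral {-?M..?M+1} F"
      by (rule Henstock_Kurzweil_Integration.integral_combine[symmetric]) (use int in auto)
    have 2: "integral {-?M..?M+1} F = integral {-?M..?M} F + integral {?M..?M+1} F"
      by (rule Henstock_Kurzweil_Integration.integral_combine[symmetric]) (use int in auto)
    have 3: "integral {-1/2..1/2} (\<lambda>y. F (y + of_int (int N + 1))) = integral {?M..?M+1} F"
      using shift[of "of_int (int N + 1)"] by (simp add: algebra_simps)
    have 4: "integral {-1/2..1/2} (\<lambda>y. F (y + of_int (- int N - 1))) = integral {-(?M+1)..-?M} F"
      using shift[of "of_int (- int N - 1)"] by (simp add: algebra_simps)
    have 5: "integral {-(real (Suc N) + 1/2)..real (Suc N) + 1/2} F = integral {-(?M+1)..?M+1} F"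
      by (simp add: algebra_simps)
    show ?case unfolding bisum_Suc Suc 3 4 5 1 2 by (simp only: ac_simps)
  qed
qed

lemma integral_symmetric_intervals_tendsto:
  fixes F :: "real \<Rightarrow> complex"
  assumes "integrable lborel F"
  shows "(\<lambda>N. integral {-(real N + 1/2)..real N + 1/2} F) \<longlonglongrightarrow> (LINT x|lborel. F x)"
proof -
  have si: "set_integrable lborel {a..b} F" for a b
    using assms by (auto simp: set_integrable_def intro: integrable_mult_indicator)
  have "(\<lambda>N. LINT x|lborel. indicator {-(real N + 1/2)..real N + 1/2} x *\<^sub>R F x) \<longlonglongrightarrow> (LINT x|lborel. F x)"
  proof (rule integral_dominated_convergence)
    show "integrable lborel (\<lambda>x. norm (F x))" using assms by simp
    show "F \<in> borel_measurable lborel" using assms by simp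
    show "(\<lambda>x. indicator {-(real N + 1/2)..real N + 1/2} x *\<^sub>R F x) \<in> borel_measurable lborel" for N
      using assms by (intro borel_measurable_scaleR borel_measurable_indicator) auto
    show "AE x in lborel. norm (indicator {-(real N + 1/2)..real N + 1/2} x *\<^sub>R F x) \<le> norm (F x)" for N
      by (auto simp: indicator_def)
    show "AE x in lborel. (\<lambda>N. indicator {-(real N + 1/2)..real N + 1/2} x *\<^sub>R F x) \<longlonglongrightarrow> F x"
    proof (intro AE_I2)
      fix x :: real
      obtain K where "\<bar>x\<bar> \<le> real K" using real_arch_simple by blast
      then have "indicator {-(real N + 1/2)..real N + 1/2} x *\<^sub>R F x = F x" if "N \<ge> K" for N
        using that by (auto simp: indicator_def)
      then show "(\<lambda>N. indicator {-(real N + 1/2)..real N + 1/2} x *\<^sub>R F x) \<longlonglongrightarrow> F x"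
        by (intro tendsto_eventually eventually_sequentiallyI[of K])
    qed
  qed
  then show ?thesis
    using set_borel_integral_eq_integral(2)[OF si] by (simp add: set_lebesgue_integral_def)
qed

text \<open>After the substitution \<open>y = - x + s u\<close> with \<open>s\<^sup>2 = t / (2 \<pi>)\<close> the integrand is a constant times the
standard normal density times a character, so the value is read off from the characteristic
function of the normal distribution.\<close>

lemma gaussian_fourier:
  fixes t x m :: real
  assumes t: "t > 0"
  defines "F \<equiv> (\<lambda>y. of_real (exp (- pi * (x + y)\<^sup>2 / t)) * cis (2 * pi * m * y))"
  shows "integrable lborel F"
    and "(LINT y|lborel. F y) = of_real (sqrt t * exp (- pi * m\<^sup>2 * t)) * cis (- (2 * pi * m * x))"
proof -
  interpret S: real_distribution std_normal_distribution by (rule real_dist_normal_dist)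
  define s where "s = sqrt (t / (2 * pi))"
  have s: "s > 0" "s\<^sup>2 = t / (2 * pi)" using t by (simp_all add: s_def)
  let ?c = "2 * pi * m * s"
  have chr: "(LINT u|lborel. std_normal_density u *\<^sub>R iexp (?c * u)) = of_real (exp (- ?c\<^sup>2 / 2))"
    using fun_cong[OF char_std_normal_distribution, of ?c] unfolding char_def
    by (subst (asm) integral_density) auto
  have intg: "integrable lborel (\<lambda>u. std_normal_density u *\<^sub>R iexp (?c * u))"
  proof -
    have "integrable std_normal_distribution (\<lambda>u. iexp (?c * u))"
      by (rule S.integrable_iexp) (auto simp: Im_divide)
    then show ?thesis by (subst (asm) integrable_density) auto
  qed
  have F: "F (- x + s * u) = (of_real (sqrt (2 * pi)) * cis (- (2 * pi * m * x))) *
      (std_normal_density u *\<^sub>R iexp (?c * u))" for u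
  proof -
    have "- pi * (s * u)\<^sup>2 / t = - u\<^sup>2 / 2"
      using t by (simp add: power_mult_distrib s(2))
    then show ?thesis
      by (simp add: F_def std_normal_density_def cis_conv_exp scaleR_conv_of_real exp_add[symmetric] algebra_simps)
  qed
  have "integrable lborel (\<lambda>u. F (- x + s * u))"
    unfolding F by (intro integrable_mult_right intg)
  then show "integrable lborel F" using lborel_integrable_real_affine_iff[of s F "-x"] s by simp
  have "(LINT y|lborel. F y) = \<bar>s\<bar> *\<^sub>R (LINT u|lborel. F (- x + s * u))"
    using s by (intro lborel_integral_real_affine) auto
  also have "\<dots> = of_real (s * sqrt (2 * pi) * exp (- ?c\<^sup>2 / 2)) * cis (- (2 * pi * m * x))"
    unfolding F integral_mult_right_zero chr using s by (simp add: scaleR_conv_of_real)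
  also have "s * sqrt (2 * pi) = sqrt t" by (simp add: s_def real_sqrt_mult[symmetric])
  also have "- ?c\<^sup>2 / 2 = - pi * m\<^sup>2 * t"
    by (simp add: power_mult_distrib s(2)) (simp add: power2_eq_square)
  finally show "(LINT y|lborel. F y) = of_real (sqrt t * exp (- pi * m\<^sup>2 * t)) * cis (- (2 * pi * m * x))" .
qed

lemma has_integral_cis_unit:
  fixes k :: int
  shows "((\<lambda>y. cis (2 * pi * of_int k * y)) has_integral (if k = 0 then 1 else 0)) {-1/2..1/2}"
proof (cases "k = 0")
  case True
  then show ?thesis using has_integral_const_real[of "1::complex" "-1/2" "1/2"] by simp
next
  case False
  define a where "a = 2 * pi * of_int k"
  have "a \<noteq> 0" using False by (simp add: a_def)
  have "((\<lambda>y. cis (a * y)) has_integral (cis (a * (1/2)) / (\<i> * a) - cis (a * (-1/2)) / (\<i> * a))) {-1/2..1/2}"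
  proof (rule fundamental_theorem_of_calculus)
    show "((\<lambda>y. cis (a * y) / (\<i> * a)) has_vector_derivative cis (a * y)) (at y within {-1/2..1/2})" for y
    proof -
      have "((\<lambda>z. exp (\<i> * (of_real a * z)) / (\<i> * a)) has_field_derivative exp (\<i> * (of_real a * of_real y))) (at (of_real y))"
        using \<open>a \<noteq> 0\<close> by (auto intro!: derivative_eq_intros simp: field_simps)
      then show ?thesis
        using has_vector_derivative_real_field by (fastforce simp: cis_conv_exp)
    qed
  qed auto
  moreover have "cis (a * (1/2)) = cis (a * (-1/2))"
  proof -
    have "cis (a * (1/2)) = cis (a * (-1/2)) * cis (2 * pi * of_int k)"
      unfolding cis_mult by (simp add: a_def)
    then show ?thesis by (simp add: cis_multiple_2pi)
  qed
  ultimately show ?thesis using False by (simp add: a_def)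
qed


text \<open>Poisson summation. Replace \<open>x\<close> by \<open>x + y\<close> in both series. The two functions \<open>g\<close> and \<open>h\<close> of \<open>y\<close> obtained
in this way are continuous and have the same Fourier coefficients, hence agree at \<open>y = 0\<close>.\<close>

lemma poisson_gaussian:
  fixes t x :: real
  assumes t: "t > 0"
  shows "\<exists>S::complex. (\<lambda>N. bisum (\<lambda>n. of_real (exp (- pi * (x + of_int n)\<^sup>2 / t))) N) \<longlonglongrightarrow> S \<and>
     (\<lambda>N. bisum (\<lambda>n. of_real (sqrt t * exp (- pi * (of_int n)\<^sup>2 * t)) * cis (2 * pi * of_int n * x)) N) \<longlonglongrightarrow> S"
proof -
  let ?I = "{-1/2..1/2::real}"
  define G where "G y = complex_of_real (exp (- pi * (x + y)\<^sup>2 / t))" for y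
  define H where "H n y = complex_of_real (sqrt t * exp (- pi * (of_int n)\<^sup>2 * t)) * cis (2 * pi * of_int n * (x + y))"
    for n :: int and y
  have contG: "continuous_on A (\<lambda>y. G (y + c))" for A c
    unfolding G_def by (intro continuous_intros) (use t in auto)
  have contH: "continuous_on A (H n)" for A n
    unfolding H_def by (intro continuous_intros)
  have contc: "continuous_on A (\<lambda>x. cis (2 * pi * of_int n * x))" for A :: "real set" and n :: int
    by (intro continuous_intros)
  have abs_sq: "\<bar>real_of_int n\<bar> \<le> (real_of_int n)\<^sup>2" for n
  proof -
    have "\<bar>n\<bar> \<le> n\<^sup>2" by (cases "n = 0") (auto simp: power2_eq_square abs_le_square_iff[symmetric] self_le_power mult_le_cancel_left1 abs_mult_self_eq[symmetric, of n] simp del: abs_mult_self_eq)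
    then show ?thesis by (metis of_int_abs of_int_le_iff of_int_power)
  qed
  have expabs: "exp (- (c * \<bar>real_of_int n\<bar>)) = exp (- c) ^ nat \<bar>n\<bar>" for c n
    by (simp add: exp_of_nat_mult[symmetric] mult.commute)
  obtain g where g: "uniform_limit ?I (\<lambda>N y. bisum (\<lambda>n. G (y + of_int n)) N) g sequentially"
  proof -
    have "norm (G (y + of_int n)) \<le> exp (pi * (\<bar>x\<bar> + 1)\<^sup>2 / t) * exp (- (pi / (2 * t))) ^ nat \<bar>n\<bar>"
      if y: "y \<in> ?I" for n y
    proof -
      let ?n = "real_of_int n"
      have "(x + y)\<^sup>2 \<le> (\<bar>x\<bar> + 1)\<^sup>2"
        using y by (intro power2_le_iff_abs_le[THEN iffD2]) auto
      moreover have "(x + (y + ?n))\<^sup>2 \<ge> ?n\<^sup>2 / 2 - (x + y)\<^sup>2"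
        using zero_le_power2[of "?n + 2 * (x + y)"] by (simp add: power2_eq_square algebra_simps)
      ultimately have "(x + (y + ?n))\<^sup>2 \<ge> \<bar>?n\<bar> / 2 - (\<bar>x\<bar> + 1)\<^sup>2"
        using abs_sq[of n] by linarith
      then have "- pi / t * (x + (y + ?n))\<^sup>2 \<le> - pi / t * (\<bar>?n\<bar> / 2 - (\<bar>x\<bar> + 1)\<^sup>2)"
        using t by (intro mult_left_mono_neg) auto
      also have "\<dots> = pi * (\<bar>x\<bar> + 1)\<^sup>2 / t + - (pi / (2 * t) * \<bar>?n\<bar>)"
        using t by (simp add: field_simps)
      finally have "exp (- pi / t * (x + (y + ?n))\<^sup>2) \<le> exp (pi * (\<bar>x\<bar> + 1)\<^sup>2 / t) * exp (- (pi / (2 * t) * \<bar>?n\<bar>))"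
        unfolding exp_add[symmetric] by simp
      then show ?thesis unfolding expabs by (simp add: G_def)
    qed
    from uniform_limit_bisum[where A = ?I and F = "\<lambda>n y. G (y + of_int n)", OF this] t
    show ?thesis using that by auto
  qed
  obtain h where h: "uniform_limit ?I (\<lambda>N y. bisum (\<lambda>n. H n y) N) h sequentially"
  proof -
    have "norm (H n y) \<le> sqrt t * exp (- (pi * t)) ^ nat \<bar>n\<bar>" for n y
    proof -
      have "pi * t * \<bar>real_of_int n\<bar> \<le> pi * t * (real_of_int n)\<^sup>2"
        using abs_sq[of n] t by (intro mult_left_mono) auto
      then have "exp (- pi * (real_of_int n)\<^sup>2 * t) \<le> exp (- (pi * t * \<bar>real_of_int n\<bar>))"
        by (simp add: algebra_simps)
      then show ?thesis unfolding expabs using t by (simp add: H_def norm_mult)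
    qed
    from uniform_limit_bisum[where A = ?I and F = H, OF this] t
    show ?thesis using that by auto
  qed
  define d where "d y = g y - h y" for y
  have contd: "continuous_on ?I d"
    unfolding d_def
    by (intro continuous_on_diff uniform_limit_theorem[OF _ g] uniform_limit_theorem[OF _ h]
        always_eventually allI continuous_on_bisum contG contH) auto
  have "integral ?I (\<lambda>y. d y * cis (2 * pi * of_int m * y)) = 0" for m
  proof -
    let ?e = "\<lambda>y. cis (2 * pi * of_int m * y)"
    let ?c = "complex_of_real (sqrt t * exp (- pi * (of_int m)\<^sup>2 * t)) * cis (- (2 * pi * of_int m * x))"
    have bnd: "bounded (f ` ?I)" if "continuous_on ?I f" for f :: "real \<Rightarrow> complex"
      using that by (intro compact_imp_bounded compact_continuous_image) auto
    have contg: "continuous_on ?I g" and conth: "continuous_on ?I h"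
      by (rule uniform_limit_theorem[OF _ g] uniform_limit_theorem[OF _ h];
          auto intro!: always_eventually continuous_on_bisum contG contH)+
    have ul_g: "uniform_limit ?I (\<lambda>N y. bisum (\<lambda>n. G (y + of_int n)) N * ?e y) (\<lambda>y. g y * ?e y) sequentially"
      by (intro uniform_lim_mult g uniform_limit_const bnd contg contc)
    have ul_h: "uniform_limit ?I (\<lambda>N y. bisum (\<lambda>n. H n y) N * ?e y) (\<lambda>y. h y * ?e y) sequentially"
      by (intro uniform_lim_mult h uniform_limit_const bnd conth contc)
    obtain I J where IJ: "\<And>N. ((\<lambda>y. bisum (\<lambda>n. G (y + of_int n)) N * ?e y) has_integral I N) ?I"
        "((\<lambda>y. g y * ?e y) has_integral J) ?I" "I \<longlonglongrightarrow> J"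
      by (rule uniform_limit_integral[OF ul_g]) (auto intro!: continuous_intros continuous_on_bisum contG)
    obtain I' J' where IJ': "\<And>N. ((\<lambda>y. bisum (\<lambda>n. H n y) N * ?e y) has_integral I' N) ?I"
        "((\<lambda>y. h y * ?e y) has_integral J') ?I" "I' \<longlonglongrightarrow> J'"
      by (rule uniform_limit_integral[OF ul_h]) (auto intro!: continuous_intros continuous_on_bisum contH)
    have "I N = integral {-(real N + 1/2)..real N + 1/2} (\<lambda>y. G y * ?e y)" for N
    proof -
      have "bisum (\<lambda>n. G (y + of_int n)) N * ?e y = bisum (\<lambda>n. G (y + of_int n) * ?e (y + of_int n)) N" for y
      proof -
        have "?e (y + of_int n) = ?e y" for n
        proof -
          have "?e (y + of_int n) = ?e y * cis (2 * pi * of_int (m * n))"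
            unfolding cis_mult by (simp add: algebra_simps)
          then show ?thesis by (simp add: cis_multiple_2pi)
        qed
        then show ?thesis by (simp add: bisum_def sum_distrib_right distrib_right)
      qed
      then have "((\<lambda>y. bisum (\<lambda>n. G (y + of_int n) * ?e (y + of_int n)) N) has_integral I N) ?I"
        using IJ(1)[of N] by simp
      moreover have "((\<lambda>y. bisum (\<lambda>n. G (y + of_int n) * ?e (y + of_int n)) N) has_integral
          bisum (\<lambda>n. integral ?I (\<lambda>y. G (y + of_int n) * ?e (y + of_int n))) N) ?I"
        by (intro has_integral_bisum integrable_integral integrable_continuous_real continuous_intros contG)
      ultimately have "I N = bisum (\<lambda>n. integral ?I (\<lambda>y. G (y + of_int n) * ?e (y + of_int n))) N"
        by (rule has_integral_unique)
      moreover have "continuous_on UNIV (\<lambda>y. G y * ?e y)"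
        using contG[of UNIV 0] by (intro continuous_on_mult contc) simp
      ultimately show ?thesis
        using bisum_integral_unit_intervals[of "\<lambda>y. G y * ?e y" N] by simp
    qed
    then have Ieq: "I = (\<lambda>N. integral {-(real N + 1/2)..real N + 1/2} (\<lambda>y. G y * ?e y))" by (rule ext)
    have "I \<longlonglongrightarrow> ?c"
      unfolding Ieq
      using integral_symmetric_intervals_tendsto[OF gaussian_fourier(1)[OF t, of x "of_int m"]]
        gaussian_fourier(2)[OF t, of x "of_int m"] by (simp add: G_def)
    with IJ(3) have J: "J = ?c" by (rule LIMSEQ_unique)
    have "I' N = (if \<bar>-m\<bar> \<le> int N then ?c else 0)" for N
    proof -
      have "((\<lambda>y. H n y * ?e y) has_integral (if n = -m then ?c else 0)) ?I" for n
      proof -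
        have "H n y * ?e y = (of_real (sqrt t * exp (- pi * (of_int n)\<^sup>2 * t)) * cis (2 * pi * of_int n * x)) *
            cis (2 * pi * of_int (n + m) * y)" for y
          by (simp add: H_def cis_mult mult.assoc distrib_left distrib_right add.assoc)
        moreover have "((\<lambda>y. (of_real (sqrt t * exp (- pi * (of_int n)\<^sup>2 * t)) * cis (2 * pi * of_int n * x)) *
            cis (2 * pi * of_int (n + m) * y)) has_integral
            ((of_real (sqrt t * exp (- pi * (of_int n)\<^sup>2 * t)) * cis (2 * pi * of_int n * x)) * (if n + m = 0 then 1 else 0))) ?I"
          by (intro has_integral_mult_right has_integral_cis_unit)
        moreover have "n + m = 0 \<longleftrightarrow> n = - m" by linarith
        ultimately show ?thesis by (auto split: if_splits)
      qed
      then have "((\<lambda>y. bisum (\<lambda>n. H n y * ?e y) N) has_integral bisum (\<lambda>n. if n = -m then ?c else 0) N) ?I"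
        by (rule has_integral_bisum)
      moreover have "bisum (\<lambda>n. H n y * ?e y) N = bisum (\<lambda>n. H n y) N * ?e y" for y
        by (simp add: bisum_def sum_distrib_right distrib_right)
      ultimately show ?thesis using IJ'(1)[of N] unfolding bisum_delta by (simp add: has_integral_unique)
    qed
    then have "I' \<longlonglongrightarrow> ?c"
      by (intro tendsto_eventually eventually_sequentiallyI[of "nat \<bar>m\<bar>"]) auto
    with IJ'(3) have J': "J' = ?c" by (rule LIMSEQ_unique)
    have "((\<lambda>y. g y * ?e y - h y * ?e y) has_integral (J - J')) ?I"
      by (intro has_integral_diff IJ IJ')
    then show ?thesis unfolding J J' d_def by (simp add: left_diff_distrib integral_unique)
  qed
  then have "d 0 = 0" by (rule fourier_coefficients_zero_imp_zero[OF contd])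
  then have "g 0 = h 0" by (simp add: d_def)
  moreover have "(\<lambda>N. bisum (\<lambda>n. G (0 + of_int n)) N) \<longlonglongrightarrow> g 0"
    using tendsto_uniform_limitI[OF g, of 0] by simp
  moreover have "(\<lambda>N. bisum (\<lambda>n. H n 0) N) \<longlonglongrightarrow> h 0"
    using tendsto_uniform_limitI[OF h, of 0] by simp
  ultimately show ?thesis by (auto simp: G_def H_def)
qed

section \<open>Gauss's product for the triangular series\<close>

definition triangular_fps :: "complex fps" where
  "triangular_fps = Abs_fps (\<lambda>n. if \<exists>k. n = k * (k + 1) div 2 then 1 else 0)"

text \<open>The theta constants are \<open>theta3 = 1 + 2 \<Sum> p ^ (n\<^sup>2)\<close> with \<open>p = exp (\<pi> i z)\<close>, and \<open>theta2\<close>, which is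
\<open>2 p ^ (1/4)\<close> times the triangular series in \<open>p\<^sup>2\<close>.\<close>

definition square_fps :: "complex fps" where
  "square_fps = Abs_fps (\<lambda>n. if \<exists>k. n = (Suc k)\<^sup>2 then 1 else 0)"

lemma triangular_fps_0: "fps_nth triangular_fps 0 = 1"
  by (auto simp: triangular_fps_def intro: exI[of _ 0])

lemma fps_conv_radius_ge_1_if_bounded:
  fixes f :: "complex fps"
  assumes "\<And>n. norm (fps_nth f n) \<le> C"
  shows "fps_conv_radius f \<ge> 1"
  unfolding fps_conv_radius_def
proof (rule conv_radius_geI_ex')
  fix r :: real assume r: "0 < r" "ereal r < 1"
  show "summable (\<lambda>n. fps_nth f n * complex_of_real r ^ n)"
  proof (rule summable_comparison_test')
    show "summable (\<lambda>n. C * r ^ n)" using r by (intro summable_mult summable_geometric) auto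
    show "norm (fps_nth f n * complex_of_real r ^ n) \<le> C * r ^ n" for n
      using assms[of n] r by (simp add: norm_mult norm_power mult_right_mono)
  qed
qed

lemma fps_conv_radius_triangular: "fps_conv_radius triangular_fps \<ge> 1"
  and fps_conv_radius_square: "fps_conv_radius square_fps \<ge> 1"
  by (rule fps_conv_radius_ge_1_if_bounded[of _ 1]; simp add: triangular_fps_def square_fps_def)+

lemma sums_eval_fps_1:
  assumes "fps_conv_radius f \<ge> 1" "norm (z::complex) < 1"
  shows "(\<lambda>n. fps_nth f n * z ^ n) sums eval_fps f z"
  using assms by (intro sums_eval_fps) (simp add: less_le_trans[of _ 1])

lemma strict_mono_triangular: "strict_mono (\<lambda>k::nat. k * (k + 1) div 2)"
  by (intro strict_monoI_Suc) simp

lemma strict_mono_Suc_square: "strict_mono (\<lambda>k::nat. (Suc k)\<^sup>2)"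
  by (intro strict_monoI_Suc) (simp add: power2_eq_square)

lemma triangular_sums:
  assumes "norm z < 1"
  shows "(\<lambda>k. z ^ (k * (k + 1) div 2)) sums eval_fps triangular_fps z"
proof -
  have "(\<lambda>k. fps_nth triangular_fps (k * (k + 1) div 2) * z ^ (k * (k + 1) div 2)) sums eval_fps triangular_fps z"
    by (subst sums_mono_reindex[OF strict_mono_triangular, of "\<lambda>n. fps_nth triangular_fps n * z ^ n"])
      (auto simp: triangular_fps_def intro!: sums_eval_fps_1[OF fps_conv_radius_triangular assms, unfolded triangular_fps_def, simplified])
  moreover have "fps_nth triangular_fps (k * (k + 1) div 2) = 1" for k
    by (auto simp: triangular_fps_def)
  ultimately show ?thesis by simp
qed

lemma square_sums:
  assumes "norm z < 1"
  shows "(\<lambda>k. z ^ ((Suc k)\<^sup>2)) sums eval_fps square_fps z"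
proof -
  have "(\<lambda>k. fps_nth square_fps ((Suc k)\<^sup>2) * z ^ ((Suc k)\<^sup>2)) sums eval_fps square_fps z"
    by (subst sums_mono_reindex[OF strict_mono_Suc_square, of "\<lambda>n. fps_nth square_fps n * z ^ n"])
      (auto simp: square_fps_def intro!: sums_eval_fps_1[OF fps_conv_radius_square assms, unfolded square_fps_def, simplified])
  moreover have "fps_nth square_fps ((Suc k)\<^sup>2) = 1" for k
    by (auto simp: square_fps_def)
  ultimately show ?thesis by simp
qed

text \<open>A finite form, due to Shanks, of Gauss's product
\<open>\<Sum> q ^ (s (s + 1) / 2) = \<Prod> (1 - q ^ (2 j)) / (1 - q ^ (2 j - 1))\<close>. On the right the term \<open>s = 0\<close> is the
numerator of the product and all other terms are divisible by \<open>q ^ (2 n + 1)\<close>. Denominators are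
cleared, so that the identity can be used both for complex \<open>q\<close> and for the formal variable. In the
induction step consecutive right hand sides differ by a sum that telescopes through \<open>D\<close>.\<close>

lemma gauss_shanks_identity:
  fixes q :: "'a::comm_ring_1"
  shows "(\<Sum>s<2*n. q ^ (s * (s + 1) div 2)) * (\<Prod>j=1..n. 1 - q ^ (2 * j - 1)) =
    (\<Sum>s<n. (\<Prod>j=Suc s..n. 1 - q ^ (2 * j)) * (\<Prod>j=1..s. 1 - q ^ (2 * j - 1)) * q ^ (s * (2 * n + 1)))"
proof (induction n)
  case 0
  then show ?case by simp
next
  case (Suc n)
  define E where "E s = (\<Prod>j=Suc s..n. 1 - q ^ (2 * j))" for s
  define P where "P s = (\<Prod>j=1..s. 1 - q ^ (2 * j - 1))" for s
  define D where "D s = E s * P s * q ^ (s * (2 * n + 1)) * (1 - q ^ (2 * s))" for s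
  have E_Suc: "E s = (1 - q ^ (2 * s + 2)) * E (Suc s)" if "s < n" for s
    using that unfolding E_def by (subst prod.atLeast_Suc_atMost) (auto simp: algebra_simps)
  have P_Suc: "P (Suc s) = P s * (1 - q ^ (2 * s + 1))" for s
    by (simp add: P_def)
  have E_ext: "(\<Prod>j=Suc s..Suc n. 1 - q ^ (2 * j)) = E s * (1 - q ^ (2 * n + 2))" if "s \<le> n" for s
    using that by (simp add: E_def)
  have E_n: "E n = 1" by (simp add: E_def)
  have step: "E s * (1 - q ^ (2 * n + 2)) * P s * q ^ (s * (2 * n + 3)) =
      (E s * P s * q ^ (s * (2 * n + 1))) * (1 - q ^ (2 * n + 1)) + (D (Suc s) - D s)" if "s < n" for s
  proof -
    have a: "q ^ (s * (2 * n + 3)) = q ^ (s * (2 * n + 1)) * q ^ (2 * s)"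
      by (simp add: power_add[symmetric] algebra_simps)
    have b: "q ^ (Suc s * (2 * n + 1)) = q ^ (s * (2 * n + 1)) * q ^ (2 * n + 1)"
      by (simp add: power_add[symmetric] algebra_simps)
    have c: "q ^ (2 * n + 2) = q * q ^ (2 * n + 1)" "q ^ (2 * s + 1) = q * q ^ (2 * s)"
       by simp_all
    have d: "D (Suc s) = E s * P s * (1 - q ^ (2 * s + 1)) * (q ^ (s * (2 * n + 1)) * q ^ (2 * n + 1))"
      unfolding D_def b[symmetric] E_Suc[OF that] P_Suc by (simp add: mult_ac)
    have "e * (1 - q * u) * p * (x * y) = (e * p * x) * (1 - u) + (e * p * (1 - q * y) * (x * u) - e * p * x * (1 - y))"
      for e p x y u
      by (simp add: algebra_simps)
    then show ?thesis unfolding a d c unfolding D_def by blast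
  qed
  have "(\<Sum>s<n. D (Suc s) - D s) = D n"
    by (subst sum_lessThan_telescope) (simp add: D_def)
  then have D_n: "(\<Sum>s<n. D (Suc s) - D s) = P n * q ^ (n * (2 * n + 1)) * (1 - q ^ (2 * n))"
    by (simp add: D_def E_n)
  have tri: "2 * n * (2 * n + 1) div 2 = n * (2 * n + 1)"
    "(2 * n + 1) * (2 * n + 1 + 1) div 2 = n * (2 * n + 1) + (2 * n + 1)"
    by (simp_all add: algebra_simps)
  have "(\<Sum>s<2 * Suc n. f s) = (\<Sum>s<2 * n. f s) + f (2 * n) + f (2 * n + 1)" for f :: "nat \<Rightarrow> 'a"
    by simp
  then have "(\<Sum>s<2 * Suc n. q ^ (s * (s + 1) div 2)) =
      (\<Sum>s<2 * n. q ^ (s * (s + 1) div 2)) + q ^ (n * (2 * n + 1)) + q ^ (n * (2 * n + 1)) * q ^ (2 * n + 1)"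
    by (simp only: tri power_add)
  note * = this
  have "(\<Sum>s<2 * Suc n. q ^ (s * (s + 1) div 2)) * P (Suc n) =
      ((\<Sum>s<2 * n. q ^ (s * (s + 1) div 2)) * P n) * (1 - q ^ (2 * n + 1)) +
      q ^ (n * (2 * n + 1)) * (1 + q ^ (2 * n + 1)) * (1 - q ^ (2 * n + 1)) * P n"
  proof -
    have "(a + x + x * u) * (p * (1 - u)) = (a * p) * (1 - u) + x * (1 + u) * (1 - u) * p" for a x u p :: 'a
      by (simp add: algebra_simps)
    with * show ?thesis unfolding P_Suc by (simp only:)
  qed
  also have "\<dots> = (\<Sum>s<n. (E s * P s * q ^ (s * (2 * n + 1))) * (1 - q ^ (2 * n + 1))) +
      q ^ (n * (2 * n + 1)) * (1 + q ^ (2 * n + 1)) * (1 - q ^ (2 * n + 1)) * P n"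
    using Suc by (simp only: E_def P_def sum_distrib_right)
  also have "\<dots> = (\<Sum>s<n. E s * (1 - q ^ (2 * n + 2)) * P s * q ^ (s * (2 * n + 3))) - (\<Sum>s<n. D (Suc s) - D s) +
      q ^ (n * (2 * n + 1)) * (1 + q ^ (2 * n + 1)) * (1 - q ^ (2 * n + 1)) * P n"
    unfolding sum_subtractf[symmetric] by (intro arg_cong2[where f = "(+)"] sum.cong refl) (use step in simp)
  also have "\<dots> = (\<Sum>s<n. E s * (1 - q ^ (2 * n + 2)) * P s * q ^ (s * (2 * n + 3))) +
      (1 - q ^ (2 * n + 2)) * P n * (q ^ (n * (2 * n + 1)) * q ^ (2 * n))"
  proof -
    have a: "q ^ (2 * n + 2) = q * q * q ^ (2 * n)" "q ^ (2 * n + 1) = q * q ^ (2 * n)"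
      by simp_all
    have "w - p * x * (1 - y) + x * (1 + q * y) * (1 - q * y) * p = w + (1 - q * q * y) * p * (x * y)"
      for w p x y
      by (simp add: algebra_simps)
    then show ?thesis unfolding D_n by (simp only: a)
  qed
  also have "q ^ (n * (2 * n + 1)) * q ^ (2 * n) = q ^ (n * (2 * n + 3))"
    by (simp add: power_add[symmetric] algebra_simps)
  also have "(\<Sum>s<n. E s * (1 - q ^ (2 * n + 2)) * P s * q ^ (s * (2 * n + 3))) +
      (1 - q ^ (2 * n + 2)) * P n * q ^ (n * (2 * n + 3)) =
      (\<Sum>s<Suc n. (\<Prod>j=Suc s..Suc n. 1 - q ^ (2 * j)) * P s * q ^ (s * (2 * Suc n + 1)))"
  proof -
    have e: "2 * Suc n + 1 = 2 * n + 3" by simp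
    have "(\<Sum>s<n. E s * (1 - q ^ (2 * n + 2)) * P s * q ^ (s * (2 * n + 3))) =
       (\<Sum>s<n. (\<Prod>j=Suc s..Suc n. 1 - q ^ (2 * j)) * P s * q ^ (s * (2 * n + 3)))"
      by (intro sum.cong refl) (simp only: lessThan_iff E_ext less_imp_le)
    moreover have "1 - q ^ (2 * n + 2) = (\<Prod>j=Suc n..Suc n. 1 - q ^ (2 * j))"
      by simp
    ultimately show ?thesis unfolding e sum.lessThan_Suc by simp
  qed
  finally show ?case unfolding P_def .
qed

lemma prod_norm_le_exp_geometric:
  fixes q :: complex
  assumes q: "norm q < 1" and g: "inj_on g A" "finite A"
  shows "norm (\<Prod>j\<in>A. 1 - q ^ g j) \<le> exp (1 / (1 - norm q))"
proof -
  have "norm (\<Prod>j\<in>A. 1 - q ^ g j) \<le> (\<Prod>j\<in>A. 1 + norm q ^ g j)"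
    unfolding prod_norm[symmetric]
    by (intro prod_mono conjI norm_ge_zero order_trans[OF norm_triangle_ineq4]) (simp add: norm_power)
  also have "\<dots> \<le> exp (\<Sum>j\<in>A. norm q ^ g j)" by (rule prod_le_exp_sum) simp
  also have "(\<Sum>j\<in>A. norm q ^ g j) = (\<Sum>i\<in>g ` A. norm q ^ i)"
    using g by (simp add: sum.reindex)
  also have "\<dots> \<le> (\<Sum>i. norm q ^ i)"
    using q g by (intro sum_le_suminf summable_geometric) auto
  also have "\<dots> = 1 / (1 - norm q)" using q by (simp add: suminf_geometric)
  finally show ?thesis by simp
qed

text \<open>Let \<open>n\<close> tend to infinity in the preceding identity. If the series vanished at \<open>q\<close>, the left hand side
would tend to 0, as do the terms with \<open>s \<ge> 1\<close>. Then the infinite product of the \<open>1 - q ^ (2 j)\<close> would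
be 0, although it converges absolutely and has no vanishing factor.\<close>

lemma eval_triangular_nonzero:
  assumes q: "norm q < 1"
  shows "eval_fps triangular_fps q \<noteq> 0"
proof
  assume zero: "eval_fps triangular_fps q = 0"
  define K where "K = exp (1 / (1 - norm q))"
  define L where "L n = (\<Sum>s<2*n. q ^ (s * (s + 1) div 2))" for n
  define E where "E n s = (\<Prod>j=Suc s..n. 1 - q ^ (2 * j))" for n s
  define P where "P s = (\<Prod>j=1..s. 1 - q ^ (2 * j - 1))" for s
  have E_le: "norm (E n s) \<le> K" for n s
    unfolding E_def K_def by (rule prod_norm_le_exp_geometric[OF q]) (auto simp: inj_on_def)
  have P_le: "norm (P s) \<le> K" for s
    unfolding P_def K_def by (rule prod_norm_le_exp_geometric[OF q]) (auto simp: inj_on_def)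
  have "(\<lambda>n. \<Sum>s<n. q ^ (s * (s + 1) div 2)) \<longlonglongrightarrow> 0"
    using triangular_sums[OF q] zero by (simp add: sums_def)
  moreover have "strict_mono (\<lambda>n::nat. 2 * n)" by (simp add: strict_mono_def)
  ultimately have "((\<lambda>n. \<Sum>s<n. q ^ (s * (s + 1) div 2)) \<circ> (\<lambda>n. 2 * n)) \<longlonglongrightarrow> 0"
    by (rule LIMSEQ_subseq_LIMSEQ)
  then have L: "L \<longlonglongrightarrow> 0"
    unfolding L_def[abs_def] o_def .
  have LP: "(\<lambda>n. L n * P n) \<longlonglongrightarrow> 0"
  proof (rule Lim_null_comparison)
    show "eventually (\<lambda>n. norm (L n * P n) \<le> norm (L n) * K) sequentially"
      using P_le by (simp add: norm_mult mult_left_mono)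
    show "(\<lambda>n. norm (L n) * K) \<longlonglongrightarrow> 0"
      using L by (intro tendsto_mult_left_zero tendsto_norm_zero)
  qed
  define S where "S n = (\<Sum>s=1..n. E (Suc n) s * P s * q ^ (s * (2 * Suc n + 1)))" for n
  have split: "L (Suc n) * P (Suc n) = E (Suc n) 0 + S n" for n
  proof -
    have "L (Suc n) * P (Suc n) = (\<Sum>s<Suc n. E (Suc n) s * P s * q ^ (s * (2 * Suc n + 1)))"
      using gauss_shanks_identity[of q "Suc n"] by (simp only: L_def P_def E_def)
    also have "{..<Suc n} = insert 0 {1..n}" by auto
    finally show ?thesis by (simp add: S_def P_def)
  qed
  have S_le: "norm (S n) \<le> K * K * (real n * norm q ^ n)" for n
  proof -
    have "norm (S n) \<le> (\<Sum>s=1..n. K * K * norm q ^ n)"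
      unfolding S_def
    proof (rule sum_norm_le)
      fix s assume s: "s \<in> {1..n}"
      have "n \<le> s * (2 * Suc n + 1)" using s by (cases s) auto
      then have "norm q ^ (s * (2 * Suc n + 1)) \<le> norm q ^ n"
        using q by (intro power_decreasing) auto
      then show "norm (E (Suc n) s * P s * q ^ (s * (2 * Suc n + 1))) \<le> K * K * norm q ^ n"
        unfolding norm_mult norm_power using E_le P_le
        by (intro mult_mono) (auto simp: K_def)
    qed
    then show ?thesis by (simp add: mult_ac)
  qed
  have "S \<longlonglongrightarrow> 0"
  proof (rule Lim_null_comparison)
    show "eventually (\<lambda>n. norm (S n) \<le> K * K * (real n * norm q ^ n)) sequentially"
      using S_le by simp
    have "(\<lambda>n. real n * norm q ^ n) \<longlonglongrightarrow> 0"
      using q by (intro powser_times_n_limit_0) auto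
    then show "(\<lambda>n. K * K * (real n * norm q ^ n)) \<longlonglongrightarrow> 0"
      by (rule tendsto_mult_right_zero)
  qed
  then have "(\<lambda>n. L (Suc n) * P (Suc n) - S n) \<longlonglongrightarrow> 0"
    using tendsto_diff[OF LIMSEQ_Suc[OF LP]] by force
  then have "(\<lambda>n. E (Suc n) 0) \<longlonglongrightarrow> 0" by (simp add: split)
  moreover have ne: "- (q ^ (2 * k + 2)) \<noteq> - 1" for k
  proof
    assume "- (q ^ (2 * k + 2)) = - 1"
    then have "norm q ^ (2 * k + 2) = 1" by (metis minus_minus norm_one norm_power)
    then show False using q power_less_one_iff[of "norm q" "2 * k + 2"] by simp
  qed
  have cp: "convergent_prod (\<lambda>j. 1 + - (q ^ (2 * j + 2)))"
  proof (rule summable_imp_convergent_prod_complex[OF _ ne])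
    have "norm (- (q ^ (2 * k + 2))) = (norm q)\<^sup>2 * ((norm q)\<^sup>2) ^ k" for k
      unfolding norm_minus_cancel norm_power power_mult[symmetric] power_add[symmetric]
      by (simp only: add.commute)
    moreover have "summable (\<lambda>k. (norm q)\<^sup>2 * ((norm q)\<^sup>2) ^ k)"
      using q by (intro summable_mult summable_geometric) (simp add: power_less_one_iff)
    ultimately show "summable (\<lambda>k. norm (- (q ^ (2 * k + 2))))" by simp
  qed
  have E0: "E (Suc n) 0 = (\<Prod>j\<le>n. 1 + - (q ^ (2 * j + 2)))" for n
  proof -
    have "E (Suc n) 0 = (\<Prod>j\<in>Suc ` {..n}. 1 - q ^ (2 * j))"
      unfolding E_def image_Suc_atMost One_nat_def ..
    also have "\<dots> = (\<Prod>j\<le>n. 1 + - (q ^ (2 * j + 2)))"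
      by (subst prod.reindex) auto
    finally show ?thesis .
  qed
  have "(\<lambda>n. E (Suc n) 0) \<longlonglongrightarrow> prodinf (\<lambda>j. 1 + - (q ^ (2 * j + 2)))"
    unfolding E0 by (rule convergent_prod_LIMSEQ[OF cp])
  ultimately have "prodinf (\<lambda>j. 1 + - (q ^ (2 * j + 2))) = 0"
    using LIMSEQ_unique by blast
  moreover have "prodinf (\<lambda>j. 1 + - (q ^ (2 * j + 2))) \<noteq> 0"
  proof (rule prodinf_nonzero[OF cp])
    show "1 + - (q ^ (2 * i + 2)) \<noteq> 0" for i
      using ne[of i] by (metis add_eq_0_iff2 add.inverse_inverse)
  qed
  ultimately show False by simp
qed


section \<open>Power series with alternating signs\<close>

text \<open>The series has nonnegative coefficients after the substitution of \<open>- X\<close> for \<open>X\<close>.\<close>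

definition fps_alternating :: "complex fps \<Rightarrow> bool" where
  "fps_alternating f \<longleftrightarrow> (\<forall>n. (-1) ^ n * fps_nth f n \<in> \<real>\<^sub>\<ge>\<^sub>0)"

lemma fps_alternatingD: "fps_alternating f \<Longrightarrow> (-1) ^ n * fps_nth f n \<in> \<real>\<^sub>\<ge>\<^sub>0"
  by (simp add: fps_alternating_def)

lemma nonneg_Reals_sum: "(\<And>i. i \<in> A \<Longrightarrow> f i \<in> \<real>\<^sub>\<ge>\<^sub>0) \<Longrightarrow> sum f A \<in> (\<real>\<^sub>\<ge>\<^sub>0 :: complex set)"
  by (induction A rule: infinite_finite_induct) auto

lemma signed_fps_mult_nth:
  fixes f g :: "complex fps"
  shows "(-1) ^ n * fps_nth (f * g) n =
    (\<Sum>i=0..n. ((-1) ^ i * fps_nth f i) * ((-1) ^ (n - i) * fps_nth g (n - i)))"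
proof -
  have "(-1) ^ n * (x * y) = ((-1) ^ i * x) * ((-1) ^ (n - i) * y)" if "i \<le> n" for i and x y :: complex
  proof -
    have "(-1 :: complex) ^ n = (-1) ^ i * (-1) ^ (n - i)"
      using that by (simp add: power_add[symmetric])
    then show ?thesis by simp
  qed
  then show ?thesis by (auto simp: fps_mult_nth sum_distrib_left intro!: sum.cong)
qed

lemma fps_alternating_mult:
  assumes "fps_alternating f" "fps_alternating g"
  shows "fps_alternating (f * g)"
  unfolding fps_alternating_def signed_fps_mult_nth
  by (intro allI nonneg_Reals_sum nonneg_Reals_mult_I fps_alternatingD assms)

lemma fps_alternating_1 [simp]: "fps_alternating 1"
  by (simp add: fps_alternating_def)

lemma fps_alternating_power: "fps_alternating f \<Longrightarrow> fps_alternating (f ^ n)"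
  by (induction n) (auto intro: fps_alternating_mult)

text \<open>There is no cancellation in the convolution, because all its terms have the sign \<open>(-1) ^ n\<close>.\<close>

lemma signed_fps_mult_nth_pos:
  assumes "fps_alternating f" "fps_alternating g"
    and "i \<le> n" "fps_nth f i \<noteq> 0" "fps_nth g (n - i) \<noteq> 0"
  shows "fps_nth (f * g) n \<noteq> 0"
proof -
  let ?t = "\<lambda>i. ((-1) ^ i * fps_nth f i) * ((-1) ^ (n - i) * fps_nth g (n - i))"
  have nn: "?t j \<in> \<real>\<^sub>\<ge>\<^sub>0" for j
    by (intro nonneg_Reals_mult_I fps_alternatingD assms)
  have pos: "Re z > 0" if "z \<in> \<real>\<^sub>\<ge>\<^sub>0" "z \<noteq> 0" for z
    using that by (auto simp: complex_nonneg_Reals_iff complex_eq_iff)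
  have "?t i \<noteq> 0" using assms by simp
  then have "Re (?t i) > 0" by (rule pos[OF nn])
  also have "Re (?t i) \<le> (\<Sum>j=0..n. Re (?t j))"
    using assms(3) nn by (intro member_le_sum) (auto simp: complex_nonneg_Reals_iff simp del: times_complex.sel)
  also have "\<dots> = Re ((-1) ^ n * fps_nth (f * g) n)"
    unfolding signed_fps_mult_nth Re_sum ..
  finally show ?thesis by auto
qed

lemma fps_inverse_one_minus_X_power:
  assumes "k > 0"
  shows "inverse (1 - fps_X ^ k :: complex fps) = Abs_fps (\<lambda>n. if k dvd n then 1 else 0)"
proof -
  have "(1 - fps_X ^ k) * Abs_fps (\<lambda>n. if k dvd n then 1 else 0) = (1 :: complex fps)"
  proof (rule fps_ext)
    fix n
    have "k dvd n \<longleftrightarrow> k dvd n - k" if "\<not> n < k"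
      using that by (simp add: dvd_minus_self)
    then show "fps_nth ((1 - fps_X ^ k) * Abs_fps (\<lambda>n. if k dvd n then 1 else 0)) n = fps_nth (1 :: complex fps) n"
      using assms by (auto simp: left_diff_distrib fps_X_power_mult_nth dest: dvd_imp_le)
  qed
  then show ?thesis by (metis fps_inverse_unique)
qed

lemma fps_X_power_dvd_iff_nth:
  "fps_X ^ k dvd (f :: complex fps) \<longleftrightarrow> (\<forall>i<k. fps_nth f i = 0)"
proof
  assume "\<forall>i<k. fps_nth f i = 0"
  then have "f = fps_X ^ k * fps_shift k f"
    by (intro fps_ext) (auto simp: fps_X_power_mult_nth)
  then show "fps_X ^ k dvd f" by (metis dvdI)
qed (auto simp: dvd_def fps_X_power_mult_nth)

text \<open>By Gauss's product the reciprocal agrees modulo \<open>X ^ (2 N + 1)\<close> with the product of the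
\<open>F j = (1 - X ^ (2 j - 1)) / (1 - X ^ (2 j))\<close> for \<open>j \<le> N\<close>. Every factor is alternating, and
\<open>F 1 = 1 / (1 + X)\<close> has no vanishing coefficient.\<close>

lemma inverse_triangular_alternating:
  "fps_alternating (inverse triangular_fps) \<and> fps_nth (inverse triangular_fps) n \<noteq> 0"
proof -
  define R where "R = inverse triangular_fps"
  have R: "R * triangular_fps = 1"
    unfolding R_def by (intro inverse_mult_eq_1) (simp add: triangular_fps_0)
  define F where "F j = (1 - fps_X ^ (2 * j - 1)) * inverse (1 - fps_X ^ (2 * j) :: complex fps)" for j
  have F_alt: "fps_alternating (F j)" if "j > 0" for j
    unfolding F_def
  proof (rule fps_alternating_mult)
    show "fps_alternating (1 - fps_X ^ (2 * j - 1))"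
      using that unfolding fps_alternating_def
      by (auto simp: minus_one_power_iff)
    show "fps_alternating (inverse (1 - fps_X ^ (2 * j)))"
      using that unfolding fps_alternating_def
      by (auto simp: fps_inverse_one_minus_X_power minus_one_power_iff dest: dvd_mult_left)
  qed
  have F1: "fps_nth (F 1) n \<noteq> 0" for n
  proof -
    have "fps_nth (F 1) n = (if even n then 1 else - 1)"
      by (cases n) (auto simp: F_def fps_inverse_one_minus_X_power left_diff_distrib)
    then show ?thesis by simp
  qed
  have prod: "fps_alternating (\<Prod>j=1..N. F j) \<and> (N > 0 \<longrightarrow> (\<forall>n. fps_nth (\<Prod>j=1..N. F j) n \<noteq> 0))" for N
  proof (induction N)
    case 0
    then show ?case by simp
  next
    case (Suc N)
    show ?case
    proof (cases "N = 0")
      case True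
      then show ?thesis using F_alt[of 1] F1 by simp
    next
      case False
      have "fps_nth (F (Suc N)) 0 \<noteq> 0" by (simp add: F_def)
      then have "fps_nth ((\<Prod>j=1..N. F j) * F (Suc N)) n \<noteq> 0" for n
        using Suc False F_alt[of "Suc N"]
        by (intro signed_fps_mult_nth_pos[where i = n]) auto
      moreover have "fps_alternating ((\<Prod>j=1..N. F j) * F (Suc N))"
        using Suc F_alt[of "Suc N"] by (intro fps_alternating_mult) auto
      ultimately show ?thesis by simp
    qed
  qed
  have eq: "fps_nth R n = fps_nth (\<Prod>j=1..N. F j) n" if N: "N \<ge> 1" "n < 2 * N + 1" for n N
  proof -
    let ?X = "fps_X :: complex fps"
    define L where "L = (\<Sum>s<2*N. ?X ^ (s * (s + 1) div 2))"
    define E where "E = (\<Prod>j=Suc 0..N. 1 - ?X ^ (2 * j))"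
    define P where "P = (\<Prod>j=1..N. 1 - ?X ^ (2 * j - 1))"
    have "?X ^ (2 * N + 1) dvd L * P - E"
    proof -
      have "L * P = (\<Sum>s<N. (\<Prod>j=Suc s..N. 1 - ?X ^ (2 * j)) * (\<Prod>j=1..s. 1 - ?X ^ (2 * j - 1)) * ?X ^ (s * (2 * N + 1)))"
        unfolding L_def P_def by (rule gauss_shanks_identity)
      also have "{..<N} = insert 0 {1..<N}" using N by auto
      finally have "L * P - E = (\<Sum>s=1..<N. (\<Prod>j=Suc s..N. 1 - ?X ^ (2 * j)) * (\<Prod>j=1..s. 1 - ?X ^ (2 * j - 1)) * ?X ^ (s * (2 * N + 1)))"
        by (simp add: E_def)
      also have "?X ^ (2 * N + 1) dvd \<dots>"
      proof (intro dvd_sum dvd_mult le_imp_power_dvd)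
        fix s assume "s \<in> {1..<N}"
        then have "1 * (2 * N + 1) \<le> s * (2 * N + 1)" by (intro mult_right_mono) auto
        then show "2 * N + 1 \<le> s * (2 * N + 1)" by simp
      qed
      finally show ?thesis .
    qed
    moreover have "?X ^ (2 * N + 1) dvd triangular_fps - L"
      unfolding fps_X_power_dvd_iff_nth
    proof (intro allI impI)
      fix i assume i: "i < 2 * N + 1"
      have "fps_nth L i = (\<Sum>s<2*N. if i = s * (s + 1) div 2 then 1 else 0)"
        by (simp add: L_def fps_sum_nth)
      also have "\<dots> = (if \<exists>k. i = k * (k + 1) div 2 then 1 else 0)"
      proof (cases "\<exists>k. i = k * (k + 1) div 2")
        case True
        then obtain k where k: "i = k * (k + 1) div 2" by blast
        have "k < 2 * N"
        proof (rule ccontr)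
          assume "\<not> k < 2 * N"
          then have "2 * N * (2 * N + 1) div 2 \<le> i"
            using strict_mono_less_eq[OF strict_mono_triangular, of "2 * N" k] k by simp
          moreover have "2 * N * (2 * N + 1) div 2 = N * (2 * N + 1)" by simp
          moreover have "1 * (2 * N + 1) \<le> N * (2 * N + 1)" using N by (intro mult_right_mono) auto
          ultimately have "1 * (2 * N + 1) \<le> i" by (simp only: le_trans)
          then show False using i by simp
        qed
        moreover have "i = s * (s + 1) div 2 \<longleftrightarrow> s = k" for s
          using strict_mono_eq[OF strict_mono_triangular, of s k] k by auto
        ultimately show ?thesis using True by (simp add: k)
      qed auto
      finally show "fps_nth (triangular_fps - L) i = 0" by (simp add: triangular_fps_def)
    qed
    ultimately have "?X ^ (2 * N + 1) dvd (L * P - E) + (triangular_fps - L) * P"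
      by (intro dvd_add dvd_mult2)
    then have "?X ^ (2 * N + 1) dvd triangular_fps * P - E" by (simp add: algebra_simps)
    moreover define Q where "Q = (\<Prod>j=1..N. F j)"
    have unit: "inverse (1 - ?X ^ (2 * j)) * (1 - ?X ^ (2 * j)) = 1" if "j > 0" for j
      using that by (intro inverse_mult_eq_1) simp
    have "Q * E = P"
      unfolding Q_def E_def P_def One_nat_def prod.distrib[symmetric]
      by (intro prod.cong refl) (simp add: F_def mult.assoc unit)
    moreover have "inverse E * E = 1"
    proof (rule inverse_mult_eq_1)
      have "fps_nth (\<Prod>j\<in>A. 1 - ?X ^ (2 * j)) 0 = 1" if "finite A" "\<forall>j\<in>A. j > 0" for A
        using that by (induction A rule: finite_induct) auto
      then show "fps_nth E 0 \<noteq> 0" by (simp add: E_def)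
    qed
    ultimately have "?X ^ (2 * N + 1) dvd (triangular_fps * (Q * E) - E) * (R * inverse E)"
      by (metis dvd_mult2)
    also have "(triangular_fps * (Q * E) - E) * (R * inverse E) =
        (R * triangular_fps) * Q * (inverse E * E) - R * (inverse E * E)"
      by (simp add: algebra_simps)
    also have "\<dots> = Q - R" by (simp add: R \<open>inverse E * E = 1\<close>)
    finally have "\<forall>i<2 * N + 1. fps_nth (Q - R) i = 0"
      unfolding fps_X_power_dvd_iff_nth .
    then show ?thesis using N by (simp add: Q_def)
  qed
  have "fps_nth R n = fps_nth (\<Prod>j=1..Suc n. F j) n" for n
    by (rule eq) auto
  then show ?thesis unfolding R_def[symmetric] fps_alternating_def
    using prod[of "Suc _"] by (simp add: fps_alternating_def del: prod.cl_ivl_Suc)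
qed

section \<open>Theta constants\<close>

text \<open>The classical constants \<open>\<Sum> exp (\<pi> i n\<^sup>2 z)\<close>, \<open>\<Sum> (-1) ^ n exp (\<pi> i n\<^sup>2 z)\<close> and
\<open>\<Sum> exp (\<pi> i (n + 1/2)\<^sup>2 z)\<close>, summed over all integers \<open>n\<close>, with the terms for opposite exponents
combined. Defining them through power series makes their expansions at infinity available for the
formal part of the argument.\<close>

definition theta3 :: "complex \<Rightarrow> complex" where
  "theta3 z = 1 + 2 * eval_fps square_fps (exp (\<i> * pi * z))"

definition theta4 :: "complex \<Rightarrow> complex" where
  "theta4 z = 1 + 2 * eval_fps square_fps (- exp (\<i> * pi * z))"

definition theta2 :: "complex \<Rightarrow> complex" where
  "theta2 z = 2 * exp (\<i> * pi * z / 4) * eval_fps triangular_fps (exp (2 * of_real pi * \<i> * z))"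

lemma norm_nome: "norm (exp (\<i> * pi * z)) = exp (- pi * Im z)"
  by (simp add: norm_exp_eq_Re)

lemma norm_q: "norm (exp (2 * of_real pi * \<i> * z)) = exp (- (2 * pi * Im z))"
  by (simp add: norm_exp_eq_Re)

lemma norm_nome_less_1: "z \<in> upper_half_plane \<Longrightarrow> norm (exp (\<i> * pi * z)) < 1"
  unfolding norm_nome by (simp add: upper_half_plane_def)

lemma norm_q_less_1: "z \<in> upper_half_plane \<Longrightarrow> norm (exp (2 * of_real pi * \<i> * z)) < 1"
  unfolding norm_q by (simp add: upper_half_plane_def)

lemma in_upper_half_plane: "z \<in> upper_half_plane \<longleftrightarrow> Im z > 0"
  by (simp add: upper_half_plane_def)

lemma open_upper_half_plane: "open upper_half_plane"
  unfolding upper_half_plane_def by (rule open_halfspace_Im_gt)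

lemma connected_upper_half_plane: "connected upper_half_plane"
  unfolding upper_half_plane_def by (intro convex_connected convex_halfspace_Im_gt)

lemma holomorphic_on_eval_fps_compose:
  assumes "fps_conv_radius f \<ge> 1" "g holomorphic_on A" "\<And>z. z \<in> A \<Longrightarrow> norm (g z) < 1"
  shows "(\<lambda>z. eval_fps f (g z)) holomorphic_on A"
proof -
  have "eval_fps f holomorphic_on ball 0 1"
    using assms(1) by (intro holomorphic_on_eval_fps) (auto intro!: less_le_trans[of "ereal _" 1 "fps_conv_radius f"])
  then have "(eval_fps f \<circ> g) holomorphic_on A"
    using assms by (intro holomorphic_on_compose_gen[of g A _ "ball 0 1"]) auto
  then show ?thesis by (simp add: o_def)
qed

lemma holomorphic_theta3: "theta3 holomorphic_on upper_half_plane"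
  unfolding theta3_def[abs_def]
  by (intro holomorphic_intros holomorphic_on_eval_fps_compose fps_conv_radius_square norm_nome_less_1)

lemma holomorphic_theta4: "theta4 holomorphic_on upper_half_plane"
  unfolding theta4_def[abs_def]
  by (intro holomorphic_intros holomorphic_on_eval_fps_compose fps_conv_radius_square)
    (simp only: norm_minus_cancel norm_nome_less_1)

lemma holomorphic_theta2: "theta2 holomorphic_on upper_half_plane"
  unfolding theta2_def[abs_def]
  by (intro holomorphic_intros holomorphic_on_eval_fps_compose fps_conv_radius_triangular norm_q_less_1)
    (auto simp: upper_half_plane_def)

lemma S_upper_half_plane: "z \<in> upper_half_plane \<Longrightarrow> -1/z \<in> upper_half_plane"
  by (simp add: upper_half_plane_def Im_divide power2_eq_square sum_power2_gt_zero_iff)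
    (auto intro!: divide_pos_pos simp: add_nonneg_pos)

lemma T_upper_half_plane: "z \<in> upper_half_plane \<Longrightarrow> z + 1 \<in> upper_half_plane"
  by (simp add: upper_half_plane_def)

lemma theta3_imaginary_axis:
  assumes "s > 0"
  shows "(\<lambda>N. bisum (\<lambda>n. complex_of_real (exp (- pi * (of_int n)\<^sup>2 * s))) N) \<longlonglongrightarrow> theta3 (\<i> * s)"
proof -
  define p where "p = exp (\<i> * pi * (\<i> * s))"
  have p: "p = of_real (exp (- (pi * s)))" by (simp add: p_def exp_of_real[symmetric] algebra_simps)
  have "norm p < 1" using assms by (simp add: p)
  from square_sums[OF this] have "(\<lambda>N. 1 + 2 * (\<Sum>k<N. p ^ ((Suc k)\<^sup>2))) \<longlonglongrightarrow> theta3 (\<i> * s)"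
    unfolding theta3_def p_def[symmetric] sums_def by (intro tendsto_intros)
  moreover have "complex_of_real (exp (- pi * x\<^sup>2 * s)) = p ^ (k\<^sup>2)" if "\<bar>x\<bar> = real k" for x k
  proof -
    have "x\<^sup>2 = real (k\<^sup>2)" using that power2_abs[of x] by (simp only: of_nat_power)
    then have "exp (- pi * x\<^sup>2 * s) = exp (- (pi * s)) ^ (k\<^sup>2)"
      using exp_of_nat_mult[of "k\<^sup>2" "- (pi * s)"] by (simp only: mult_ac mult_minus_left mult_minus_right)
    then show ?thesis unfolding p of_real_power[symmetric] by (rule arg_cong)
  qed
  then have e: "complex_of_real (exp (- pi * (of_int (int k + 1))\<^sup>2 * s)) = p ^ ((Suc k)\<^sup>2)"
    "complex_of_real (exp (- pi * (of_int (- int k - 1))\<^sup>2 * s)) = p ^ ((Suc k)\<^sup>2)" for k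
    by simp_all
  have "bisum (\<lambda>n. complex_of_real (exp (- pi * (of_int n)\<^sup>2 * s))) N = 1 + 2 * (\<Sum>k<N. p ^ ((Suc k)\<^sup>2))" for N
    unfolding bisum_def e by (simp add: sum_distrib_left)
  ultimately show ?thesis by (simp only:)
qed

lemma theta4_imaginary_axis:
  assumes "s > 0"
  shows "(\<lambda>N. bisum (\<lambda>n. complex_of_real (exp (- pi * (of_int n)\<^sup>2 * s)) * cis (2 * pi * of_int n * (1/2))) N) \<longlonglongrightarrow> theta4 (\<i> * s)"
proof -
  define p where "p = - exp (\<i> * pi * (\<i> * s))"
  have p: "p = - of_real (exp (- (pi * s)))" by (simp add: p_def exp_of_real[symmetric] algebra_simps)
  have "norm p < 1" using assms by (simp add: p)
  from square_sums[OF this] have "(\<lambda>N. 1 + 2 * (\<Sum>k<N. p ^ ((Suc k)\<^sup>2))) \<longlonglongrightarrow> theta4 (\<i> * s)"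
    unfolding theta4_def p_def[symmetric] sums_def by (intro tendsto_intros)
  moreover have "complex_of_real (exp (- pi * x\<^sup>2 * s)) * cis (2 * pi * x * (1/2)) = p ^ (k\<^sup>2)"
    if x: "\<bar>x\<bar> = real k" for x k
  proof -
    have "x\<^sup>2 = real (k\<^sup>2)" using that power2_abs[of x] by (simp only: of_nat_power)
    then have "exp (- pi * x\<^sup>2 * s) = exp (- (pi * s)) ^ (k\<^sup>2)"
      using exp_of_nat_mult[of "k\<^sup>2" "- (pi * s)"] by (simp only: mult_ac mult_minus_left mult_minus_right)
    then have "complex_of_real (exp (- pi * x\<^sup>2 * s)) = of_real (exp (- (pi * s))) ^ (k\<^sup>2)"
      unfolding of_real_power[symmetric] by (rule arg_cong)
    moreover have "cis (2 * pi * x * (1/2)) = (-1) ^ (k\<^sup>2)"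
    proof -
      have ck: "cis (pi * real k) = (-1) ^ k"
        using Complex.DeMoivre[of pi k] unfolding cis_pi mult.commute[of pi] by (rule sym)
      moreover have "cis (- (pi * real k)) = (-1) ^ k"
        using arg_cong[OF ck, of cnj] by (simp add: cis_cnj)
      moreover have "x = real k \<or> x = - real k" using x by linarith
      ultimately have "cis (pi * x) = (-1) ^ k" by auto
      then show ?thesis by (simp add: minus_one_power_iff)
    qed
    ultimately show ?thesis
      unfolding p power_minus[of "of_real _" "k\<^sup>2"] by (simp only: mult.commute)
  qed
  then have e: "complex_of_real (exp (- pi * (of_int (int k + 1))\<^sup>2 * s)) * cis (2 * pi * of_int (int k + 1) * (1/2)) = p ^ ((Suc k)\<^sup>2)"
    "complex_of_real (exp (- pi * (of_int (- int k - 1))\<^sup>2 * s)) * cis (2 * pi * of_int (- int k - 1) * (1/2)) = p ^ ((Suc k)\<^sup>2)" for k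
    by simp_all
  have "bisum (\<lambda>n. complex_of_real (exp (- pi * (of_int n)\<^sup>2 * s)) * cis (2 * pi * of_int n * (1/2))) N = 1 + 2 * (\<Sum>k<N. p ^ ((Suc k)\<^sup>2))" for N
    unfolding bisum_def e by (simp add: sum_distrib_left)
  ultimately show ?thesis by (simp only:)
qed

lemma theta2_imaginary_axis:
  assumes "s > 0"
  shows "(\<lambda>N. bisum (\<lambda>n. complex_of_real (exp (- pi * (1/2 + of_int n)\<^sup>2 * s))) N) \<longlonglongrightarrow> theta2 (\<i> * s)"
proof -
  define q where "q = exp (2 * of_real pi * \<i> * (\<i> * s))"
  define c where "c = exp (\<i> * pi * (\<i> * s) / 4)"
  define g where "g k = c * q ^ (k * (k + 1) div 2)" for k
  have q: "q = of_real (exp (- (2 * pi * s)))" by (simp add: q_def exp_of_real[symmetric] algebra_simps)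
  have c: "c = of_real (exp (- (pi * s / 4)))" by (simp add: c_def exp_of_real[symmetric] algebra_simps)
  have "norm q < 1" using assms by (simp add: q)
  from triangular_sums[OF this] have lim: "(\<lambda>N. \<Sum>k<N. g k) \<longlonglongrightarrow> c * eval_fps triangular_fps q"
    unfolding sums_def g_def sum_distrib_left[symmetric] by (intro tendsto_intros)
  have "(\<lambda>N. (\<Sum>k<Suc N. g k) + (\<Sum>k<N. g k)) \<longlonglongrightarrow> c * eval_fps triangular_fps q + c * eval_fps triangular_fps q"
    by (intro tendsto_add lim LIMSEQ_Suc)
  moreover have "complex_of_real (exp (- pi * x\<^sup>2 * s)) = g k" if x: "\<bar>x\<bar> = real k + 1/2" for x k
  proof -
    have "even (k * (k + 1))" by simp
    then have "2 * real (k * (k + 1) div 2) = real (k * (k + 1))"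
      by (metis dvd_mult_div_cancel of_nat_mult of_nat_numeral)
    moreover have "x\<^sup>2 = (real k + 1/2)\<^sup>2" using x power2_abs[of x] by simp
    ultimately have "- pi * x\<^sup>2 * s = - (pi * s / 4) + real (k * (k + 1) div 2) * (- (2 * pi * s))"
      by (simp add: power2_eq_square algebra_simps)
    then have "exp (- pi * x\<^sup>2 * s) = exp (- (pi * s / 4)) * exp (- (2 * pi * s)) ^ (k * (k + 1) div 2)"
      by (simp only: exp_add exp_of_nat_mult)
    then show ?thesis unfolding g_def c q of_real_power[symmetric] of_real_mult[symmetric] by (rule arg_cong)
  qed
  then have e: "complex_of_real (exp (- pi * (1/2 + of_int (int k + 1))\<^sup>2 * s)) = g (Suc k)"
    "complex_of_real (exp (- pi * (1/2 + of_int (- int k - 1))\<^sup>2 * s)) = g k"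
    "complex_of_real (exp (- pi * (1/2 + of_int 0)\<^sup>2 * s)) = g 0" for k
    by simp_all
  have "bisum (\<lambda>n. complex_of_real (exp (- pi * (1/2 + of_int n)\<^sup>2 * s))) N = (\<Sum>k<Suc N. g k) + (\<Sum>k<N. g k)" for N
    unfolding bisum_def e sum.distrib sum.lessThan_Suc_shift[of g] by (simp only: add.assoc o_def)
  ultimately show ?thesis unfolding theta2_def q_def[symmetric] c_def[symmetric]
    by (simp only: mult_2 distrib_right)
qed

text \<open>Poisson summation at \<open>x = 0\<close> and at \<open>x = 1/2\<close>.\<close>

lemma theta_inversion_imaginary_axis:
  assumes "t > 0"
  shows "theta3 (\<i> * of_real (1 / t)) = of_real (sqrt t) * theta3 (\<i> * t)"
    and "theta2 (\<i> * of_real (1 / t)) = of_real (sqrt t) * theta4 (\<i> * t)"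
proof -
  have lim_eq: "x = y" if "A \<longlonglongrightarrow> S" "B \<longlonglongrightarrow> S" "A \<longlonglongrightarrow> x" "B \<longlonglongrightarrow> y"
    for A B :: "nat \<Rightarrow> complex" and S x y
    using LIMSEQ_unique[OF that(1,3)] LIMSEQ_unique[OF that(2,4)] by simp
  have scale: "bisum (\<lambda>n. complex_of_real (sqrt t * a n) * b n) N = of_real (sqrt t) * bisum (\<lambda>n. complex_of_real (a n) * b n) N"
    for a b N by (simp add: bisum_def sum_distrib_left distrib_left mult.assoc)
  have t': "1 / t > 0" using assms by simp
  obtain S where "(\<lambda>N. bisum (\<lambda>n. of_real (exp (- pi * (0 + of_int n)\<^sup>2 / t))) N) \<longlonglongrightarrow> S"
     "(\<lambda>N. bisum (\<lambda>n. of_real (sqrt t * exp (- pi * (of_int n)\<^sup>2 * t)) * cis (2 * pi * of_int n * 0)) N) \<longlonglongrightarrow> S"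
    using poisson_gaussian[OF assms, of 0] by blast
  moreover have "(\<lambda>N. bisum (\<lambda>n. of_real (exp (- pi * (0 + of_int n)\<^sup>2 / t))) N) \<longlonglongrightarrow> theta3 (\<i> * of_real (1 / t))"
    using theta3_imaginary_axis[OF t'] by simp
  moreover have "(\<lambda>N. bisum (\<lambda>n. of_real (sqrt t * exp (- pi * (of_int n)\<^sup>2 * t)) * cis (2 * pi * of_int n * 0)) N) \<longlonglongrightarrow> of_real (sqrt t) * theta3 (\<i> * t)"
    unfolding scale using theta3_imaginary_axis[OF assms] by (auto intro!: tendsto_mult_left)
  ultimately show "theta3 (\<i> * of_real (1 / t)) = of_real (sqrt t) * theta3 (\<i> * t)"
    by (rule lim_eq)
  obtain S where "(\<lambda>N. bisum (\<lambda>n. of_real (exp (- pi * (1/2 + of_int n)\<^sup>2 / t))) N) \<longlonglongrightarrow> S"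
     "(\<lambda>N. bisum (\<lambda>n. of_real (sqrt t * exp (- pi * (of_int n)\<^sup>2 * t)) * cis (2 * pi * of_int n * (1/2))) N) \<longlonglongrightarrow> S"
    using poisson_gaussian[OF assms, of "1/2"] by blast
  moreover have "(\<lambda>N. bisum (\<lambda>n. of_real (exp (- pi * (1/2 + of_int n)\<^sup>2 / t))) N) \<longlonglongrightarrow> theta2 (\<i> * of_real (1 / t))"
    using theta2_imaginary_axis[OF t'] by simp
  moreover have "(\<lambda>N. bisum (\<lambda>n. of_real (sqrt t * exp (- pi * (of_int n)\<^sup>2 * t)) * cis (2 * pi * of_int n * (1/2))) N) \<longlonglongrightarrow> of_real (sqrt t) * theta4 (\<i> * t)"
    unfolding scale by (intro tendsto_mult_left theta4_imaginary_axis[OF assms])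
  ultimately show "theta2 (\<i> * of_real (1 / t)) = of_real (sqrt t) * theta4 (\<i> * t)"
    by (rule lim_eq)
qed

text \<open>The identity theorem applies because \<open>- \<i> * z\<close> has positive real part on the upper half plane, where
the principal square root is holomorphic.\<close>

lemma inversion_from_imaginary_axis:
  assumes F: "F holomorphic_on upper_half_plane" and G: "G holomorphic_on upper_half_plane"
    and axis: "\<And>t::real. t > 0 \<Longrightarrow> F (\<i> * of_real (1 / t)) = of_real (sqrt t) * G (\<i> * t)"
    and z: "z \<in> upper_half_plane"
  shows "F (-1/z) = csqrt (- \<i> * z) * G z"
proof -
  define D where "D z = F (-1/z) - csqrt (- \<i> * z) * G z" for z
  have "(F \<circ> (\<lambda>z. -1/z)) holomorphic_on upper_half_plane"
    using S_upper_half_plane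
    by (intro holomorphic_on_compose_gen[OF _ F] holomorphic_intros) (auto simp: upper_half_plane_def)
  then have "D holomorphic_on upper_half_plane"
    unfolding D_def[abs_def] o_def
    by (intro holomorphic_intros G) (auto simp: upper_half_plane_def complex_nonpos_Reals_iff)
  moreover have "\<i> islimpt ((\<lambda>t. \<i> * complex_of_real t) ` {0<..})"
  proof (rule islimptI)
    fix T :: "complex set" assume "\<i> \<in> T" "open T"
    then obtain e where e: "e > 0" "ball \<i> e \<subseteq> T" by (meson openE)
    have d: "\<i> - \<i> * complex_of_real (1 + e / 2) = - (\<i> * of_real (e / 2))" by (simp add: algebra_simps)
    have "dist \<i> (\<i> * complex_of_real (1 + e / 2)) = e / 2"
      using e(1) unfolding dist_norm d by (simp add: norm_mult)
    then show "\<exists>y\<in>(\<lambda>t. \<i> * complex_of_real t) ` {0<..}. y \<in> T \<and> y \<noteq> \<i>"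
      using e by (intro bexI[of _ "\<i> * complex_of_real (1 + e / 2)"]) (auto simp: subset_eq intro!: image_eqI[of _ _ "1 + e / 2"])
  qed
  moreover have "D w = 0" if "w \<in> (\<lambda>t. \<i> * complex_of_real t) ` {0<..}" for w
  proof -
    from that obtain t where "t \<in> {0<..}" "w = \<i> * of_real t" by (rule imageE)
    then have t: "w = \<i> * of_real t" "t > 0" by auto
    have "-1 / w = \<i> * of_real (1 / t)" using t by (simp add: field_simps)
    moreover have "- \<i> * w = of_real t" using t by (simp add: algebra_simps)
    ultimately show ?thesis using axis[OF t(2)] t by (simp add: D_def csqrt_of_real_nonneg)
  qed
  ultimately have "D z = 0"
    using z by (intro analytic_continuation[of D upper_half_plane "(\<lambda>t. \<i> * complex_of_real t) ` {0<..}" \<i> z])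
      (auto simp: open_upper_half_plane connected_upper_half_plane in_upper_half_plane)
  then show ?thesis by (simp add: D_def)
qed

lemma theta_inversion:
  assumes z: "z \<in> upper_half_plane"
  shows "theta3 (-1/z) = csqrt (- \<i> * z) * theta3 z"
    and "theta2 (-1/z) = csqrt (- \<i> * z) * theta4 z"
    and "theta4 (-1/z) = csqrt (- \<i> * z) * theta2 z"
proof -
  show "theta3 (-1/z) = csqrt (- \<i> * z) * theta3 z"
    by (rule inversion_from_imaginary_axis[OF holomorphic_theta3 holomorphic_theta3 theta_inversion_imaginary_axis(1) z])
  show "theta2 (-1/z) = csqrt (- \<i> * z) * theta4 z"
    by (rule inversion_from_imaginary_axis[OF holomorphic_theta2 holomorphic_theta4 theta_inversion_imaginary_axis(2) z])
  show "theta4 (-1/z) = csqrt (- \<i> * z) * theta2 z"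
  proof (rule inversion_from_imaginary_axis[OF holomorphic_theta4 holomorphic_theta2 _ z])
    fix t :: real assume t: "t > 0"
    have "theta2 (\<i> * t) = of_real (sqrt (1 / t)) * theta4 (\<i> * of_real (1 / t))"
      using theta_inversion_imaginary_axis(2)[of "1 / t"] t by simp
    moreover have "complex_of_real (sqrt t) * of_real (sqrt (1 / t)) = 1"
      using t by (simp add: real_sqrt_divide)
    ultimately show "theta4 (\<i> * of_real (1 / t)) = of_real (sqrt t) * theta2 (\<i> * t)"
      by (simp add: mult.assoc[symmetric])
  qed
qed

text \<open>In the eighth powers the square root becomes \<open>z ^ 4\<close>; in the fourth powers it becomes \<open>- z\<^sup>2\<close>, and this
sign has to be balanced by the sign in the translation of \<open>theta2 ^ 4\<close>.\<close>

lemma theta_power8_inversion: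
  assumes z: "z \<in> upper_half_plane"
  shows "theta3 (-1/z) ^ 8 = z ^ 4 * theta3 z ^ 8"
    and "theta2 (-1/z) ^ 8 = z ^ 4 * theta4 z ^ 8"
    and "theta4 (-1/z) ^ 8 = z ^ 4 * theta2 z ^ 8"
proof -
  have "csqrt (- \<i> * z) ^ 8 = (csqrt (- \<i> * z) ^ 2) ^ 4"
    by (simp only: power_mult[symmetric]) simp
  also have "\<dots> = z ^ 4" by (simp only: power2_csqrt power_mult_distrib) simp
  finally show "theta3 (-1/z) ^ 8 = z ^ 4 * theta3 z ^ 8"
    and "theta2 (-1/z) ^ 8 = z ^ 4 * theta4 z ^ 8"
    and "theta4 (-1/z) ^ 8 = z ^ 4 * theta2 z ^ 8"
    by (simp_all only: theta_inversion[OF z] power_mult_distrib)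
qed

lemma theta_power4_inversion:
  assumes z: "z \<in> upper_half_plane"
  shows "theta3 (-1/z) ^ 4 = - (z ^ 2) * theta3 z ^ 4"
    and "theta2 (-1/z) ^ 4 = - (z ^ 2) * theta4 z ^ 4"
    and "theta4 (-1/z) ^ 4 = - (z ^ 2) * theta2 z ^ 4"
proof -
  have "csqrt (- \<i> * z) ^ 4 = (csqrt (- \<i> * z) ^ 2) ^ 2"
    by (simp only: power_mult[symmetric]) simp
  also have "\<dots> = - (z ^ 2)" by (simp only: power2_csqrt power_mult_distrib) simp
  finally show "theta3 (-1/z) ^ 4 = - (z ^ 2) * theta3 z ^ 4"
    and "theta2 (-1/z) ^ 4 = - (z ^ 2) * theta4 z ^ 4"
    and "theta4 (-1/z) ^ 4 = - (z ^ 2) * theta2 z ^ 4"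
    by (simp_all only: theta_inversion[OF z] power_mult_distrib)
qed

lemma theta_translation:
  shows "theta3 (z + 1) = theta4 z" "theta4 (z + 1) = theta3 z"
    "theta2 (z + 1) ^ 4 = - (theta2 z ^ 4)" "theta2 (z + 1) ^ 8 = theta2 z ^ 8"
proof -
  have e: "exp (\<i> * pi * (z + 1)) = - exp (\<i> * pi * z)"
    by (simp add: distrib_left exp_add)
  then show "theta3 (z + 1) = theta4 z" "theta4 (z + 1) = theta3 z"
    by (simp_all add: theta3_def theta4_def)
  have e2: "exp (2 * of_real pi * \<i> * (z + 1)) = exp (2 * of_real pi * \<i> * z)"
    by (simp add: distrib_left exp_add exp_two_pi_i)
  have "exp (\<i> * pi * (z + 1) / 4) ^ 4 = - (exp (\<i> * pi * z / 4) ^ 4)"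
    using e by (simp add: exp_of_nat_mult[symmetric])
  then show t: "theta2 (z + 1) ^ 4 = - (theta2 z ^ 4)"
    unfolding theta2_def e2 by (simp add: power_mult_distrib)
  have sq: "theta2 w ^ 8 = (theta2 w ^ 4)\<^sup>2" for w by (simp only: power_mult[symmetric]) simp
  show "theta2 (z + 1) ^ 8 = theta2 z ^ 8" by (simp only: sq t power2_minus)
qed

text \<open>Gauss's product shows this for \<open>theta2\<close>; inversion carries it to \<open>theta4\<close> and translation to \<open>theta3\<close>.\<close>

lemma theta_nonzero:
  assumes z: "z \<in> upper_half_plane"
  shows "theta2 z \<noteq> 0" "theta3 z \<noteq> 0" "theta4 z \<noteq> 0"
proof -
  have t2: "theta2 w \<noteq> 0" if "w \<in> upper_half_plane" for w
    using eval_triangular_nonzero[OF norm_q_less_1[OF that]] by (simp add: theta2_def)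
  have t4: "theta4 w \<noteq> 0" if "w \<in> upper_half_plane" for w
    using theta_inversion(2)[OF that] t2[OF S_upper_half_plane[OF that]] by auto
  show "theta2 z \<noteq> 0" "theta4 z \<noteq> 0" using t2 t4 z by auto
  show "theta3 z \<noteq> 0"
    using t4[OF T_upper_half_plane[OF z]] by (simp add: theta_translation)
qed

section \<open>Holomorphic functions invariant under the modular group\<close>

abbreviation at_i_infinity :: "complex filter" where
  "at_i_infinity \<equiv> filtercomap Im at_top"

lemma at_i_infinity_neq_bot: "at_i_infinity \<noteq> bot"
proof -
  have "\<exists>z. Im z \<ge> Y" for Y by (rule exI[of _ "Complex 0 Y"]) simp
  then show ?thesis
    by (auto simp: trivial_limit_def eventually_filtercomap_at_top_linorder)
qed

lemma eventually_at_i_infinity_upper: "eventually (\<lambda>z. z \<in> upper_half_plane) at_i_infinity"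
  unfolding eventually_filtercomap_at_top_linorder in_upper_half_plane by (rule exI[of _ 1]) auto

lemma exp_tendsto_0_at_i_infinity:
  assumes "c > 0"
  shows "((\<lambda>z. exp (of_real c * \<i> * z)) \<longlongrightarrow> 0) at_i_infinity"
proof (rule tendsto_norm_zero_cancel)
  have "((\<lambda>y. exp (- (c * y))) \<longlongrightarrow> 0) at_top"
    using assms by real_asymp
  then have "((\<lambda>z. exp (- (c * Im z))) \<longlongrightarrow> 0) at_i_infinity"
    by (rule filterlim_compose) (rule filterlim_filtercomap)
  then show "((\<lambda>z. norm (exp (of_real c * \<i> * z))) \<longlongrightarrow> 0) at_i_infinity"
    by (simp add: norm_exp_eq_Re)
qed

lemma eval_fps_tendsto_at_i_infinity:
  fixes f :: "complex fps"
  assumes "fps_conv_radius f \<ge> 1" "(g \<longlongrightarrow> 0) at_i_infinity"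
  shows "((\<lambda>z. eval_fps f (g z)) \<longlongrightarrow> fps_nth f 0) at_i_infinity"
proof -
  have "fps_conv_radius f > 0" using assms(1) by (auto intro: less_le_trans[of 0 1])
  then have "isCont (eval_fps f) 0"
    using has_fps_expansion_imp_continuous[OF eval_fps_has_fps_expansion, of f UNIV] by simp
  from isCont_tendsto_compose[OF this assms(2)] show ?thesis by (simp add: eval_fps_at_0)
qed

lemma nome_tendsto_0: "((\<lambda>z. exp (\<i> * pi * z)) \<longlongrightarrow> 0) at_i_infinity"
  using exp_tendsto_0_at_i_infinity[OF pi_gt_zero] by (simp add: mult.commute)

lemma q_tendsto_0: "((\<lambda>z. exp (2 * of_real pi * \<i> * z)) \<longlongrightarrow> 0) at_i_infinity"
  using exp_tendsto_0_at_i_infinity[of "2 * pi"] by simp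

lemma theta3_tendsto: "(theta3 \<longlongrightarrow> 1) at_i_infinity"
  and theta4_tendsto: "(theta4 \<longlongrightarrow> 1) at_i_infinity"
proof -
  have 0: "fps_nth square_fps 0 = 0" by (simp add: square_fps_def)
  have "((\<lambda>z. 1 + 2 * eval_fps square_fps (exp (\<i> * pi * z))) \<longlongrightarrow> 1 + 2 * fps_nth square_fps 0) at_i_infinity"
    by (intro tendsto_intros eval_fps_tendsto_at_i_infinity nome_tendsto_0 fps_conv_radius_square)
  then show "(theta3 \<longlongrightarrow> 1) at_i_infinity" by (simp add: theta3_def[abs_def] 0)
  have "((\<lambda>z. - exp (\<i> * pi * z)) \<longlongrightarrow> - 0) at_i_infinity"
    by (intro tendsto_minus nome_tendsto_0)
  then have "((\<lambda>z. 1 + 2 * eval_fps square_fps (- exp (\<i> * pi * z))) \<longlongrightarrow> 1 + 2 * fps_nth square_fps 0) at_i_infinity"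
    by (intro tendsto_intros eval_fps_tendsto_at_i_infinity fps_conv_radius_square) simp
  then show "(theta4 \<longlongrightarrow> 1) at_i_infinity" by (simp add: theta4_def[abs_def] 0)
qed

lemma Im_minus_inverse: "Im (-1/z) = Im z / (norm z)\<^sup>2"
  by (simp add: Im_divide cmod_power2)

text \<open>Translate to \<open>\<bar>Re z\<bar> \<le> 1/2\<close>. If then \<open>Im z < 1/2\<close>, we have \<open>\<bar>z\<bar>\<^sup>2 \<le> 1/2\<close>, and \<open>z \<mapsto> -1/z\<close> at least doubles the
imaginary part, so finitely many steps suffice. The bound 1/2, weaker than the one of the usual
fundamental domain, is enough for compactness.\<close>

lemma level_one_reduction:
  assumes T: "\<And>z. z \<in> upper_half_plane \<Longrightarrow> F (z + 1) = F z"
    and S: "\<And>z. z \<in> upper_half_plane \<Longrightarrow> F (-1/z) = F z"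
    and z: "z \<in> upper_half_plane"
  shows "\<exists>w. F w = F z \<and> \<bar>Re w\<bar> \<le> 1/2 \<and> Im w \<ge> 1/2"
proof -
  have T_nat: "F (z + of_nat n) = F z" if "z \<in> upper_half_plane" for z n
  proof (induction n)
    case (Suc n)
    have "z + of_nat n \<in> upper_half_plane" using that by (simp add: in_upper_half_plane)
    from T[OF this] Suc show ?case by (simp add: add_ac)
  qed simp
  have T_int: "F (z + of_int n) = F z" if "z \<in> upper_half_plane" for z n
  proof (cases "n \<ge> 0")
    case True
    then show ?thesis using T_nat[OF that, of "nat n"] by simp
  next
    case False
    have "z + of_int n \<in> upper_half_plane" using that by (simp add: in_upper_half_plane)
    from T_nat[OF this, of "nat (- n)"] False show ?thesis by simp
  qed
  have translate: "\<exists>w. F w = F z \<and> \<bar>Re w\<bar> \<le> 1/2 \<and> Im w = Im z" if "z \<in> upper_half_plane" for z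
  proof -
    have "\<bar>Re z + of_int (- round (Re z))\<bar> \<le> 1/2"
      using of_int_round_abs_le[of "Re z"] by (simp add: abs_minus_commute)
    then show ?thesis using T_int[OF that, of "- round (Re z)"]
      by (intro exI[of _ "z + of_int (- round (Re z))"]) simp
  qed
  have "\<exists>w. F w = F z \<and> \<bar>Re w\<bar> \<le> 1/2 \<and> Im w \<ge> 1/2"
    if "z \<in> upper_half_plane" "Im z \<ge> (1/2) / 2 ^ n" for n z
    using that
  proof (induction n arbitrary: z)
    case 0
    then show ?case using translate[of z] by auto
  next
    case (Suc n)
    obtain w where w: "F w = F z" "\<bar>Re w\<bar> \<le> 1/2" "Im w = Im z" using translate[OF Suc.prems(1)] by blast
    show ?case
    proof (cases "Im w \<ge> 1/2")
      case True
      then show ?thesis using w by blast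
    next
      case False
      have wH: "w \<in> upper_half_plane" using w Suc.prems by (simp add: in_upper_half_plane)
      have "(Re w)\<^sup>2 \<le> (1/2)\<^sup>2" using w(2) by (metis abs_ge_zero power2_abs power_mono)
      moreover have "(Im w)\<^sup>2 \<le> (1/2)\<^sup>2"
        using False wH by (intro power_mono) (auto simp: in_upper_half_plane)
      ultimately have "(norm w)\<^sup>2 \<le> 1/2" unfolding cmod_power2 by (simp add: power2_eq_square)
      moreover have "(norm w)\<^sup>2 > 0" using wH by (auto simp: in_upper_half_plane)
      moreover have "Im w > 0" using wH by (simp add: in_upper_half_plane)
      ultimately have "Im w / (norm w)\<^sup>2 \<ge> Im w / (1/2)"
        by (intro divide_left_mono mult_pos_pos) auto
      then have "Im (-1/w) \<ge> 2 * Im w" unfolding Im_minus_inverse by simp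
      moreover have "2 * Im w \<ge> (1/2) / 2 ^ n" using Suc.prems(2) w(3) by simp
      ultimately have "Im (-1/w) \<ge> (1/2) / 2 ^ n" by linarith
      from Suc.IH[OF S_upper_half_plane[OF wH] this] S[OF wH] w(1) show ?thesis by simp
    qed
  qed
  moreover obtain n where "(1/2) ^ n < Im z"
    using real_arch_pow_inv[of "Im z" "1/2"] z by (auto simp: in_upper_half_plane)
  then have "Im z \<ge> (1/2) / 2 ^ n" by (simp add: power_one_over field_simps)
  ultimately show ?thesis using z by blast
qed

text \<open>By the reduction, \<open>\<bar>F\<bar>\<close> attains its supremum over the half plane on a compact box. Hence \<open>F\<close> is
constant by the maximum modulus principle, and the constant is the limit 0.\<close>

lemma level_one_function_zero:
  assumes hol: "F holomorphic_on upper_half_plane"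
    and T: "\<And>z. z \<in> upper_half_plane \<Longrightarrow> F (z + 1) = F z"
    and S: "\<And>z. z \<in> upper_half_plane \<Longrightarrow> F (-1/z) = F z"
    and lim: "(F \<longlongrightarrow> 0) at_i_infinity"
    and z: "z \<in> upper_half_plane"
  shows "F z = 0"
proof (rule ccontr)
  assume nz: "F z \<noteq> 0"
  have "eventually (\<lambda>w. norm (F w) < norm (F z)) at_i_infinity"
    using order_tendstoD(2)[OF tendsto_norm_zero[OF lim], of "norm (F z)"] nz by simp
  then obtain Y where Y: "\<And>w. Im w \<ge> Y \<Longrightarrow> norm (F w) < norm (F z)"
    unfolding eventually_filtercomap_at_top_linorder by blast
  define K where "K = cbox (Complex (-1/2) (1/2)) (Complex (1/2) Y)"
  have K: "w \<in> K \<longleftrightarrow> \<bar>Re w\<bar> \<le> 1/2 \<and> 1/2 \<le> Im w \<and> Im w \<le> Y" for w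
    unfolding K_def by (auto simp: in_cbox_complex_iff)
  have "K \<subseteq> upper_half_plane" by (auto simp: K in_upper_half_plane)
  then have contK: "continuous_on K (\<lambda>w. norm (F w))"
    by (intro continuous_on_norm holomorphic_on_imp_continuous_on[OF holomorphic_on_subset[OF hol]])
  have reduce: "\<exists>w\<in>K. F w = F v" if v: "v \<in> upper_half_plane" "norm (F v) \<ge> norm (F z)" for v
  proof -
    obtain w where w: "F w = F v" "\<bar>Re w\<bar> \<le> 1/2" "Im w \<ge> 1/2"
      using level_one_reduction[of F, OF T S v(1)] by blast
    moreover have "Im w \<le> Y" using Y[of w] w(1) v(2) by force
    ultimately show ?thesis using K by blast
  qed
  then have "K \<noteq> {}" using z by blast
  then obtain m where m: "m \<in> K" "\<And>w. w \<in> K \<Longrightarrow> norm (F w) \<le> norm (F m)"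
    using continuous_attains_sup[OF _ _ contK] by (auto simp: K_def)
  have ge: "norm (F z) \<le> norm (F m)" using reduce[OF z] m(2) by (metis order_refl)
  have max: "norm (F v) \<le> norm (F m)" if "v \<in> upper_half_plane" for v
  proof (cases "norm (F v) \<ge> norm (F z)")
    case True
    then show ?thesis using reduce[OF that] m(2) by metis
  qed (use ge in linarith)
  have "F constant_on upper_half_plane"
    using m(1) \<open>K \<subseteq> upper_half_plane\<close> max
    by (intro maximum_modulus_principle[OF hol open_upper_half_plane connected_upper_half_plane open_upper_half_plane subset_refl, of m]) auto
  then obtain c where c: "\<And>w. w \<in> upper_half_plane \<Longrightarrow> F w = c" unfolding constant_on_def by blast
  have "eventually (\<lambda>w. F w = c) at_i_infinity"
    using eventually_at_i_infinity_upper by eventually_elim (rule c)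
  then have "(F \<longlongrightarrow> c) at_i_infinity" by (rule tendsto_eventually)
  then have "c = 0" using lim at_i_infinity_neq_bot tendsto_unique by blast
  then show False using c[OF z] nz by simp
qed

section \<open>Modularity from inversion and translation\<close>

text \<open>Right multiplication by \<open>S\<close> and \<open>T\<close> generates \<open>SL(2,Z)\<close>: on the bottom row \<open>(c, d)\<close> a power of \<open>T\<close>
reduces \<open>d\<close> modulo \<open>c\<close>, and \<open>S\<close> exchanges the two entries up to sign, so the Euclidean algorithm ends
with \<open>c = 0\<close>.\<close>

lemma SL2Z_induct [consumes 1, case_names one S T T_inv]:
  fixes a b c d :: int
  assumes det: "a * d - b * c = 1"
    and one: "P 1 0 0 1"
    and S: "\<And>a b c d. a * d - b * c = 1 \<Longrightarrow> P a b c d \<Longrightarrow> P b (-a) d (-c)"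
    and T: "\<And>a b c d. a * d - b * c = 1 \<Longrightarrow> P a b c d \<Longrightarrow> P a (b + a) c (d + c)"
    and T_inv: "\<And>a b c d. a * d - b * c = 1 \<Longrightarrow> P a b c d \<Longrightarrow> P a (b - a) c (d - c)"
  shows "P a b c d"
proof -
  have Tn: "P a (b + of_nat n * a) c (d + of_nat n * c) \<and> P a (b - of_nat n * a) c (d - of_nat n * c)"
    if "a * d - b * c = 1" "P a b c d" for a b c d n
  proof (induction n)
    case (Suc n)
    have det: "a * (d + of_nat n * c) - (b + of_nat n * a) * c = 1"
      "a * (d - of_nat n * c) - (b - of_nat n * a) * c = 1"
      using that(1) by (simp_all add: algebra_simps)
    show ?case
      using T[OF det(1)] T_inv[OF det(2)] Suc by (simp add: algebra_simps)
  qed (use that in simp)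
  have Tz: "P a (b + n * a) c (d + n * c)" if "a * d - b * c = 1" "P a b c d" for a b c d n
    using Tn[OF that, of "nat \<bar>n\<bar>"] by (cases "n \<ge> 0") auto
  have neg: "P (-a) (-b) (-c) (-d)" if "a * d - b * c = 1" "P a b c d" for a b c d
  proof -
    have "P b (-a) d (-c)" using S[OF that] .
    then show ?thesis using S[of b "-c" "-a" d] that(1) by (simp add: algebra_simps)
  qed
  show ?thesis using det
  proof (induction "nat \<bar>c\<bar>" arbitrary: a b c d rule: less_induct)
    case less
    show ?case
    proof (cases "c = 0")
      case True
      then have "a * d = 1" using less.prems by simp
      then consider "a = 1" "d = 1" | "a = -1" "d = -1" by (auto simp: zmult_eq_1_iff)
      then show ?thesis
      proof cases
        case 1
        then show ?thesis using Tz[OF _ one, of b] True by simp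
      next
        case 2
        then show ?thesis using neg[OF _ Tz[OF _ one, of "-b"]] True by simp
      qed
    next
      case False
      define n where "n = d div c"
      define r where "r = d mod c"
      define b' where "b' = b - n * a"
      have d: "d = r + n * c" by (simp add: n_def r_def)
      have det: "a * r - b' * c = 1" using less.prems by (simp add: d b'_def algebra_simps)
      have "nat \<bar>r\<bar> < nat \<bar>c\<bar>" using False abs_mod_less[of c d] by (simp add: r_def)
      then have "P b' (-a) r (-c)" using less.hyps[of r b' "-c" "-a"] det by (simp add: algebra_simps)
      then have "P (-a) (-b') (-c) (-r)"
        using S[of b' "-c" "-a" r] det by (simp add: algebra_simps)
      then have "P a b' c r" using neg[of "-a" "-r" "-b'" "-c"] det by simp
      from Tz[OF det this, of n] show ?thesis by (simp add: d b'_def)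
    qed
  qed
qed

lemma mobius_denominator_nonzero:
  fixes a b c d :: int
  assumes "a * d - b * c = 1" "z \<in> upper_half_plane"
  shows "of_int c * z + of_int d \<noteq> 0"
proof
  assume eq: "of_int c * z + of_int d = 0"
  have "Im (of_int c * z + of_int d) = of_int c * Im z" by simp
  then have "of_int c * Im z = 0" unfolding eq by simp
  then have "c = 0" using assms(2) by (simp add: in_upper_half_plane)
  then show False using eq assms(1) by simp
qed

lemma mobius_in_upper_half_plane:
  fixes a b c d :: int
  assumes "a * d - b * c = 1" "z \<in> upper_half_plane"
  shows "(of_int a * z + of_int b) / (of_int c * z + of_int d) \<in> upper_half_plane"
proof -
  have "real_of_int a * of_int d - of_int b * of_int c = of_int (a * d - b * c)" by simp
  then have det: "real_of_int a * of_int d - of_int b * of_int c = 1" using assms(1) by simp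
  let ?D = "of_int c * z + of_int d"
  have "Im ((of_int a * z + of_int b) / ?D) = (Im z * (real_of_int a * of_int d - of_int b * of_int c)) / (norm ?D)\<^sup>2"
    unfolding Im_divide cmod_power2 by (simp add: algebra_simps)
  moreover have "norm ?D > 0" using mobius_denominator_nonzero[OF assms] by simp
  ultimately show ?thesis using assms(2) det by (simp add: in_upper_half_plane)
qed

text \<open>The bottom row \<open>(c, d)\<close> of a unimodular matrix is one of \<open>(0, 1)\<close>, \<open>(1, 0)\<close>, \<open>(1, 1)\<close> modulo 2, and right
multiplication by \<open>S\<close> and \<open>T\<close> permutes these three classes in the way in which \<open>S\<close> and \<open>T\<close> permute
\<open>F1\<close>, \<open>F2\<close>, \<open>F3\<close>. So the class of the bottom row tells into which function \<open>F1\<close> is transformed; the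
class \<open>(0, 1)\<close> is that of \<open>\<Gamma>\<^sub>0(2)\<close>.\<close>

lemma three_term_modularity:
  fixes F1 F2 F3 :: "complex \<Rightarrow> complex" and a b c d :: int
  assumes S: "\<And>z. z \<in> upper_half_plane \<Longrightarrow> F1 (-1/z) = z ^ w * F2 z"
      "\<And>z. z \<in> upper_half_plane \<Longrightarrow> F2 (-1/z) = z ^ w * F1 z"
      "\<And>z. z \<in> upper_half_plane \<Longrightarrow> F3 (-1/z) = z ^ w * F3 z"
    and T: "\<And>z. z \<in> upper_half_plane \<Longrightarrow> F1 (z + 1) = F1 z"
      "\<And>z. z \<in> upper_half_plane \<Longrightarrow> F2 (z + 1) = F3 z"
      "\<And>z. z \<in> upper_half_plane \<Longrightarrow> F3 (z + 1) = F2 z"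
    and det: "a * d - b * c = 1" and z: "z \<in> upper_half_plane"
  shows "F1 ((of_int a * z + of_int b) / (of_int c * z + of_int d)) =
    (of_int c * z + of_int d) ^ w * (if even c then F1 z else if even d then F2 z else F3 z)"
proof -
  define lab where "lab c d = (if even c then F1 else if even d then F2 else F3)" for c d :: int
  have "\<forall>z\<in>upper_half_plane. F1 ((of_int a * z + of_int b) / (of_int c * z + of_int d)) = (of_int c * z + of_int d) ^ w * lab c d z"
    using det
  proof (induction rule: SL2Z_induct)
    case one
    then show ?case by (simp add: lab_def)
  next
    case (S a b c d)
    show ?case
    proof
      fix z assume z: "z \<in> upper_half_plane"
      then have z0: "z \<noteq> 0" by (auto simp: in_upper_half_plane)
      have e: "of_int c * (-1/z) + of_int d = (of_int d * z + of_int (-c)) / z"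
        "of_int a * (-1/z) + of_int b = (of_int b * z + of_int (-a)) / z"
        using z0 by (simp_all add: field_simps)
      have "odd d" if "even c"
        using S.hyps that by (metis dvd_diff dvd_mult odd_one)
      then have "lab c d (-1/z) = z ^ w * lab d (-c) z"
        using assms(1-3)[OF z] by (simp add: lab_def)
      with bspec[OF S.IH S_upper_half_plane[OF z]]
      have "F1 ((of_int b * z + of_int (-a)) / (of_int d * z + of_int (-c))) =
         ((of_int d * z + of_int (-c)) / z) ^ w * (z ^ w * lab d (-c) z)"
        unfolding e using z0 by simp
      then show "F1 ((of_int b * z + of_int (-a)) / (of_int d * z + of_int (-c))) =
         (of_int d * z + of_int (-c)) ^ w * lab d (-c) z"
        using z0 by (simp add: power_divide)
    qed
  next
    case (T a b c d)
    show ?case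
    proof
      fix z assume z: "z \<in> upper_half_plane"
      have e: "of_int c * (z + 1) + of_int d = of_int c * z + of_int (d + c)"
        "of_int a * (z + 1) + of_int b = of_int a * z + of_int (b + a)"
        by (simp_all add: algebra_simps)
      have "lab c d (z + 1) = lab c (d + c) z"
        using assms(4-6)[OF z] by (simp add: lab_def)
      with bspec[OF T.IH T_upper_half_plane[OF z]]
      show "F1 ((of_int a * z + of_int (b + a)) / (of_int c * z + of_int (d + c))) =
         (of_int c * z + of_int (d + c)) ^ w * lab c (d + c) z"
        unfolding e by simp
    qed
  next
    case (T_inv a b c d)
    show ?case
    proof
      fix z assume z: "z \<in> upper_half_plane"
      then have z1: "z - 1 \<in> upper_half_plane" by (simp add: in_upper_half_plane)
      have e: "of_int c * (z - 1) + of_int d = of_int c * z + of_int (d - c)"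
        "of_int a * (z - 1) + of_int b = of_int a * z + of_int (b - a)"
        by (simp_all add: algebra_simps)
      have "lab c d (z - 1) = lab c (d - c) z"
        using assms(4-6)[OF z1] by (simp add: lab_def)
      with bspec[OF T_inv.IH z1]
      show "F1 ((of_int a * z + of_int (b - a)) / (of_int c * z + of_int (d - c))) =
         (of_int c * z + of_int (d - c)) ^ w * lab c (d - c) z"
        unfolding e by simp
    qed
  qed
  then show ?thesis using z by (simp add: lab_def)
qed

section \<open>Forms that vanish to high order at infinity\<close>

definition int_mat :: "int \<Rightarrow> int \<Rightarrow> int \<Rightarrow> int \<Rightarrow> int^2^2" where
  "int_mat a b c d = vector [vector [a, b], vector [c, d]]"

lemma int_mat_nth [simp]:
  "int_mat a b c d $ 1 $ 1 = a" "int_mat a b c d $ 1 $ 2 = b"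
  "int_mat a b c d $ 2 $ 1 = c" "int_mat a b c d $ 2 $ 2 = d"
  by (simp_all add: int_mat_def vector_2)

lemma int_mat_in_SL2Z [simp]: "int_mat a b c d \<in> SL2Z \<longleftrightarrow> a * d - b * c = 1"
  by (simp add: SL2Z_def det_2)

lemma modular_forms_transform:
  fixes a b c d :: int
  assumes "f \<in> modular_forms 2 h" "a * d - b * c = 1" "even c" "z \<in> upper_half_plane"
  shows "f ((of_int a * z + of_int b) / (of_int c * z + of_int d)) = (of_int c * z + of_int d) ^ h * f z"
proof -
  have "int_mat a b c d \<in> Gamma0 2" using assms by (simp add: Gamma0_def)
  then have "f (mobius (int_mat a b c d) z) = (of_int c * z + of_int d) ^ h * f z"
    using assms unfolding modular_forms_def by fastforce
  then show ?thesis by (simp add: mobius_def)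
qed

lemma modular_forms_periodic:
  assumes "f \<in> modular_forms 2 h" "z \<in> upper_half_plane"
  shows "f (z + 1) = f z"
  using modular_forms_transform[OF assms(1), of 1 1 1 0 z] assms(2) by simp

lemma modular_forms_holomorphic: "f \<in> modular_forms 2 h \<Longrightarrow> f holomorphic_on upper_half_plane"
  by (simp add: modular_forms_def)

definition has_q_expansion :: "(complex \<Rightarrow> complex) \<Rightarrow> complex fps \<Rightarrow> bool" where
  "has_q_expansion f A \<longleftrightarrow> fps_conv_radius A \<ge> 1 \<and>
     (\<forall>z\<in>upper_half_plane. f z = eval_fps A (exp (2 * of_real pi * \<i> * z)))"

lemma fps_conv_radius_ge_1I:
  fixes A :: "complex fps"
  assumes "\<And>x. norm x < 1 \<Longrightarrow> x \<noteq> 0 \<Longrightarrow> summable (\<lambda>n. fps_nth A n * x ^ n)"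
  shows "fps_conv_radius A \<ge> 1"
  unfolding fps_conv_radius_def
proof (rule conv_radius_geI_ex')
  fix r :: real assume "0 < r" "ereal r < 1"
  then show "summable (\<lambda>n. fps_nth A n * of_real r ^ n)" by (intro assms) auto
qed

lemma norm_less_radius: "fps_conv_radius A \<ge> 1 \<Longrightarrow> norm (x :: complex) < 1 \<Longrightarrow> ereal (norm x) < fps_conv_radius (A :: complex fps)"
  by (simp add: less_le_trans[of _ 1])

lemma exp_width_surj:
  assumes "w > 0" "norm x < 1" "x \<noteq> 0"
  shows "\<exists>z\<in>upper_half_plane. exp (2 * of_real pi * \<i> * z / of_nat w) = x"
proof
  let ?z = "of_nat w * Ln x / (2 * pi * \<i>)"
  show "exp (2 * of_real pi * \<i> * ?z / of_nat w) = x" using assms by simp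
  have "ln (norm x) < 0" using assms by simp
  then have "0 < - (real w * ln (norm x))" using assms(1) by (simp add: mult_pos_neg)
  then show "?z \<in> upper_half_plane"
    using assms by (auto simp: in_upper_half_plane Im_divide power2_eq_square mult_pos_neg intro!: divide_neg_pos)
qed

lemma holomorphic_at_infinity_fps:
  assumes "holomorphic_at_infinity f"
  obtains w A where "w > 0" "fps_conv_radius A \<ge> 1"
    "\<And>z. z \<in> upper_half_plane \<Longrightarrow> f z = eval_fps A (exp (2 * of_real pi * \<i> * z / of_nat w))"
proof -
  obtain w :: nat and a where w: "w > 0"
    and a: "\<And>z. z \<in> upper_half_plane \<Longrightarrow> (\<lambda>n. a n * exp (2 * of_real pi * \<i> * z / of_nat w) ^ n) sums f z"
    using assms unfolding holomorphic_at_infinity_def by auto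
  have "fps_conv_radius (Abs_fps a) \<ge> 1"
  proof (rule fps_conv_radius_ge_1I)
    fix x :: complex assume "norm x < 1" "x \<noteq> 0"
    then obtain z where "z \<in> upper_half_plane" "exp (2 * of_real pi * \<i> * z / of_nat w) = x"
      using exp_width_surj[OF w] by blast
    then show "summable (\<lambda>n. fps_nth (Abs_fps a) n * x ^ n)"
      using sums_summable[OF a] by auto
  qed
  moreover have "f z = eval_fps (Abs_fps a) (exp (2 * of_real pi * \<i> * z / of_nat w))" if "z \<in> upper_half_plane" for z
    using a[OF that] by (simp add: eval_fps_def sums_iff)
  ultimately show ?thesis using that w by blast
qed

lemma holomorphic_at_infinity_limit:
  assumes "holomorphic_at_infinity f"
  shows "\<exists>L. (f \<longlongrightarrow> L) at_i_infinity"
proof -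
  obtain w A where w: "w > 0" and rad: "fps_conv_radius A \<ge> 1"
    and A: "\<And>z. z \<in> upper_half_plane \<Longrightarrow> f z = eval_fps A (exp (2 * of_real pi * \<i> * z / of_nat w))"
    using holomorphic_at_infinity_fps[OF assms] by blast
  have "((\<lambda>z. exp (2 * of_real pi * \<i> * z / of_nat w)) \<longlongrightarrow> 0) at_i_infinity"
    using exp_tendsto_0_at_i_infinity[of "2 * pi / w"] w by (simp add: mult_ac)
  from eval_fps_tendsto_at_i_infinity[OF rad this]
  have "((\<lambda>z. eval_fps A (exp (2 * of_real pi * \<i> * z / of_nat w))) \<longlongrightarrow> fps_nth A 0) at_i_infinity" .
  moreover have "eventually (\<lambda>z. eval_fps A (exp (2 * of_real pi * \<i> * z / of_nat w)) = f z) at_i_infinity"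
    using eventually_at_i_infinity_upper by eventually_elim (simp add: A)
  ultimately have "(f \<longlongrightarrow> fps_nth A 0) at_i_infinity"
    by (rule Lim_transform_eventually)
  then show ?thesis by blast
qed

lemma modular_forms_limit_at_0:
  assumes f: "f \<in> modular_forms 2 h"
  shows "\<exists>L. ((\<lambda>z. f (-1/z) / z ^ h) \<longlongrightarrow> L) at_i_infinity"
proof -
  have "int_mat 0 (-1) 1 0 \<in> SL2Z" by simp
  then have "holomorphic_at_infinity (slash h f (int_mat 0 (-1) 1 0))"
    using f by (simp add: modular_forms_def)
  from holomorphic_at_infinity_limit[OF this] show ?thesis by (simp add: slash_def[abs_def] mobius_def)
qed

lemma holomorphic_mult_eq_0:
  fixes S :: "complex set"
  assumes "open S" "connected S" "F holomorphic_on S" "G holomorphic_on S"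
    and zero: "\<And>z. z \<in> S \<Longrightarrow> F z * G z = 0"
  shows "(\<forall>z\<in>S. F z = 0) \<or> (\<forall>z\<in>S. G z = 0)"
proof (cases "\<forall>z\<in>S. F z = 0")
  case False
  then obtain z where z: "z \<in> S" "F z \<noteq> 0" by blast
  have "open (S \<inter> F -` (- {0}))"
    using assms by (intro continuous_open_preimage holomorphic_on_imp_continuous_on) auto
  moreover have "G w = 0" if "w \<in> S \<inter> F -` (- {0})" for w
    using zero[of w] that by auto
  moreover have "S \<inter> F -` (- {0}) \<noteq> {}" "S \<inter> F -` (- {0}) \<subseteq> S" using z by auto
  moreover have "(\<lambda>_. 0) holomorphic_on S" by simp
  ultimately have "\<forall>w\<in>S. G w = 0"
    using assms z analytic_continuation_open[of "S \<inter> F -` (- {0})" S G "\<lambda>_. 0"] by blast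
  then show ?thesis ..
qed blast

text \<open>Let \<open>f2 = f|S\<close> and \<open>f3 = f|ST\<close>. Inversion and translation permute \<open>f\<close>, \<open>f2\<close>, \<open>f3\<close> up to signs
and automorphy factors, as they
permute the eighth powers of the theta constants. Hence
\<open>N = (f f2 f3) ^ 4 / (theta2 theta3 theta4) ^ (8 h)\<close> is invariant under \<open>SL(2,Z)\<close>: the fourth power
removes the signs and makes the weights \<open>4 h\<close> agree. It is holomorphic because the theta constants
have no zeros. At infinity \<open>f ^ 4\<close> vanishes to order at least \<open>4 (h div 4 + 1) > h\<close>, while
\<open>theta2 ^ (8 h)\<close> has order exactly \<open>h\<close> and the other factors have finite limits, those of the
denominator being 1. So \<open>N\<close> tends to 0, is identically 0, and one of \<open>f\<close>, \<open>f2\<close>, \<open>f3\<close> vanishes.\<close>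

lemma modular_form_eq_0_if_vanishing:
  assumes f: "f \<in> modular_forms 2 h" and A: "has_q_expansion f A"
    and vanish: "\<And>n. 4 * n \<le> h \<Longrightarrow> fps_nth A n = 0" and z: "z \<in> upper_half_plane"
  shows "f z = 0"
proof -
  define f2 where "f2 z = f (-1/z) / z ^ h" for z
  define f3 where "f3 z = f2 (z + 1)" for z
  define P where "P z = theta2 z ^ 8 * theta3 z ^ 8 * theta4 z ^ 8" for z
  define N where "N z = (f z * f2 z * f3 z) ^ 4 / P z ^ h" for z
  have P_nz: "P z \<noteq> 0" if "z \<in> upper_half_plane" for z
    using theta_nonzero[OF that] by (simp add: P_def)
  have nz: "z \<noteq> 0" "z + 1 \<noteq> 0" "z - 1 \<noteq> 0" "z + 2 \<noteq> 0" "1 - z \<noteq> 0" if "z \<in> upper_half_plane" for z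
    using that by (auto simp: in_upper_half_plane complex_eq_iff)
  have hol_f: "f holomorphic_on upper_half_plane" using f by (rule modular_forms_holomorphic)
  have hol_f2: "f2 holomorphic_on upper_half_plane"
  proof -
    have "(f \<circ> (\<lambda>z. -1/z)) holomorphic_on upper_half_plane"
      using nz S_upper_half_plane by (intro holomorphic_on_compose_gen[OF _ hol_f] holomorphic_intros) auto
    then show ?thesis unfolding f2_def[abs_def] o_def using nz by (intro holomorphic_intros) auto
  qed
  have hol_f3: "f3 holomorphic_on upper_half_plane"
  proof -
    have "(f2 \<circ> (\<lambda>z. z + 1)) holomorphic_on upper_half_plane"
      using T_upper_half_plane by (intro holomorphic_on_compose_gen[OF _ hol_f2] holomorphic_intros) auto
    then show ?thesis unfolding f3_def[abs_def] o_def .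
  qed
  have hol_N: "N holomorphic_on upper_half_plane"
    unfolding N_def[abs_def] P_def[abs_def]
    by (intro holomorphic_intros hol_f hol_f2 hol_f3 holomorphic_theta2 holomorphic_theta3 holomorphic_theta4)
      (simp add: theta_nonzero)
  have f_S: "f (-1/z) = z ^ h * f2 z" if "z \<in> upper_half_plane" for z
    using nz[OF that] by (simp add: f2_def)
  \<comment> \<open>The sign \<open>(-1) ^ h\<close> reflects that \<open>S\<^sup>2\<close> is minus the identity.\<close>
  have f2_S: "f2 (-1/z) = (- z) ^ h * f z" if "z \<in> upper_half_plane" for z
  proof -
    have a: "-1 / (-1/z) = z" "-1/z = inverse (- z)"
      using nz[OF that] by (simp_all add: field_simps)
    have "f2 (-1/z) = f z / (-1/z) ^ h" unfolding f2_def a(1) ..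
    then show ?thesis unfolding a(2) power_inverse by (simp add: divide_inverse)
  qed
  have f3_S: "f3 (-1/z) = (- z) ^ h * f3 z" if H: "z \<in> upper_half_plane" for z
  proof -
    note n = nz[OF H]
    define u where "u = -1 / (z + 1)"
    have u: "u \<in> upper_half_plane" unfolding u_def by (intro S_upper_half_plane T_upper_half_plane H)
    \<comment> \<open>The matrix of \<open>\<Gamma>\<^sub>0(2)\<close> used here is \<open>S T S (S T)^ (-1)\<close>, up to sign.\<close>
    have "f ((of_int 1 * u + of_int 1) / (of_int (-2) * u + of_int (-1))) = (of_int (-2) * u + of_int (-1)) ^ h * f u"
      by (rule modular_forms_transform[OF f _ _ u]) auto
    moreover have den: "of_int (-2) * u + of_int (-1) = (1 - z) / (z + 1)"
      using n by (simp add: u_def field_simps)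
    moreover have "(of_int 1 * u + of_int 1) / (of_int (-2) * u + of_int (-1)) = -1 / (-1/z + 1)"
    proof -
      have "of_int 1 * u + of_int 1 = z / (z + 1)" using n by (simp add: u_def field_simps)
      moreover have "-1/z + 1 = - (1 - z) / z" using n by (simp add: field_simps)
      ultimately show ?thesis unfolding den using n by (auto simp: divide_simps algebra_simps)
    qed
    ultimately have "f (-1 / (-1/z + 1)) = ((1 - z) / (z + 1)) ^ h * f u" by metis
    moreover have "-1/z + 1 = - (1 - z) / z" using n by (simp add: field_simps)
    ultimately have "f3 (-1/z) = ((1 - z) / (z + 1)) ^ h * f u / (- (1 - z) / z) ^ h"
      by (simp add: f3_def f2_def)
    also have "\<dots> = ((1 - z) / (z + 1) / (- (1 - z) / z)) ^ h * f u"
      by (simp only: power_divide) simp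
    also have "(1 - z) / (z + 1) / (- (1 - z) / z) = - z / (z + 1)"
    proof -
      have "x / y / (- x / w) = - w / y" if "x \<noteq> 0" for x y w :: complex
        using that by simp
      from this[OF n(5)] show ?thesis .
    qed
    also have "(- z / (z + 1)) ^ h * f u = (- z) ^ h * f3 z"
      unfolding f3_def f2_def u_def power_divide by (simp only: times_divide_eq_left times_divide_eq_right)
    finally show ?thesis .
  qed
  have f3_T: "f3 (z + 1) = f2 z" if H: "z \<in> upper_half_plane" for z
  proof -
    note n = nz[OF H]
    define u where "u = -1 / z"
    have u: "u \<in> upper_half_plane" unfolding u_def by (intro S_upper_half_plane H)
    \<comment> \<open>Here \<open>S T\<^sup>2 = \<gamma> S\<close> with \<open>\<gamma>\<close> in \<open>\<Gamma>\<^sub>0(2)\<close>.\<close>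
    have "f ((of_int 1 * u + of_int 0) / (of_int (-2) * u + of_int 1)) = (of_int (-2) * u + of_int 1) ^ h * f u"
      by (rule modular_forms_transform[OF f _ _ u]) auto
    moreover have den: "of_int (-2) * u + of_int 1 = (z + 2) / z"
      using n by (simp add: u_def field_simps)
    moreover have "(of_int 1 * u + of_int 0) / (of_int (-2) * u + of_int 1) = -1 / (z + 2)"
      unfolding den using n by (simp add: u_def)
    ultimately have "f (-1 / (z + 2)) = ((z + 2) / z) ^ h * f u" by metis
    then show ?thesis using n by (simp add: f3_def f2_def u_def power_divide add.assoc)
  qed
  have N_T: "N (z + 1) = N z" if "z \<in> upper_half_plane" for z
    using modular_forms_periodic[OF f that] f3_T[OF that]
    by (simp add: N_def P_def theta_translation f3_def mult_ac)
  have N_S: "N (-1/z) = N z" if H: "z \<in> upper_half_plane" for z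
  proof -
    have e: "(- z) ^ h = (-1) ^ h * z ^ h" by (rule power_minus)
    have s: "((-1 :: complex) ^ h) ^ 4 = 1" by (simp add: power_mult[symmetric] mult.commute[of h])
    have "(f (-1/z) * f2 (-1/z) * f3 (-1/z)) ^ 4 = (((-1) ^ h * (-1) ^ h * (z ^ h) ^ 3) * (f z * f2 z * f3 z)) ^ 4"
      unfolding f_S[OF H] f2_S[OF H] f3_S[OF H] e by (simp add: power3_eq_cube mult_ac)
    also have "\<dots> = ((z ^ h) ^ 3) ^ 4 * (f z * f2 z * f3 z) ^ 4"
      by (simp only: power_mult_distrib s) simp
    finally have num: "(f (-1/z) * f2 (-1/z) * f3 (-1/z)) ^ 4 = z ^ (12 * h) * (f z * f2 z * f3 z) ^ 4"
      by (simp add: power_mult[symmetric] mult_ac)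
    have "P (-1/z) = z ^ 12 * P z"
      unfolding P_def theta_power8_inversion[OF H] by (simp add: power_add[symmetric] mult_ac)
    then have den: "P (-1/z) ^ h = z ^ (12 * h) * P z ^ h"
      by (simp add: power_mult_distrib power_mult)
    show ?thesis unfolding N_def num den using nz(1)[OF H] by simp
  qed
  define m where "m = h div 4 + 1"
  define B where "B = fps_shift m A"
  have radA: "fps_conv_radius A \<ge> 1" using A by (simp add: has_q_expansion_def)
  have radB: "fps_conv_radius B \<ge> 1" using radA by (simp add: B_def)
  have AB: "A = fps_X ^ m * B"
  proof (rule fps_ext)
    fix n
    have "fps_nth A n = 0" if "n < m" using that by (intro vanish) (auto simp: m_def)
    then show "fps_nth A n = fps_nth (fps_X ^ m * B) n" by (simp add: B_def fps_X_power_mult_nth)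
  qed
  have m: "4 * m = h + (4 * m - h)" "4 * m - h > 0" by (auto simp: m_def)
  obtain L where L: "(f2 \<longlongrightarrow> L) at_i_infinity"
    using modular_forms_limit_at_0[OF f] unfolding f2_def[abs_def] by blast
  have "filterlim (\<lambda>z. z + 1) at_i_infinity at_i_infinity"
    by (simp add: filterlim_filtercomap_iff o_def filterlim_filtercomap)
  from filterlim_compose[OF L this] have L3: "(f3 \<longlongrightarrow> L) at_i_infinity" by (simp add: f3_def[abs_def])
  let ?q = "\<lambda>z. exp (2 * of_real pi * \<i> * z)"
  define G where "G z = ?q z ^ (4 * m - h) * eval_fps B (?q z) ^ 4 / (256 * eval_fps triangular_fps (?q z) ^ 8) ^ h" for z
  have "(G \<longlongrightarrow> 0 ^ (4 * m - h) * fps_nth B 0 ^ 4 / (256 * fps_nth triangular_fps 0 ^ 8) ^ h) at_i_infinity"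
    unfolding G_def[abs_def]
    by (intro tendsto_intros q_tendsto_0 eval_fps_tendsto_at_i_infinity radB fps_conv_radius_triangular)
      (simp add: triangular_fps_0)
  then have G0: "(G \<longlongrightarrow> 0) at_i_infinity" using m by (simp add: zero_power)
  have "((\<lambda>z. G z * (f2 z * f3 z) ^ 4 / (theta3 z ^ 8 * theta4 z ^ 8) ^ h) \<longlongrightarrow> 0 * (L * L) ^ 4 / (1 ^ 8 * 1 ^ 8) ^ h) at_i_infinity"
    by (intro tendsto_intros G0 L L3 theta3_tendsto theta4_tendsto) auto
  moreover have "eventually (\<lambda>z. G z * (f2 z * f3 z) ^ 4 / (theta3 z ^ 8 * theta4 z ^ 8) ^ h = N z) at_i_infinity"
    using eventually_at_i_infinity_upper
  proof eventually_elim
    fix z assume H: "z \<in> upper_half_plane"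
    let ?x = "?q z" and ?t = "eval_fps triangular_fps (?q z)"
    have x0: "?x \<noteq> 0" by simp
    have "f z = ?x ^ m * eval_fps B ?x"
      using A H eval_fps_mult[OF _ norm_less_radius[OF radB norm_q_less_1[OF H]], of "fps_X ^ m"]
      unfolding has_q_expansion_def AB by simp
    then have "f z ^ 4 = ?x ^ (4 * m) * eval_fps B ?x ^ 4"
      by (simp add: power_mult_distrib power_mult[symmetric] mult.commute)
    then have fz: "f z ^ 4 = ?x ^ h * (?x ^ (4 * m - h) * eval_fps B ?x ^ 4)"
      by (subst (asm) m(1)) (simp only: power_add mult.assoc)
    have "exp (\<i> * pi * z / 4) ^ 8 = ?x" by (simp add: exp_of_nat_mult[symmetric] mult_ac)
    then have t2: "theta2 z ^ 8 = ?x * (256 * ?t ^ 8)" by (simp add: theta2_def power_mult_distrib mult_ac)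
    have t0: "?t \<noteq> 0" by (rule eval_triangular_nonzero[OF norm_q_less_1[OF H]])
    show "G z * (f2 z * f3 z) ^ 4 / (theta3 z ^ 8 * theta4 z ^ 8) ^ h = N z"
      unfolding N_def G_def P_def power_mult_distrib fz t2 using x0 t0 by (simp add: mult.assoc)
  qed
  ultimately have N0: "(N \<longlongrightarrow> 0) at_i_infinity"
    by (simp add: Lim_transform_eventually)
  have "f z * f2 z * f3 z = 0" if "z \<in> upper_half_plane" for z
    using level_one_function_zero[OF hol_N N_T N_S N0 that] P_nz[OF that] by (simp add: N_def)
  then have "(\<forall>z\<in>upper_half_plane. f z * f2 z = 0) \<or> (\<forall>z\<in>upper_half_plane. f3 z = 0)"
    by (intro holomorphic_mult_eq_0[OF open_upper_half_plane connected_upper_half_plane] holomorphic_on_mult hol_f hol_f2 hol_f3)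
  moreover have "(\<forall>z\<in>upper_half_plane. f z = 0) \<or> (\<forall>z\<in>upper_half_plane. f2 z = 0)"
    if "\<forall>z\<in>upper_half_plane. f z * f2 z = 0"
    using that by (intro holomorphic_mult_eq_0[OF open_upper_half_plane connected_upper_half_plane] hol_f hol_f2) auto
  moreover have "\<forall>z\<in>upper_half_plane. f2 z = 0" if "\<forall>z\<in>upper_half_plane. f3 z = 0"
    using that f3_T T_upper_half_plane by metis
  moreover have "f z = 0" if "\<forall>z\<in>upper_half_plane. f2 z = 0"
    using that f2_S[OF z] S_upper_half_plane[OF z] nz(1)[OF z] by simp
  ultimately show ?thesis using z by blast
qed

section \<open>Substitutions and uniqueness for expansions at infinity\<close>

text \<open>The series \<open>f(-X)\<close>.\<close>

definition fps_twist :: "complex fps \<Rightarrow> complex fps" where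
  "fps_twist f = Abs_fps (\<lambda>n. (-1) ^ n * fps_nth f n)"

text \<open>The series \<open>f(X\<^sup>2)\<close>.\<close>

definition fps_spread :: "complex fps \<Rightarrow> complex fps" where
  "fps_spread f = Abs_fps (\<lambda>n. if even n then fps_nth f (n div 2) else 0)"

text \<open>The series \<open>g\<close> with \<open>g(X\<^sup>2) = f(X) + f(-X)\<close>. It produces expansions in \<open>q = p\<^sup>2\<close> from expansions
in \<open>p = exp (\<pi> i z)\<close>.\<close>

definition fps_even_part :: "complex fps \<Rightarrow> complex fps" where
  "fps_even_part f = Abs_fps (\<lambda>n. 2 * fps_nth f (2 * n))"

lemma twist_sums:
  assumes "fps_conv_radius f \<ge> 1" "norm x < 1"
  shows "(\<lambda>n. fps_nth (fps_twist f) n * x ^ n) sums eval_fps f (- x)"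
proof -
  have "(\<lambda>n. fps_nth f n * (- x) ^ n) sums eval_fps f (- x)"
    using assms by (intro sums_eval_fps_1) auto
  moreover have "fps_nth f n * (- x) ^ n = fps_nth (fps_twist f) n * x ^ n" for n
    by (simp add: fps_twist_def power_minus[of x])
  ultimately show ?thesis by simp
qed

lemma spread_sums:
  assumes "fps_conv_radius f \<ge> 1" "norm x < 1"
  shows "(\<lambda>n. fps_nth (fps_spread f) n * x ^ n) sums eval_fps f (x\<^sup>2)"
proof -
  have "norm (x\<^sup>2) < 1" using assms(2) by (simp add: norm_power power_less_one_iff)
  from sums_eval_fps_1[OF assms(1) this]
  have "(\<lambda>n. fps_nth (fps_spread f) (2 * n) * x ^ (2 * n)) sums eval_fps f (x\<^sup>2)"
    by (simp add: fps_spread_def power_mult)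
  then show ?thesis
    by (subst (asm) sums_mono_reindex[of "\<lambda>n. 2 * n" "\<lambda>n. fps_nth (fps_spread f) n * x ^ n"])
      (auto simp: strict_mono_def fps_spread_def elim!: evenE)
qed

lemma even_part_sums:
  assumes "fps_conv_radius f \<ge> 1" "norm x < 1"
  shows "(\<lambda>n. fps_nth (fps_even_part f) n * (x\<^sup>2) ^ n) sums (eval_fps f x + eval_fps f (- x))"
proof -
  have "(\<lambda>n. fps_nth f n * x ^ n + fps_nth (fps_twist f) n * x ^ n) sums (eval_fps f x + eval_fps f (- x))"
    by (intro sums_add sums_eval_fps_1 twist_sums assms)
  then have "(\<lambda>n. fps_nth f (2 * n) * x ^ (2 * n) + fps_nth (fps_twist f) (2 * n) * x ^ (2 * n)) sums (eval_fps f x + eval_fps f (- x))"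
    by (subst sums_mono_reindex[of "\<lambda>n. 2 * n" "\<lambda>n. fps_nth f n * x ^ n + fps_nth (fps_twist f) n * x ^ n"])
      (auto simp: strict_mono_def fps_twist_def minus_one_power_iff image_iff elim!: evenE)
  then show ?thesis by (simp add: fps_even_part_def fps_twist_def power_mult mult.assoc)
qed

lemma eval_fps_eq_sums: "(\<lambda>n. fps_nth f n * x ^ n) sums s \<Longrightarrow> eval_fps f x = s"
  by (simp add: eval_fps_def sums_iff)

lemma radius_twist: "fps_conv_radius f \<ge> 1 \<Longrightarrow> fps_conv_radius (fps_twist f) \<ge> 1"
  by (rule fps_conv_radius_ge_1I) (rule sums_summable[OF twist_sums])

lemma radius_spread: "fps_conv_radius f \<ge> 1 \<Longrightarrow> fps_conv_radius (fps_spread f) \<ge> 1"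
  by (rule fps_conv_radius_ge_1I) (rule sums_summable[OF spread_sums])

lemma radius_even_part:
  assumes "fps_conv_radius f \<ge> 1"
  shows "fps_conv_radius (fps_even_part f) \<ge> 1"
proof (rule fps_conv_radius_ge_1I)
  fix x :: complex assume x: "norm x < 1"
  have "norm (csqrt x) < 1" using x by (simp add: norm_csqrt)
  from sums_summable[OF even_part_sums[OF assms this]]
  show "summable (\<lambda>n. fps_nth (fps_even_part f) n * x ^ n)" by simp
qed

lemma eval_twist: "fps_conv_radius f \<ge> 1 \<Longrightarrow> norm x < 1 \<Longrightarrow> eval_fps (fps_twist f) x = eval_fps f (- x)"
  by (rule eval_fps_eq_sums[OF twist_sums])

lemma eval_spread: "fps_conv_radius f \<ge> 1 \<Longrightarrow> norm x < 1 \<Longrightarrow> eval_fps (fps_spread f) x = eval_fps f (x\<^sup>2)"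
  by (rule eval_fps_eq_sums[OF spread_sums])

lemma eval_even_part: "fps_conv_radius f \<ge> 1 \<Longrightarrow> norm x < 1 \<Longrightarrow>
    eval_fps (fps_even_part f) (x\<^sup>2) = eval_fps f x + eval_fps f (- x)"
  by (rule eval_fps_eq_sums[OF even_part_sums])

lemma radius_add: "fps_conv_radius f \<ge> 1 \<Longrightarrow> fps_conv_radius g \<ge> 1 \<Longrightarrow> fps_conv_radius (f + g :: complex fps) \<ge> 1"
  using fps_conv_radius_add[of f g] by (meson min.boundedI order_trans)

lemma radius_mult: "fps_conv_radius f \<ge> 1 \<Longrightarrow> fps_conv_radius g \<ge> 1 \<Longrightarrow> fps_conv_radius (f * g :: complex fps) \<ge> 1"
  using fps_conv_radius_mult[of f g] by (meson min.boundedI order_trans)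

lemma radius_power: "fps_conv_radius f \<ge> 1 \<Longrightarrow> fps_conv_radius (f ^ n :: complex fps) \<ge> 1"
  using fps_conv_radius_power[of f n] by (rule order_trans[rotated])

lemma radius_const: "fps_conv_radius (fps_const c :: complex fps) \<ge> 1"
  by simp

lemma radius_X: "fps_conv_radius (fps_X :: complex fps) \<ge> 1"
  by simp

lemma eval_fps_inj_on_disc:
  assumes "fps_conv_radius A \<ge> 1" "fps_conv_radius B \<ge> 1"
    and eq: "\<And>x. norm x < 1 \<Longrightarrow> x \<noteq> 0 \<Longrightarrow> eval_fps A x = eval_fps B (x :: complex)"
  shows "A = B"
proof -
  \<comment> \<open>The factor \<open>X\<close> makes the values agree at 0 as well.\<close>
  have rad: "fps_conv_radius (fps_X * A) \<ge> 1" "fps_conv_radius (fps_X * B) \<ge> 1"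
    by (intro radius_mult radius_X assms)+
  have "eventually (\<lambda>x. x \<in> ball 0 1) (nhds (0 :: complex))"
    by (intro eventually_nhds_in_open) auto
  then have "eventually (\<lambda>x. eval_fps (fps_X * A) x = eval_fps (fps_X * B) x) (nhds 0)"
  proof eventually_elim
    fix x :: complex assume x: "x \<in> ball 0 1"
    then show "eval_fps (fps_X * A) x = eval_fps (fps_X * B) x"
      using eq[of x] assms(1,2) by (cases "x = 0") (auto simp: eval_fps_mult norm_less_radius eval_fps_at_0)
  qed
  moreover have "fps_conv_radius (fps_X * A) > 0" "fps_conv_radius (fps_X * B) > 0"
    using rad by (auto intro: less_le_trans[of 0 1])
  ultimately have "fps_X * A = fps_X * B" by (intro eval_fps_eqD)
  then show ?thesis by simp
qed

lemma has_q_expansion_unique: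
  assumes "has_q_expansion f A" "has_q_expansion f B"
  shows "A = B"
proof (rule eval_fps_inj_on_disc)
  fix x :: complex assume "norm x < 1" "x \<noteq> 0"
  then obtain z where "z \<in> upper_half_plane" "exp (2 * of_real pi * \<i> * z / of_nat 1) = x"
    using exp_width_surj[of 1 x] by auto
  then show "eval_fps A x = eval_fps B x" using assms unfolding has_q_expansion_def by auto
qed (use assms in \<open>auto simp: has_q_expansion_def\<close>)

definition has_nome_expansion :: "(complex \<Rightarrow> complex) \<Rightarrow> complex fps \<Rightarrow> bool" where
  "has_nome_expansion f A \<longleftrightarrow> fps_conv_radius A \<ge> 1 \<and>
     (\<forall>z\<in>upper_half_plane. f z = eval_fps A (exp (\<i> * pi * z)))"

lemma has_nome_expansion_mult:
  "has_nome_expansion f A \<Longrightarrow> has_nome_expansion g B \<Longrightarrow> has_nome_expansion (\<lambda>z. f z * g z) (A * B)"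
  unfolding has_nome_expansion_def
  by (simp add: radius_mult eval_fps_mult norm_less_radius norm_nome_less_1 del: norm_exp_eq_Re)

lemma has_nome_expansion_add:
  "has_nome_expansion f A \<Longrightarrow> has_nome_expansion g B \<Longrightarrow> has_nome_expansion (\<lambda>z. f z + g z) (A + B)"
  unfolding has_nome_expansion_def
  by (simp add: radius_add eval_fps_add norm_less_radius norm_nome_less_1 del: norm_exp_eq_Re)

lemma has_nome_expansion_const: "has_nome_expansion (\<lambda>z. c) (fps_const c)"
  unfolding has_nome_expansion_def by simp

lemma has_nome_expansion_power:
  "has_nome_expansion f A \<Longrightarrow> has_nome_expansion (\<lambda>z. f z ^ n) (A ^ n)"
  unfolding has_nome_expansion_def
  by (simp add: radius_power eval_fps_power norm_less_radius norm_nome_less_1 del: norm_exp_eq_Re)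

lemma has_q_expansion_mult:
  "has_q_expansion f A \<Longrightarrow> has_q_expansion g B \<Longrightarrow> has_q_expansion (\<lambda>z. f z * g z) (A * B)"
  unfolding has_q_expansion_def
  by (simp add: radius_mult eval_fps_mult norm_less_radius norm_q_less_1 del: norm_exp_eq_Re)

lemma has_q_expansion_add:
  "has_q_expansion f A \<Longrightarrow> has_q_expansion g B \<Longrightarrow> has_q_expansion (\<lambda>z. f z + g z) (A + B)"
  unfolding has_q_expansion_def
  by (simp add: radius_add eval_fps_add norm_less_radius norm_q_less_1 del: norm_exp_eq_Re)

lemma has_q_expansion_const: "has_q_expansion (\<lambda>z. c) (fps_const c)"
  unfolding has_q_expansion_def by simp

lemma has_q_expansion_power:
  "has_q_expansion f A \<Longrightarrow> has_q_expansion (\<lambda>z. f z ^ n) (A ^ n)"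
  unfolding has_q_expansion_def
  by (simp add: radius_power eval_fps_power norm_less_radius norm_q_less_1 del: norm_exp_eq_Re)

lemma has_q_expansion_sum:
  assumes "\<And>i. i \<in> I \<Longrightarrow> has_q_expansion (f i) (A i)"
  shows "has_q_expansion (\<lambda>z. \<Sum>i\<in>I. f i z) (\<Sum>i\<in>I. A i)"
  using assms
proof (induction I rule: infinite_finite_induct)
  case (insert i I)
  then show ?case using has_q_expansion_add[of "f i" "A i"] by simp
qed (use has_q_expansion_const[of 0] in simp_all)

lemma exp_q_eq_nome_squared: "exp (2 * of_real pi * \<i> * z) = (exp (\<i> * pi * z))\<^sup>2"
  by (simp add: exp_double[symmetric] mult_ac)

section \<open>Modular forms built from theta constants\<close>

text \<open>A form \<open>F1\<close> for \<open>\<Gamma>\<^sub>0(2)\<close> together with its conjugates \<open>F2 = F1|S\<close> and \<open>F3 = F1|ST\<close>. Carrying the conjugates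
along reduces modularity to relations for inversion and translation, reduces holomorphy at all cusps
to three expansions in \<open>exp (\<pi> i z)\<close>, and makes the notion closed under products.\<close>

definition three_term_form :: "nat \<Rightarrow> (complex \<Rightarrow> complex) \<Rightarrow> (complex \<Rightarrow> complex) \<Rightarrow> (complex \<Rightarrow> complex) \<Rightarrow> bool" where
  "three_term_form w F1 F2 F3 \<longleftrightarrow> F1 holomorphic_on upper_half_plane \<and>
     (\<forall>z\<in>upper_half_plane. F1 (-1/z) = z ^ w * F2 z \<and> F2 (-1/z) = z ^ w * F1 z \<and> F3 (-1/z) = z ^ w * F3 z \<and>
        F1 (z + 1) = F1 z \<and> F2 (z + 1) = F3 z \<and> F3 (z + 1) = F2 z) \<and>
     (\<exists>A. has_nome_expansion F1 A) \<and> (\<exists>A. has_nome_expansion F2 A) \<and> (\<exists>A. has_nome_expansion F3 A)"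

lemma three_term_form_mult:
  assumes "three_term_form w F1 F2 F3" "three_term_form v G1 G2 G3"
  shows "three_term_form (w + v) (\<lambda>z. F1 z * G1 z) (\<lambda>z. F2 z * G2 z) (\<lambda>z. F3 z * G3 z)"
proof -
  have "\<exists>A. has_nome_expansion (\<lambda>z. F z * G z) A" if "\<exists>A. has_nome_expansion F A" "\<exists>A. has_nome_expansion G A" for F G
    using that has_nome_expansion_mult by blast
  then show ?thesis
    using assms holomorphic_on_mult[of F1 upper_half_plane G1] unfolding three_term_form_def
    by (simp add: power_add mult_ac del: divide_minus_left)
qed

lemma three_term_form_1: "three_term_form 0 (\<lambda>z. 1) (\<lambda>z. 1) (\<lambda>z. 1)"
  using has_nome_expansion_const[of 1] by (auto simp: three_term_form_def)

lemma three_term_form_power: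
  assumes "three_term_form w F1 F2 F3"
  shows "three_term_form (n * w) (\<lambda>z. F1 z ^ n) (\<lambda>z. F2 z ^ n) (\<lambda>z. F3 z ^ n)"
proof (induction n)
  case (Suc n)
  show ?case using three_term_form_mult[OF assms Suc] by simp
qed (simp add: three_term_form_1)

lemma three_term_form_transform:
  fixes a b c d :: int
  assumes "three_term_form w F1 F2 F3" "a * d - b * c = 1" "z \<in> upper_half_plane"
  shows "F1 ((of_int a * z + of_int b) / (of_int c * z + of_int d)) =
    (of_int c * z + of_int d) ^ w * (if even c then F1 z else if even d then F2 z else F3 z)"
  by (rule three_term_modularity) (use assms in \<open>auto simp: three_term_form_def\<close>)

definition zero_extend :: "(complex \<Rightarrow> complex) \<Rightarrow> complex \<Rightarrow> complex" where
  "zero_extend F z = (if z \<in> upper_half_plane then F z else 0)"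

lemma has_nome_expansion_imp_holomorphic_at_infinity:
  assumes "has_nome_expansion F A" "\<And>z. z \<in> upper_half_plane \<Longrightarrow> G z = F z"
  shows "holomorphic_at_infinity G"
proof -
  have "(\<lambda>n. fps_nth A n * exp (2 * of_real pi * \<i> * z / of_nat 2) ^ n) sums G z"
    if z: "z \<in> upper_half_plane" for z
  proof -
    have "2 * of_real pi * \<i> * z / of_nat 2 = \<i> * of_real pi * z" by simp
    moreover have "(\<lambda>n. fps_nth A n * exp (\<i> * of_real pi * z) ^ n) sums G z"
      using assms z sums_eval_fps_1[OF _ norm_nome_less_1[OF z], of A] by (simp add: has_nome_expansion_def)
    ultimately show ?thesis by (simp only:)
  qed
  then show ?thesis
    unfolding holomorphic_at_infinity_def by (intro exI[of _ "2::nat"] conjI exI[of _ "fps_nth A"] ballI) auto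
qed

lemma three_term_form_modular:
  assumes F: "three_term_form w F1 F2 F3"
  shows "zero_extend F1 \<in> modular_forms 2 w"
proof -
  have det: "g$1$1 * g$2$2 - g$1$2 * g$2$1 = 1" if "g \<in> SL2Z" for g
    using that by (simp add: SL2Z_def det_2)
  have tr: "zero_extend F1 (mobius g z) = (of_int (g$2$1) * z + of_int (g$2$2)) ^ w *
      (if even (g$2$1) then F1 z else if even (g$2$2) then F2 z else F3 z)"
    if "g \<in> SL2Z" "z \<in> upper_half_plane" for g z
    using mobius_in_upper_half_plane[OF det[OF that(1)] that(2)]
      three_term_form_transform[OF F det[OF that(1)] that(2)]
    by (simp add: zero_extend_def mobius_def)
  have "zero_extend F1 holomorphic_on upper_half_plane"
    using F unfolding three_term_form_def
    by (auto simp: zero_extend_def intro: holomorphic_transform[of F1])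
  moreover have "zero_extend F1 (mobius g z) = (of_int (g$2$1) * z + of_int (g$2$2)) ^ w * zero_extend F1 z"
    if "g \<in> Gamma0 2" "z \<in> upper_half_plane" for g z
    using that tr[of g z] by (simp add: Gamma0_def zero_extend_def)
  moreover have "holomorphic_at_infinity (slash w (zero_extend F1) g)" if g: "g \<in> SL2Z" for g
  proof -
    have "slash w (zero_extend F1) g z = (if even (g$2$1) then F1 else if even (g$2$2) then F2 else F3) z"
      if z: "z \<in> upper_half_plane" for z
      using tr[OF g z] mobius_denominator_nonzero[OF det[OF g] z] by (simp add: slash_def)
    moreover have "\<exists>A. has_nome_expansion (if even (g$2$1) then F1 else if even (g$2$2) then F2 else F3) A"
      using F by (auto simp: three_term_form_def)
    ultimately show ?thesis using has_nome_expansion_imp_holomorphic_at_infinity by blast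
  qed
  ultimately show ?thesis by (simp add: modular_forms_def zero_extend_def)
qed

definition theta3_fps :: "complex fps" where
  "theta3_fps = 1 + fps_const 2 * square_fps"

lemma radius_theta3: "fps_conv_radius theta3_fps \<ge> 1"
  unfolding theta3_fps_def by (intro radius_add radius_mult radius_const fps_conv_radius_square) simp

lemma eval_theta3_fps:
  assumes "norm x < 1"
  shows "eval_fps theta3_fps x = 1 + 2 * eval_fps square_fps x"
proof -
  have r: "ereal (norm x) < fps_conv_radius (fps_const 2 * square_fps)"
    by (intro norm_less_radius radius_mult radius_const fps_conv_radius_square assms)
  have "eval_fps theta3_fps x = eval_fps 1 x + eval_fps (fps_const 2 * square_fps) x"
    unfolding theta3_fps_def by (rule eval_fps_add[OF _ r]) simp
  also have "eval_fps (fps_const 2 * square_fps) x = eval_fps (fps_const 2) x * eval_fps square_fps x"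
    by (rule eval_fps_mult) (simp, rule norm_less_radius[OF fps_conv_radius_square assms])
  finally show ?thesis by (simp only: eval_fps_1 eval_fps_const)
qed

lemma theta3_nome: "has_nome_expansion theta3 theta3_fps"
  by (simp add: has_nome_expansion_def theta3_def radius_theta3 eval_theta3_fps norm_nome_less_1 del: norm_exp_eq_Re)

lemma theta4_eval: "z \<in> upper_half_plane \<Longrightarrow> theta4 z = eval_fps theta3_fps (- exp (\<i> * pi * z))"
  using norm_nome_less_1[of z] by (simp add: theta4_def eval_theta3_fps del: norm_exp_eq_Re)

lemma theta4_nome: "has_nome_expansion theta4 (fps_twist theta3_fps)"
  by (simp add: has_nome_expansion_def theta4_eval radius_theta3 radius_twist eval_twist norm_nome_less_1 del: norm_exp_eq_Re)

lemma theta2_power4: "theta2 z ^ 4 = 16 * exp (\<i> * pi * z) * eval_fps triangular_fps (exp (2 * of_real pi * \<i> * z)) ^ 4"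
proof -
  have "exp (\<i> * pi * z / 4) ^ 4 = exp (\<i> * pi * z)" by (simp add: exp_of_nat_mult[symmetric])
  then show ?thesis by (simp add: theta2_def power_mult_distrib)
qed

lemma theta2_power8: "theta2 z ^ 8 = 256 * exp (2 * of_real pi * \<i> * z) * eval_fps triangular_fps (exp (2 * of_real pi * \<i> * z)) ^ 8"
proof -
  have "exp (\<i> * pi * z / 4) ^ 8 = exp (2 * of_real pi * \<i> * z)" by (simp add: exp_of_nat_mult[symmetric] mult_ac)
  then show ?thesis by (simp add: theta2_def power_mult_distrib)
qed

lemma theta2_power4_nome:
  "has_nome_expansion (\<lambda>z. theta2 z ^ 4) (fps_const 16 * fps_X * fps_spread triangular_fps ^ 4)"
proof -
  have "has_nome_expansion (\<lambda>z. exp (\<i> * pi * z)) fps_X" by (simp add: has_nome_expansion_def)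
  moreover have "has_nome_expansion (\<lambda>z. eval_fps triangular_fps (exp (2 * of_real pi * \<i> * z))) (fps_spread triangular_fps)"
    by (simp add: has_nome_expansion_def eval_spread radius_spread fps_conv_radius_triangular norm_nome_less_1 exp_q_eq_nome_squared del: norm_exp_eq_Re)
  ultimately show ?thesis unfolding theta2_power4
    by (intro has_nome_expansion_mult has_nome_expansion_const has_nome_expansion_power)
qed

text \<open>This is \<open>\<eta>(2z) ^ 16 / \<eta>(z) ^ 8 = q + 8 q\<^sup>2 + \<dots>\<close>, whose only zero is a simple one at infinity.\<close>

definition psi :: "complex \<Rightarrow> complex" where "psi z = theta2 z ^ 8 / 256"
definition psi_fps :: "complex fps" where "psi_fps = fps_X * triangular_fps ^ 8"

lemma psi_q_expansion: "has_q_expansion psi psi_fps"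
proof -
  have "has_q_expansion (\<lambda>z. exp (2 * of_real pi * \<i> * z)) fps_X" by (simp add: has_q_expansion_def)
  moreover have "has_q_expansion (\<lambda>z. eval_fps triangular_fps (exp (2 * of_real pi * \<i> * z))) triangular_fps"
    by (simp add: has_q_expansion_def fps_conv_radius_triangular)
  ultimately have "has_q_expansion (\<lambda>z. exp (2 * of_real pi * \<i> * z) * eval_fps triangular_fps (exp (2 * of_real pi * \<i> * z)) ^ 8) psi_fps"
    unfolding psi_fps_def by (intro has_q_expansion_mult has_q_expansion_power)
  then show ?thesis by (simp add: psi_def[abs_def] theta2_power8)
qed

lemma psi_three_term: "three_term_form 4 psi (\<lambda>z. theta4 z ^ 8 / 256) (\<lambda>z. theta3 z ^ 8 / 256)"
proof -
  have "has_nome_expansion (\<lambda>z. (theta2 z ^ 4) ^ 2 * (1/256)) ((fps_const 16 * fps_X * fps_spread triangular_fps ^ 4) ^ 2 * fps_const (1/256))"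
    by (intro has_nome_expansion_mult has_nome_expansion_const has_nome_expansion_power theta2_power4_nome)
  then have "\<exists>A. has_nome_expansion psi A" by (auto simp: psi_def[abs_def] power_mult[symmetric])
  moreover have "has_nome_expansion (\<lambda>z. theta4 z ^ 8 * (1/256)) ((fps_twist theta3_fps) ^ 8 * fps_const (1/256))"
    "has_nome_expansion (\<lambda>z. theta3 z ^ 8 * (1/256)) (theta3_fps ^ 8 * fps_const (1/256))"
    by (intro has_nome_expansion_mult has_nome_expansion_const has_nome_expansion_power theta3_nome theta4_nome)+
  then have "\<exists>A. has_nome_expansion (\<lambda>z. theta4 z ^ 8 / 256) A" "\<exists>A. has_nome_expansion (\<lambda>z. theta3 z ^ 8 / 256) A"
    by auto
  moreover have "psi holomorphic_on upper_half_plane"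
    unfolding psi_def[abs_def] by (intro holomorphic_intros holomorphic_theta2) auto
  ultimately show ?thesis unfolding three_term_form_def
    by (simp add: psi_def theta_power8_inversion theta_translation del: divide_minus_left)
qed

text \<open>Twice the Eisenstein series \<open>2 E\<^sub>2(2z) - E\<^sub>2(z) = 1 + 24 q + \<dots>\<close> of weight 2 for \<open>\<Gamma>\<^sub>0(2)\<close>.\<close>

definition eis2 :: "complex \<Rightarrow> complex" where "eis2 z = theta3 z ^ 4 + theta4 z ^ 4"
definition eis2_fps :: "complex fps" where "eis2_fps = fps_even_part (theta3_fps ^ 4)"

lemma theta_sum_q_expansion:
  "has_q_expansion (\<lambda>z. theta3 z ^ n + theta4 z ^ n) (fps_even_part (theta3_fps ^ n))"
  unfolding has_q_expansion_def
proof (intro conjI ballI)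
  have rad: "fps_conv_radius (theta3_fps ^ n) \<ge> 1" by (intro radius_power radius_theta3)
  then show "fps_conv_radius (fps_even_part (theta3_fps ^ n)) \<ge> 1" by (rule radius_even_part)
  fix z assume z: "z \<in> upper_half_plane"
  let ?p = "exp (\<i> * pi * z)"
  have p: "norm ?p < 1" "norm (- ?p) < 1"
    using norm_nome_less_1[OF z] by (simp_all only: norm_minus_cancel)
  have "theta3 z = eval_fps theta3_fps ?p" using theta3_nome z by (simp add: has_nome_expansion_def)
  then show "theta3 z ^ n + theta4 z ^ n = eval_fps (fps_even_part (theta3_fps ^ n)) (exp (2 * of_real pi * \<i> * z))"
    unfolding exp_q_eq_nome_squared eval_even_part[OF rad p(1)] theta4_eval[OF z]
    by (simp only: eval_fps_power norm_less_radius[OF radius_theta3 p(1)] norm_less_radius[OF radius_theta3 p(2)])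
qed

lemma eis2_q_expansion: "has_q_expansion eis2 eis2_fps"
  unfolding eis2_def[abs_def] eis2_fps_def by (rule theta_sum_q_expansion)

lemma eis2_three_term:
  "three_term_form 2 eis2 (\<lambda>z. - (theta3 z ^ 4 + theta2 z ^ 4)) (\<lambda>z. theta2 z ^ 4 - theta4 z ^ 4)"
proof -
  note n3 = has_nome_expansion_power[OF theta3_nome, of 4] and n4 = has_nome_expansion_power[OF theta4_nome, of 4]
    and n2 = theta2_power4_nome and c = has_nome_expansion_mult[OF has_nome_expansion_const[of "-1"]]
  have "\<exists>A. has_nome_expansion eis2 A"
    unfolding eis2_def[abs_def] using has_nome_expansion_add[OF n3 n4] by blast
  moreover have "\<exists>A. has_nome_expansion (\<lambda>z. - (theta3 z ^ 4 + theta2 z ^ 4)) A"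
    using c[OF has_nome_expansion_add[OF n3 n2]] by auto
  moreover have "\<exists>A. has_nome_expansion (\<lambda>z. theta2 z ^ 4 - theta4 z ^ 4) A"
    using has_nome_expansion_add[OF n2 c[OF n4]] by auto
  moreover have "eis2 holomorphic_on upper_half_plane"
    unfolding eis2_def[abs_def] by (intro holomorphic_intros holomorphic_theta3 holomorphic_theta4)
  ultimately show ?thesis unfolding three_term_form_def
    by (simp add: eis2_def theta_power4_inversion theta_translation algebra_simps del: divide_minus_left)
qed

text \<open>Twice the Eisenstein series \<open>E\<^sub>4 = 1 + 240 q + \<dots>\<close> of the full modular group.\<close>

definition eis4 :: "complex \<Rightarrow> complex" where
  "eis4 z = theta2 z ^ 8 + (theta3 z ^ 8 + theta4 z ^ 8)"
definition eis4_fps :: "complex fps" where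
  "eis4_fps = fps_const 256 * psi_fps + fps_even_part (theta3_fps ^ 8)"

lemma eis4_q_expansion: "has_q_expansion eis4 eis4_fps"
proof -
  have "has_q_expansion (\<lambda>z. 256 * psi z + (theta3 z ^ 8 + theta4 z ^ 8)) eis4_fps"
    unfolding eis4_fps_def
    by (intro has_q_expansion_add has_q_expansion_mult has_q_expansion_const psi_q_expansion theta_sum_q_expansion)
  then show ?thesis by (simp add: psi_def eis4_def[abs_def])
qed

lemma holomorphic_eis4: "eis4 holomorphic_on upper_half_plane"
  unfolding eis4_def[abs_def] by (intro holomorphic_intros holomorphic_theta2 holomorphic_theta3 holomorphic_theta4)

lemma eis4_S: "z \<in> upper_half_plane \<Longrightarrow> eis4 (-1/z) = z ^ 4 * eis4 z"
  unfolding eis4_def by (simp add: theta_power8_inversion algebra_simps del: divide_minus_left)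

lemma eis4_T: "eis4 (z + 1) = eis4 z"
  by (simp add: eis4_def theta_translation)

lemma eis4_transform:
  fixes a b c d :: int
  assumes "a * d - b * c = 1" "z \<in> upper_half_plane"
  shows "eis4 ((of_int a * z + of_int b) / (of_int c * z + of_int d)) = (of_int c * z + of_int d) ^ 4 * eis4 z"
  using three_term_modularity[of eis4 4 eis4 eis4, OF eis4_S eis4_S eis4_S eis4_T eis4_T eis4_T assms]
  by (simp split: if_splits)

text \<open>The choice of \<open>2 E\<^sub>4(2z)\<close> as second generator matters for signs: it is a power series in \<open>q\<^sup>2\<close> with
nonnegative coefficients, and these stay nonnegative when \<open>q\<close> is replaced by \<open>- q\<close>.\<close>

definition phi :: "complex \<Rightarrow> complex" where "phi z = eis4 (2 * z)"
definition phi_fps :: "complex fps" where "phi_fps = fps_spread eis4_fps"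

lemma radius_eis4: "fps_conv_radius eis4_fps \<ge> 1"
  using eis4_q_expansion by (simp add: has_q_expansion_def)

lemma phi_q_expansion: "has_q_expansion phi phi_fps"
  unfolding has_q_expansion_def phi_fps_def
proof (intro conjI ballI radius_spread radius_eis4)
  fix z assume z: "z \<in> upper_half_plane"
  have "2 * z \<in> upper_half_plane" using z by (simp add: in_upper_half_plane)
  then have "phi z = eval_fps eis4_fps (exp (2 * of_real pi * \<i> * (2 * z)))"
    using eis4_q_expansion by (simp add: has_q_expansion_def phi_def)
  also have "exp (2 * of_real pi * \<i> * (2 * z)) = (exp (2 * of_real pi * \<i> * z))\<^sup>2"
    by (simp add: exp_double[symmetric] mult_ac)
  finally show "phi z = eval_fps (fps_spread eis4_fps) (exp (2 * of_real pi * \<i> * z))"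
    by (simp add: eval_spread radius_eis4 norm_q_less_1 z del: norm_exp_eq_Re)
qed

lemma phi_three_term: "three_term_form 4 phi (\<lambda>z. eis4 (z / 2) / 16) (\<lambda>z. eis4 ((z + 1) / 2) / 16)"
proof -
  have half: "z / 2 \<in> upper_half_plane" "(z + 1) / 2 \<in> upper_half_plane" "2 * z \<in> upper_half_plane"
    if "z \<in> upper_half_plane" for z
    using that by (simp_all add: in_upper_half_plane)
  have ev: "eis4 w = eval_fps eis4_fps (exp (2 * of_real pi * \<i> * w))" if "w \<in> upper_half_plane" for w
    using eis4_q_expansion that by (simp add: has_q_expansion_def)
  have "has_nome_expansion phi (fps_spread phi_fps)"
    using phi_q_expansion unfolding has_nome_expansion_def has_q_expansion_def
    by (simp add: radius_spread eval_spread norm_nome_less_1 exp_q_eq_nome_squared del: norm_exp_eq_Re)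
  moreover have e: "exp (2 * of_real pi * \<i> * (z / 2)) = exp (\<i> * pi * z)" for z by (simp add: mult_ac)
  have "has_nome_expansion (\<lambda>z. eis4 (z / 2)) eis4_fps"
    unfolding has_nome_expansion_def using radius_eis4 half by (simp add: ev mult_ac)
  from has_nome_expansion_mult[OF this has_nome_expansion_const[of "1/16"]]
  have "\<exists>A. has_nome_expansion (\<lambda>z. eis4 (z / 2) / 16) A" by auto
  moreover have "has_nome_expansion (\<lambda>z. eis4 ((z + 1) / 2)) (fps_twist eis4_fps)"
    unfolding has_nome_expansion_def
  proof (intro conjI ballI radius_twist radius_eis4)
    fix z assume z: "z \<in> upper_half_plane"
    have "exp (2 * of_real pi * \<i> * ((z + 1) / 2)) = - exp (\<i> * pi * z)"
      unfolding e by (simp add: distrib_left exp_add)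
    then show "eis4 ((z + 1) / 2) = eval_fps (fps_twist eis4_fps) (exp (\<i> * pi * z))"
      using half[OF z] by (simp only: ev eval_twist radius_eis4 norm_nome_less_1 z)
  qed
  from has_nome_expansion_mult[OF this has_nome_expansion_const[of "1/16"]]
  have "\<exists>A. has_nome_expansion (\<lambda>z. eis4 ((z + 1) / 2) / 16) A" by auto
  moreover have "phi holomorphic_on upper_half_plane"
  proof -
    have "(eis4 \<circ> (\<lambda>z. 2 * z)) holomorphic_on upper_half_plane"
      using half by (intro holomorphic_on_compose_gen[OF _ holomorphic_eis4] holomorphic_intros) auto
    then show ?thesis by (simp add: phi_def[abs_def] o_def)
  qed
  moreover have "phi (-1/z) = z ^ 4 * (eis4 (z / 2) / 16)" if z: "z \<in> upper_half_plane" for z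
    using eis4_S[OF half(1)[OF z]] by (simp add: phi_def power_divide)
  moreover have "eis4 ((-1/z) / 2) / 16 = z ^ 4 * phi z" if z: "z \<in> upper_half_plane" for z
    using eis4_S[OF half(3)[OF z]] by (simp add: phi_def power_mult_distrib mult.commute)
  moreover have "eis4 ((-1/z + 1) / 2) / 16 = z ^ 4 * (eis4 ((z + 1) / 2) / 16)" if z: "z \<in> upper_half_plane" for z
  proof -
    define w where "w = (z + 1) / 2"
    have z0: "z \<noteq> 0" using z by (auto simp: in_upper_half_plane)
    \<comment> \<open>In terms of \<open>w = (z + 1) / 2\<close>, inversion of \<open>z = 2 w - 1\<close> is the unimodular map \<open>w \<mapsto> (w - 1) / (2 w - 1)\<close>.\<close>
    have t: "eis4 ((of_int 1 * w + of_int (-1)) / (of_int 2 * w + of_int (-1))) = (of_int 2 * w + of_int (-1)) ^ 4 * eis4 w"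
      using half(2)[OF z] by (intro eis4_transform) (auto simp: w_def)
    have den: "of_int 2 * w + of_int (-1) = z" by (simp add: w_def del: distrib_left_numeral)
    have num: "of_int 1 * w + of_int (-1) = (z - 1) / 2" by (simp add: w_def field_simps)
    have quot: "(z - 1) / 2 / z = (-1/z + 1) / 2" using z0 by (simp add: field_simps)
    show ?thesis using t unfolding den num quot by (simp only: w_def times_divide_eq_right)
  qed
  moreover have "phi (z + 1) = phi z" for z
  proof -
    have "phi (z + 1) = eis4 (2 * z + 1 + 1)" by (simp add: phi_def distrib_left add.assoc)
    then show ?thesis by (simp only: eis4_T phi_def)
  qed
  moreover have "eis4 ((z + 1 + 1) / 2) / 16 = eis4 (z / 2) / 16" for z
  proof -
    have "(z + (1 + 1)) / 2 = z / 2 + 1" unfolding add_divide_distrib by simp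
    then have "(z + 1 + 1) / 2 = z / 2 + 1" by (simp only: add.assoc)
    then show ?thesis by (simp only: eis4_T)
  qed
  ultimately show ?thesis unfolding three_term_form_def by (intro conjI ballI) blast+
qed

section \<open>The dimension of the space of forms\<close>

text \<open>Holomorphy at infinity provides an expansion in \<open>exp (2 \<pi> i z / w)\<close>. The translation \<open>z \<mapsto> z + 1\<close>
multiplies its coefficient of index \<open>n\<close> by the power \<open>\<zeta> ^ n\<close> of a primitive \<open>w\<close>-th root of unity, so
invariance leaves only the indices divisible by \<open>w\<close>.\<close>

lemma modular_forms_q_expansion:
  assumes f: "f \<in> modular_forms 2 h"
  shows "\<exists>A. has_q_expansion f A"
proof -
  have "holomorphic_at_infinity (slash h f (int_mat 1 0 0 1))"
    using f by (simp add: modular_forms_def)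
  then have "holomorphic_at_infinity f" by (simp add: slash_def[abs_def] mobius_def)
  then obtain w :: nat and A where w: "w > 0" and rad: "fps_conv_radius A \<ge> 1"
    and A: "\<And>z. z \<in> upper_half_plane \<Longrightarrow> f z = eval_fps A (exp (2 * of_real pi * \<i> * z / of_nat w))"
    by (rule holomorphic_at_infinity_fps) blast
  define \<zeta> where "\<zeta> = exp (2 * of_real pi * \<i> / of_nat w)"
  have norm_zeta: "norm \<zeta> = 1" by (simp add: \<zeta>_def norm_exp_eq_Re)
  define B where "B = Abs_fps (\<lambda>n. \<zeta> ^ n * fps_nth A n)"
  have sumsB: "(\<lambda>n. fps_nth B n * x ^ n) sums eval_fps A (\<zeta> * x)" if "norm x < 1" for x
    using sums_eval_fps_1[OF rad, of "\<zeta> * x"] that norm_zeta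
    by (simp add: B_def norm_mult power_mult_distrib mult_ac)
  have "A = B"
  proof (rule eval_fps_inj_on_disc[OF rad])
    show "fps_conv_radius B \<ge> 1"
      by (rule fps_conv_radius_ge_1I) (rule sums_summable[OF sumsB])
    fix x :: complex assume x: "norm x < 1" "x \<noteq> 0"
    then obtain z where z: "z \<in> upper_half_plane" "exp (2 * of_real pi * \<i> * z / of_nat w) = x"
      using exp_width_surj[OF w] by blast
    have "\<zeta> * x = exp (2 * of_real pi * \<i> * (z + 1) / of_nat w)"
      unfolding \<zeta>_def z(2)[symmetric] exp_add[symmetric] by (simp add: add_divide_distrib distrib_left add.commute)
    then have "eval_fps A (\<zeta> * x) = eval_fps A x"
      using A[OF T_upper_half_plane[OF z(1)]] A[OF z(1)] modular_forms_periodic[OF f z(1)] z(2) by simp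
    then show "eval_fps A x = eval_fps B x"
      using eval_fps_eq_sums[OF sumsB[OF x(1)]] by simp
  qed
  have supp: "fps_nth A n = 0" if "\<not> w dvd n" for n
  proof -
    have "\<zeta> ^ n \<noteq> 1"
    proof
      assume "\<zeta> ^ n = 1"
      then have "exp (2 * of_real pi * \<i> * (of_nat n / of_nat w)) = 1"
        by (simp add: \<zeta>_def exp_of_nat_mult[symmetric] mult_ac)
      then obtain k :: int where "2 * pi * (real n / real w) = of_int (2 * k) * pi"
        unfolding exp_eq_1 by auto
      then have "2 * pi * (real n / real w - of_int k) = 0" by (simp add: algebra_simps)
      then have "real n / real w = of_int k" by simp
      then have "real_of_int (int n) = of_int (k * int w)" using w by (simp add: field_simps)
      then have "int n = k * int w" by (simp only: of_int_eq_iff)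
      then show False using that by (metis dvd_triv_right int_dvd_int_iff)
    qed
    moreover have "fps_nth A n = \<zeta> ^ n * fps_nth A n" using arg_cong[OF \<open>A = B\<close>, of "\<lambda>f. fps_nth f n"] by (simp add: B_def)
    ultimately show ?thesis by simp
  qed
  define C where "C = Abs_fps (\<lambda>n. fps_nth A (w * n))"
  have sumsC: "(\<lambda>n. fps_nth C n * exp (2 * of_real pi * \<i> * z) ^ n) sums f z" if z: "z \<in> upper_half_plane" for z
  proof -
    define x where "x = exp (2 * of_real pi * \<i> * z / of_nat w)"
    have xw: "x ^ w = exp (2 * of_real pi * \<i> * z)"
      using w by (simp add: x_def exp_of_nat_mult[symmetric])
    have "norm (x ^ w) < 1" unfolding xw by (rule norm_q_less_1[OF z])
    then have "norm x < 1" using w by (simp add: norm_power power_less_one_iff)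
    then have "(\<lambda>n. fps_nth A n * x ^ n) sums f z"
      using sums_eval_fps_1[OF rad] A[OF z] by (simp add: x_def)
    then have "(\<lambda>n. fps_nth A (w * n) * x ^ (w * n)) sums f z"
      by (subst sums_mono_reindex[of "\<lambda>n. w * n" "\<lambda>n. fps_nth A n * x ^ n"])
        (use w supp in \<open>auto simp: strict_mono_def dvd_def\<close>)
    then show ?thesis by (simp add: C_def power_mult xw)
  qed
  have "has_q_expansion f C"
    unfolding has_q_expansion_def
  proof (intro conjI ballI)
    show "fps_conv_radius C \<ge> 1"
    proof (rule fps_conv_radius_ge_1I)
      fix x :: complex assume "norm x < 1" "x \<noteq> 0"
      then obtain z where "z \<in> upper_half_plane" "exp (2 * of_real pi * \<i> * z / of_nat 1) = x"
        using exp_width_surj[of 1 x] by auto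
      then show "summable (\<lambda>n. fps_nth C n * x ^ n)" using sums_summable[OF sumsC] by auto
    qed
    show "f z = eval_fps C (exp (2 * of_real pi * \<i> * z))" if "z \<in> upper_half_plane" for z
      using eval_fps_eq_sums[OF sumsC[OF that]] by simp
  qed
  then show ?thesis by blast
qed

lemma modular_forms_power:
  assumes f: "f \<in> modular_forms 2 h" and "n > 0"
  shows "(\<lambda>z. f z ^ n) \<in> modular_forms 2 (n * h)"
proof -
  have "(\<lambda>z. f z ^ n) holomorphic_on upper_half_plane"
    by (intro holomorphic_on_power modular_forms_holomorphic[OF f])
  moreover have "f (mobius g z) ^ n = (of_int (g$2$1) * z + of_int (g$2$2)) ^ (n * h) * f z ^ n"
    if "g \<in> Gamma0 2" "z \<in> upper_half_plane" for g z
    using f that by (simp add: modular_forms_def power_mult_distrib power_mult mult.commute[of n])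
  moreover have "holomorphic_at_infinity (slash (n * h) (\<lambda>z. f z ^ n) g)" if g: "g \<in> SL2Z" for g
  proof -
    have "holomorphic_at_infinity (slash h f g)" using f g by (simp add: modular_forms_def)
    then obtain w :: nat and A where w: "w > 0" and rad: "fps_conv_radius A \<ge> 1"
      and A: "\<And>z. z \<in> upper_half_plane \<Longrightarrow> slash h f g z = eval_fps A (exp (2 * of_real pi * \<i> * z / of_nat w))"
      by (rule holomorphic_at_infinity_fps) blast
    have "(\<lambda>k. fps_nth (A ^ n) k * exp (2 * of_real pi * \<i> * z / of_nat w) ^ k) sums slash (n * h) (\<lambda>z. f z ^ n) g z"
      if z: "z \<in> upper_half_plane" for z
    proof -
      let ?x = "exp (2 * of_real pi * \<i> * z / of_nat w)"
      have "norm (?x ^ w) < 1"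
        using w norm_q_less_1[OF z] by (simp add: exp_of_nat_mult[symmetric] del: norm_exp_eq_Re)
      then have x: "norm ?x < 1" using w by (simp add: norm_power power_less_one_iff del: norm_exp_eq_Re)
      have "slash (n * h) (\<lambda>z. f z ^ n) g z = slash h f g z ^ n"
        by (simp add: slash_def power_divide power_mult mult.commute[of n])
      also have "\<dots> = eval_fps (A ^ n) ?x"
        unfolding A[OF z] by (rule eval_fps_power[OF norm_less_radius[OF rad x], symmetric])
      finally show ?thesis using sums_eval_fps_1[OF radius_power[OF rad] x] by simp
    qed
    then show ?thesis using w unfolding holomorphic_at_infinity_def by blast
  qed
  moreover have "f z ^ n = 0" if "z \<notin> upper_half_plane" for z
    using f that \<open>n > 0\<close> by (simp add: modular_forms_def)
  ultimately show ?thesis by (simp add: modular_forms_def)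
qed

lemma triangular_elimination:
  fixes B :: "nat \<Rightarrow> complex fps"
  assumes "\<And>i n. n < i \<Longrightarrow> fps_nth (B i) n = 0" and "\<And>i. fps_nth (B i) i \<noteq> 0"
  shows "\<exists>c. \<forall>n<m. fps_nth (A - (\<Sum>i<m. fps_const (c i) * B i)) n = 0"
proof (induction m)
  case (Suc m)
  then obtain c where c: "\<And>n. n < m \<Longrightarrow> fps_nth (A - (\<Sum>i<m. fps_const (c i) * B i)) n = 0" by blast
  let ?r = "A - (\<Sum>i<m. fps_const (c i) * B i)"
  define c' where "c' = c(m := fps_nth ?r m / fps_nth (B m) m)"
  have "(\<Sum>i<m. fps_const (c' i) * B i) = (\<Sum>i<m. fps_const (c i) * B i)"
    by (intro sum.cong) (auto simp: c'_def)
  then have e: "A - (\<Sum>i<Suc m. fps_const (c' i) * B i) = ?r - fps_const (fps_nth ?r m / fps_nth (B m) m) * B m"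
    by (simp add: c'_def)
  have "fps_nth (A - (\<Sum>i<Suc m. fps_const (c' i) * B i)) n = 0" if "n < Suc m" for n
    unfolding e fps_sub_nth fps_mult_left_const_nth
    using c[of n, unfolded fps_sub_nth] assms(1)[of n m] assms(2)[of m] that by (cases "n = m") auto
  then show ?case by blast
qed simp

lemma triangular_independent:
  fixes B :: "nat \<Rightarrow> complex fps"
  assumes B: "\<And>i n. n < i \<Longrightarrow> fps_nth (B i) n = 0" "\<And>i. fps_nth (B i) i \<noteq> 0"
    and zero: "(\<Sum>i<m. fps_const (c i) * B i) = 0" and "j < m"
  shows "c j = 0"
  using \<open>j < m\<close>
proof (induction j rule: less_induct)
  case (less j)
  have "0 = (\<Sum>i<m. c i * fps_nth (B i) j)"
    using arg_cong[OF zero, of "\<lambda>f. fps_nth f j"] by (simp add: fps_sum_nth)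
  also have "\<dots> = (\<Sum>i<m. if i = j then c j * fps_nth (B j) j else 0)"
  proof (intro sum.cong refl)
    fix i assume "i \<in> {..<m}"
    then show "c i * fps_nth (B i) j = (if i = j then c j * fps_nth (B j) j else 0)"
      using less.IH[of i] B(1)[of j i] by (cases i j rule: linorder_cases) auto
  qed
  also have "\<dots> = c j * fps_nth (B j) j" using less.prems by simp
  finally show ?case using B(2)[of j] by simp
qed

text \<open>The factor \<open>eis2\<close> occurs once if \<open>h \<equiv> 2\<close> modulo 4 and does not occur if \<open>h \<equiv> 0\<close>. The form with index
\<open>i\<close> vanishes to order exactly \<open>i\<close> at infinity.\<close>

definition basis_form :: "nat \<Rightarrow> nat \<Rightarrow> complex \<Rightarrow> complex" where
  "basis_form h i z = eis2 z ^ (h mod 4 div 2) * (phi z ^ (h div 4 - i) * psi z ^ i)"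

definition basis_fps :: "nat \<Rightarrow> nat \<Rightarrow> complex fps" where
  "basis_fps h i = eis2_fps ^ (h mod 4 div 2) * (phi_fps ^ (h div 4 - i) * psi_fps ^ i)"

lemma basis_form_modular:
  assumes "even h" "i \<le> h div 4"
  shows "zero_extend (basis_form h i) \<in> modular_forms 2 h"
proof -
  have "h mod 4 mod 2 = 0" using assms(1) by (simp add: mod_mod_cancel)
  then have "h mod 4 div 2 * 2 = h mod 4" by (metis add.right_neutral div_mult_mod_eq)
  moreover have "(h div 4 - i) * 4 + i * 4 = 4 * (h div 4)" using assms(2) by (simp add: algebra_simps)
  ultimately have w: "h mod 4 div 2 * 2 + ((h div 4 - i) * 4 + i * 4) = h" by simp
  show ?thesis
    using three_term_form_modular[OF three_term_form_mult[OF three_term_form_power[OF eis2_three_term]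
      three_term_form_mult[OF three_term_form_power[OF phi_three_term] three_term_form_power[OF psi_three_term]]],
      of "h mod 4 div 2" "h div 4 - i" i]
    unfolding w basis_form_def[abs_def] by simp
qed

lemma zero_extend_q_expansion: "has_q_expansion f A \<Longrightarrow> has_q_expansion (zero_extend f) A"
  by (simp add: has_q_expansion_def zero_extend_def)

lemma basis_form_q_expansion: "has_q_expansion (zero_extend (basis_form h i)) (basis_fps h i)"
  unfolding basis_form_def[abs_def] basis_fps_def
  by (intro zero_extend_q_expansion has_q_expansion_mult has_q_expansion_power
      eis2_q_expansion phi_q_expansion psi_q_expansion)

lemma theta3_fps_0: "fps_nth theta3_fps 0 = 1"
  by (simp add: theta3_fps_def square_fps_def)

lemma eis2_fps_0: "fps_nth eis2_fps 0 = 2"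
  by (simp add: eis2_fps_def fps_even_part_def fps_power_zeroth theta3_fps_0)

lemma phi_fps_0: "fps_nth phi_fps 0 = 2"
  by (simp add: phi_fps_def fps_spread_def eis4_fps_def psi_fps_def fps_even_part_def fps_power_zeroth theta3_fps_0)

lemma basis_fps_order:
  shows "n < i \<Longrightarrow> fps_nth (basis_fps h i) n = 0" and "fps_nth (basis_fps h i) i \<noteq> 0"
proof -
  define U where "U = eis2_fps ^ (h mod 4 div 2) * (phi_fps ^ (h div 4 - i) * (triangular_fps ^ 8) ^ i)"
  have e: "basis_fps h i = fps_X ^ i * U"
    by (simp add: basis_fps_def U_def psi_fps_def power_mult_distrib mult_ac)
  have "fps_nth U 0 \<noteq> 0"
    by (simp add: U_def fps_power_zeroth eis2_fps_0 phi_fps_0 triangular_fps_0)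
  then show "n < i \<Longrightarrow> fps_nth (basis_fps h i) n = 0" "fps_nth (basis_fps h i) i \<noteq> 0"
    by (simp_all add: e fps_X_power_mult_nth)
qed

lemma sum_fun_apply: "(\<Sum>i\<in>I. f i) x = (\<Sum>i\<in>I. f i x)"
  for f :: "'i \<Rightarrow> 'a \<Rightarrow> complex"
  by (induction I rule: infinite_finite_induct) auto

text \<open>Elimination produces a combination of the basis forms that matches the coefficients of \<open>f\<close> up to
index \<open>h div 4\<close>; the difference then vanishes to so high an order that it is 0.\<close>

lemma modular_forms_expand:
  assumes h: "even h" and f: "f \<in> modular_forms 2 h" and A: "has_q_expansion f A"
  obtains c where "f = (\<lambda>z. \<Sum>i<h div 4 + 1. c i * zero_extend (basis_form h i) z)"
    "A = (\<Sum>i<h div 4 + 1. fps_const (c i) * basis_fps h i)"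
proof -
  let ?m = "h div 4 + 1"
  obtain c where c: "\<And>n. n < ?m \<Longrightarrow> fps_nth (A - (\<Sum>i<?m. fps_const (c i) * basis_fps h i)) n = 0"
    using triangular_elimination[of "basis_fps h" ?m A, OF basis_fps_order] by blast
  define g where "g = (\<lambda>z. \<Sum>i<?m. c i * zero_extend (basis_form h i) z)"
  define G where "G = (\<Sum>i<?m. fps_const (c i) * basis_fps h i)"
  have "g = (\<Sum>i<?m. fun_scale (c i) (zero_extend (basis_form h i)))"
    by (auto simp: g_def fun_scale_def fun_eq_iff sum_fun_apply)
  moreover have "\<dots> \<in> modular_forms 2 h"
    using subspace_modular_forms[of 2 h] basis_form_modular[OF h]
    by (intro cfun.subspace_sum cfun.subspace_scale) auto
  ultimately have g: "g \<in> modular_forms 2 h" by simp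
  have G: "has_q_expansion g G"
    unfolding g_def G_def
    by (intro has_q_expansion_sum has_q_expansion_mult has_q_expansion_const basis_form_q_expansion)
  have fg: "f + fun_scale (-1) g \<in> modular_forms 2 h"
    using f g subspace_modular_forms[of 2 h] by (intro cfun.subspace_add cfun.subspace_scale) auto
  have "has_q_expansion (\<lambda>z. f z + (-1) * g z) (A + fps_const (-1) * G)"
    by (intro has_q_expansion_add has_q_expansion_mult has_q_expansion_const A G)
  then have FG: "has_q_expansion (f + fun_scale (-1) g) (A + fps_const (-1) * G)"
    by (simp add: plus_fun_def fun_scale_def)
  have "fps_nth (A + fps_const (-1) * G) n = 0" if "4 * n \<le> h" for n
    using c[of n] that by (simp add: G_def less_Suc_eq_le less_eq_div_iff_mult_less_eq mult.commute)
  from modular_form_eq_0_if_vanishing[OF fg FG this]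
  have "f z + - g z = 0" if "z \<in> upper_half_plane" for z
    using that by (simp add: fun_scale_def)
  moreover have "f z = 0" "g z = 0" if "z \<notin> upper_half_plane" for z
    using f g that by (auto simp: modular_forms_def)
  ultimately have "f z = g z" for z by (cases "z \<in> upper_half_plane") auto
  then have "f = g" by (rule ext)
  moreover from this have "A = G" using has_q_expansion_unique[OF A] G by simp
  ultimately show ?thesis using that unfolding g_def G_def by blast
qed

lemma dim_modular_forms_even:
  assumes h: "even h"
  shows "dim_modular_forms 2 h = h div 4 + 1"
proof -
  let ?m = "h div 4 + 1"
  let ?b = "\<lambda>i. zero_extend (basis_form h i)"
  have indep: "\<forall>j<?m. c j = 0" if zero: "(\<Sum>i<?m. fun_scale (c i) (?b i)) = 0" for c
  proof -
    have "has_q_expansion (\<lambda>z. \<Sum>i<?m. c i * ?b i z) (\<Sum>i<?m. fps_const (c i) * basis_fps h i)"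
      by (intro has_q_expansion_sum has_q_expansion_mult has_q_expansion_const basis_form_q_expansion)
    moreover have "(\<lambda>z. \<Sum>i<?m. c i * ?b i z) = (\<lambda>z. 0)"
      using zero by (simp add: fun_eq_iff sum_fun_apply fun_scale_def)
    ultimately have "(\<Sum>i<?m. fps_const (c i) * basis_fps h i) = 0"
      using has_q_expansion_unique has_q_expansion_const[of 0] by fastforce
    then show ?thesis using triangular_independent[of "basis_fps h", OF basis_fps_order] by blast
  qed
  have inj: "inj_on ?b {..<?m}"
  proof (rule inj_onI)
    fix i j assume ij: "i \<in> {..<?m}" "j \<in> {..<?m}" and eq: "?b i = ?b j"
    have e: "basis_fps h i = basis_fps h j"
      using has_q_expansion_unique[OF basis_form_q_expansion[of h i, unfolded eq] basis_form_q_expansion[of h j]] .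
    show "i = j"
      using basis_fps_order(1)[of i j h] basis_fps_order(1)[of j i h] basis_fps_order(2)[of h i] basis_fps_order(2)[of h j] e
      by (cases i j rule: linorder_cases) auto
  qed
  have "cfun.independent (?b ` {..<?m})"
  proof
    assume "cfun.dependent (?b ` {..<?m})"
    then obtain u v where v: "v \<in> ?b ` {..<?m}" "u v \<noteq> 0" and s: "(\<Sum>v\<in>?b ` {..<?m}. fun_scale (u v) v) = 0"
      using cfun.dependent_finite[of "?b ` {..<?m}"] by blast
    have "(\<Sum>i<?m. fun_scale (u (?b i)) (?b i)) = 0"
      using s by (subst (asm) sum.reindex[OF inj]) (simp add: o_def)
    from indep[OF this] v show False by auto
  qed
  moreover have "?b ` {..<?m} \<subseteq> modular_forms 2 h"
    using basis_form_modular[OF h] by auto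
  moreover have "modular_forms 2 h \<subseteq> cfun.span (?b ` {..<?m})"
  proof
    fix f assume f: "f \<in> modular_forms 2 h"
    then obtain A where "has_q_expansion f A" using modular_forms_q_expansion by blast
    then obtain c where "f = (\<lambda>z. \<Sum>i<?m. c i * ?b i z)"
      using modular_forms_expand[OF h f] by blast
    then have "f = (\<Sum>i<?m. fun_scale (c i) (?b i))"
      by (auto simp: fun_scale_def fun_eq_iff sum_fun_apply)
    also have "\<dots> \<in> cfun.span (?b ` {..<?m})"
      by (intro cfun.span_sum cfun.span_scale cfun.span_base) auto
    finally show "f \<in> cfun.span (?b ` {..<?m})" .
  qed
  ultimately have "card (?b ` {..<?m}) = cfun.dim (modular_forms 2 h)"
    by (intro cfun.basis_card_eq_dim)
  moreover have "card (?b ` {..<?m}) = ?m" using card_image[OF inj] by simp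
  ultimately show ?thesis unfolding dim_modular_forms_def by (simp only:)
qed


section \<open>A residue condition on power series with a gap\<close>

lemma fls_residue_power_times_deriv:
  "fls_residue (J ^ m * fls_deriv J) = (0 :: complex)"
proof -
  have "fls_deriv (J ^ Suc m) = fls_const (of_nat (Suc m)) * (J ^ m * fls_deriv J)"
    by (simp only: fls_deriv_power fls_of_nat diff_Suc_1 mult.assoc)
  then have "of_nat (Suc m) * fls_residue (J ^ m * fls_deriv J) = (0 :: complex)"
    using fls_residue_deriv[of "J ^ Suc m"] by (simp only: fls_residue_fls_const_times)
  then show ?thesis by (simp only: mult_eq_0_iff of_nat_eq_0_iff) simp
qed

lemma fps_to_fls_sum: "fps_to_fls (\<Sum>i\<in>I. f i) = (\<Sum>i\<in>I. fps_to_fls (f i :: complex fps))"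
  by (induction I rule: infinite_finite_induct) auto

lemma fls_residue_sum: "fls_residue (\<Sum>i\<in>I. f i) = (\<Sum>i\<in>I. fls_residue (f i :: complex fls))"
  by (induction I rule: infinite_finite_induct) auto

text \<open>Write \<open>\<Psi> = X \<tau>\<close> and \<open>J = \<Phi> / \<Psi>\<close>. Since \<open>A / \<Psi> ^ k\<close> is a polynomial in \<open>J\<close>, the Laurent series
\<open>(A / \<Psi> ^ k) J'\<close> is a derivative and has residue 0. Its pole has order \<open>k + 2\<close>, so the gap in \<open>A\<close> makes
this residue equal to the constant coefficient of \<open>A\<close> times the residue of \<open>J' / \<Psi> ^ k\<close>. The derivative
of \<open>\<Phi> / \<Psi> ^ (k + 1)\<close> shows that the latter is \<open>k / (k + 1)\<close> times the residue of \<open>\<Phi>' / \<Psi> ^ (k + 1)\<close>,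
which is the coefficient in the conclusion.\<close>

lemma residue_constraint:
  fixes \<Phi> \<tau> A :: "complex fps"
  assumes \<tau>: "fps_nth \<tau> 0 \<noteq> 0" and k: "k > 0"
    and A: "A = (\<Sum>i<k+1. fps_const (c i) * (\<Phi> ^ (k - i) * (fps_X * \<tau>) ^ i))"
    and gap: "\<And>n. 1 \<le> n \<Longrightarrow> n \<le> k + 1 \<Longrightarrow> fps_nth A n = 0" and A0: "fps_nth A 0 \<noteq> 0"
  shows "fps_nth (fps_deriv \<Phi> * inverse \<tau> ^ (k + 1)) k = 0"
proof -
  define \<iota> where "\<iota> = inverse \<tau>"
  have \<iota>: "\<tau> * \<iota> = 1" unfolding \<iota>_def using inverse_mult_eq_1[OF \<tau>] by (simp add: mult.commute)
  \<comment> \<open>The Laurent series \<open>P\<close>, \<open>Q\<close> and \<open>v\<close> are \<open>\<Phi>\<close>, \<open>\<Psi>\<close> and \<open>1 / \<Psi>\<close>.\<close>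
  define P where "P = fps_to_fls \<Phi>"
  define Q where "Q = fps_to_fls (fps_X * \<tau>)"
  define v where "v = fls_X_inv * fps_to_fls \<iota>"
  define J where "J = P * v"
  have Xv: "fls_X * v = fps_to_fls \<iota>"
  proof -
    have "fls_X * (fls_X_inv :: complex fls) = 1" by (simp add: fls_X_inv_times_conv_shift)
    then show ?thesis by (simp only: v_def mult.assoc[symmetric] mult_1_left)
  qed
  have Qv: "Q * v = 1"
  proof -
    have "Q = fps_to_fls \<tau> * fls_X" by (simp add: Q_def fls_times_fps_to_fls mult.commute)
    then have "Q * v = fps_to_fls (\<tau> * \<iota>)" by (simp add: mult.assoc Xv fls_times_fps_to_fls)
    then show ?thesis by (simp add: \<iota>)
  qed
  have Dv: "fls_deriv v = - (v * v * fls_deriv Q)"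
  proof -
    have "Q * fls_deriv v + fls_deriv Q * v = 0"
      using arg_cong[OF Qv, of fls_deriv] by (simp add: mult.commute)
    then have "Q * fls_deriv v = - (fls_deriv Q * v)" by (simp add: eq_neg_iff_add_eq_0)
    then have "v * (Q * fls_deriv v) = v * - (fls_deriv Q * v)" by simp
    moreover have "v * (Q * fls_deriv v) = fls_deriv v" using Qv by (simp add: mult.assoc[symmetric] mult.commute)
    ultimately show ?thesis by (simp add: mult_ac)
  qed
  have DJ: "fls_deriv J = fls_deriv P * v - P * (v * v * fls_deriv Q)"
    unfolding J_def by (simp add: Dv mult.commute)
  have Dpow: "fls_deriv (v ^ n) = - (of_nat n * (v ^ (n + 1) * fls_deriv Q))" for n
    unfolding fls_deriv_power Dv by (cases n) (simp_all add: mult_ac)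
  have "fls_residue (fps_to_fls A * v ^ k * fls_deriv J) = 0"
  proof -
    have factor: "fps_to_fls (\<Phi> ^ (k - i) * (fps_X * \<tau>) ^ i) * v ^ k = J ^ (k - i)" if "i < k + 1" for i
    proof -
      have "v ^ k = v ^ (k - i) * v ^ i" using that by (simp add: power_add[symmetric])
      then have "fps_to_fls (\<Phi> ^ (k - i) * (fps_X * \<tau>) ^ i) * v ^ k = P ^ (k - i) * v ^ (k - i) * (Q ^ i * v ^ i)"
        by (simp add: fls_times_fps_to_fls fps_to_fls_power P_def Q_def mult_ac)
      then show ?thesis by (simp add: J_def power_mult_distrib[symmetric] Qv)
    qed
    have "fps_to_fls A = (\<Sum>i<k+1. fls_const (c i) * fps_to_fls (\<Phi> ^ (k - i) * (fps_X * \<tau>) ^ i))"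
      unfolding A by (simp only: fps_to_fls_sum fls_times_fps_to_fls fps_const_to_fls)
    then have "fps_to_fls A * v ^ k * fls_deriv J = (\<Sum>i<k+1. fls_const (c i) * (J ^ (k - i) * fls_deriv J))"
      using factor by (simp only: sum_distrib_right mult.assoc[symmetric]) (simp add: mult.assoc factor)
    then show ?thesis
      by (simp only: fls_residue_sum fls_residue_fls_const_times fls_residue_power_times_deriv
          mult_zero_right sum.neutral_const)
  qed
  moreover have "fls_residue (fps_to_fls A * v ^ k * fls_deriv J) = fps_nth A 0 * fls_residue (v ^ k * fls_deriv J)"
  proof -
    define B where "B = fps_shift (k + 2) A"
    have AB: "A = fps_const (fps_nth A 0) + fps_X ^ (k + 2) * B"
    proof (rule fps_ext)
      fix n
      show "fps_nth A n = fps_nth (fps_const (fps_nth A 0) + fps_X ^ (k + 2) * B) n"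
      proof (cases "n < k + 2")
        case True
        then show ?thesis using gap[of n] unfolding fps_add_nth fps_X_power_mult_nth by (cases "n = 0") auto
      next
        case False
        then have "n - (k + 2) + (k + 2) = n" by linarith
        then show ?thesis
          using False unfolding fps_add_nth fps_X_power_mult_nth B_def fps_shift_nth by simp
      qed
    qed
    have DJ2: "fls_deriv J = v ^ 2 * (fls_deriv P * Q - P * fls_deriv Q)"
      unfolding DJ using Qv by (simp add: power2_eq_square algebra_simps)
    have Xv_pow: "fls_X ^ (k + 2) * v ^ (k + 2) = fps_to_fls (\<iota> ^ (k + 2))"
      by (simp only: power_mult_distrib[symmetric] Xv fps_to_fls_power)
    have "fps_to_fls (fps_X ^ (k + 2) * B) = fls_X ^ (k + 2) * fps_to_fls B"
      by (simp only: fls_times_fps_to_fls fps_to_fls_power fps_X_to_fls)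
    then have "fps_to_fls (fps_X ^ (k + 2) * B) * v ^ k * fls_deriv J =
        fps_to_fls B * (fls_X ^ (k + 2) * v ^ (k + 2)) * (fls_deriv P * Q - P * fls_deriv Q)"
      unfolding DJ2 power_add[of v k 2] by (simp only: mult_ac)
    also have "\<dots> = fps_to_fls (B * \<iota> ^ (k + 2) * (fps_deriv \<Phi> * (fps_X * \<tau>) - \<Phi> * fps_deriv (fps_X * \<tau>)))"
      unfolding Xv_pow P_def Q_def fls_deriv_fps_to_fls by (simp only: fls_times_fps_to_fls fps_to_fls_minus)
    finally have "fps_to_fls (fps_X ^ (k + 2) * B) * v ^ k * fls_deriv J =
        fps_to_fls (B * \<iota> ^ (k + 2) * (fps_deriv \<Phi> * (fps_X * \<tau>) - \<Phi> * fps_deriv (fps_X * \<tau>)))" .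
    then have "fls_residue (fps_to_fls (fps_X ^ (k + 2) * B) * v ^ k * fls_deriv J) = 0" by simp
    moreover have "fps_to_fls A * v ^ k * fls_deriv J = fls_const (fps_nth A 0) * (v ^ k * fls_deriv J) +
        fps_to_fls (fps_X ^ (k + 2) * B) * v ^ k * fls_deriv J"
      by (subst AB) (simp only: fps_to_fls_plus fps_const_to_fls distrib_right mult.assoc)
    ultimately show ?thesis by (simp only: fls_residue_add fls_residue_fls_const_times add_0_right)
  qed
  ultimately have R1: "fls_residue (v ^ k * fls_deriv J) = 0" using A0 by simp
  define S where "S = P * v ^ (k + 2) * fls_deriv Q"
  have "v ^ k * fls_deriv J = fls_deriv P * v ^ (k + 1) - S"
    unfolding DJ S_def by (simp add: algebra_simps)
  then have e1: "fls_residue (fls_deriv P * v ^ (k + 1)) = fls_residue S" using R1 by simp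
  have "fls_deriv (P * v ^ (k + 1)) = fls_deriv P * v ^ (k + 1) - fls_const (of_nat (k + 1)) * S"
    unfolding fls_deriv_mult Dpow S_def fls_of_nat by (simp add: algebra_simps del: fls_of_nat of_nat_add of_nat_Suc)
  then have e2: "fls_residue (fls_deriv P * v ^ (k + 1)) = of_nat (k + 1) * fls_residue S"
    using fls_residue_deriv[of "P * v ^ (k + 1)"]
    by (simp only: fls_residue_fls_const_times fls_residue_def fls_minus_nth) (simp add: fls_residue_fls_const_times[unfolded fls_residue_def])
  have "of_nat k * fls_residue S = 0" using e1 e2 by (simp add: algebra_simps)
  then have res0: "fls_residue (fls_deriv P * v ^ (k + 1)) = 0" using k e1 by simp
  have shape: "fls_deriv P * v ^ (k + 1) = fls_X_inv ^ (k + 1) * fps_to_fls (fps_deriv \<Phi> * \<iota> ^ (k + 1))"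
    by (simp only: P_def fls_deriv_fps_to_fls v_def power_mult_distrib fls_times_fps_to_fls fps_to_fls_power mult_ac)
  have shift: "fls_residue (fls_X_inv ^ (k + 1) * fps_to_fls F) = fps_nth F k" for F :: "complex fps"
    unfolding fls_X_inv_power_times_conv_shift by simp
  show ?thesis using res0 unfolding shape shift \<iota>_def .
qed

section \<open>The first coefficients of a form\<close>

definition fps_nonneg :: "complex fps \<Rightarrow> bool" where
  "fps_nonneg f \<longleftrightarrow> (\<forall>n. fps_nth f n \<in> \<real>\<^sub>\<ge>\<^sub>0)"

lemma fps_nonneg_mult: "fps_nonneg f \<Longrightarrow> fps_nonneg g \<Longrightarrow> fps_nonneg (f * g)"
  unfolding fps_nonneg_def fps_mult_nth by (auto intro!: nonneg_Reals_sum nonneg_Reals_mult_I)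

lemma fps_nonneg_1: "fps_nonneg 1"
  by (simp add: fps_nonneg_def)

lemma fps_nonneg_power: "fps_nonneg f \<Longrightarrow> fps_nonneg (f ^ n)"
  by (induction n) (auto intro: fps_nonneg_mult fps_nonneg_1)

lemma fps_nonneg_theta3: "fps_nonneg theta3_fps"
  unfolding fps_nonneg_def
proof
  fix n
  have "fps_nth theta3_fps n = (if n = 0 then 1 else 0) + 2 * fps_nth square_fps n"
    by (simp add: theta3_fps_def del: mult_cancel_left)
  then show "fps_nth theta3_fps n \<in> \<real>\<^sub>\<ge>\<^sub>0" by (simp add: square_fps_def)
qed

lemma fps_nonneg_triangular: "fps_nonneg triangular_fps"
  by (simp add: fps_nonneg_def triangular_fps_def)

lemma fps_nth_eis4:
  "fps_nth eis4_fps n = 256 * fps_nth psi_fps n + 2 * fps_nth (theta3_fps ^ 8) (2 * n)"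
  by (simp add: eis4_fps_def fps_even_part_def)

lemma fps_nonneg_psi: "fps_nonneg psi_fps"
  unfolding psi_fps_def
  by (intro fps_nonneg_mult fps_nonneg_power fps_nonneg_triangular) (simp add: fps_nonneg_def fps_X_def)

lemma fps_nonneg_eis4: "fps_nonneg eis4_fps"
  using fps_nonneg_psi fps_nonneg_power[OF fps_nonneg_theta3, of 8]
  unfolding fps_nonneg_def fps_nth_eis4 by (auto intro!: nonneg_Reals_add_I nonneg_Reals_mult_I)

lemma fps_nth_eis4_1: "fps_nth eis4_fps 1 \<noteq> 0"
proof -
  have "fps_nth psi_fps 1 = 1" by (simp add: psi_fps_def fps_power_zeroth triangular_fps_0)
  moreover have "fps_nth (theta3_fps ^ 8) (2 * 1) \<in> \<real>\<^sub>\<ge>\<^sub>0"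
    using fps_nonneg_power[OF fps_nonneg_theta3, of 8] unfolding fps_nonneg_def by blast
  ultimately have "Re (fps_nth eis4_fps 1) > 0"
    unfolding fps_nth_eis4 by (simp add: complex_nonneg_Reals_iff)
  then show ?thesis by auto
qed

lemma alternating_deriv_phi: "fps_alternating (- fps_deriv phi_fps)"
  unfolding fps_alternating_def
proof
  fix n
  show "(-1) ^ n * fps_nth (- fps_deriv phi_fps) n \<in> \<real>\<^sub>\<ge>\<^sub>0"
  proof (cases "even n")
    case True
    then show ?thesis by (simp add: phi_fps_def fps_spread_def)
  next
    case False
    have "of_nat (n + 1) * fps_nth eis4_fps ((n + 1) div 2) \<in> \<real>\<^sub>\<ge>\<^sub>0"
      using fps_nonneg_eis4 unfolding fps_nonneg_def by (intro nonneg_Reals_mult_I nonneg_Reals_of_nat_I) auto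
    then show ?thesis using False by (simp add: phi_fps_def fps_spread_def)
  qed
qed

text \<open>All terms of this coefficient have the same sign, and one of them is not 0: the coefficient of \<open>X\<close> in
the derivative of \<open>phi_fps\<close> is twice that of \<open>X\<close> in \<open>eis4_fps\<close>, and no coefficient of a positive power of
the reciprocal triangular series vanishes.\<close>

lemma phi_psi_residue_nonzero:
  assumes "k > 0"
  shows "fps_nth (fps_deriv phi_fps * inverse (triangular_fps ^ 8) ^ (k + 1)) k \<noteq> 0"
proof -
  let ?R = "inverse triangular_fps"
  have alt: "fps_alternating (?R ^ m)" for m
    using inverse_triangular_alternating by (intro fps_alternating_power) simp
  have nz: "fps_nth (?R ^ Suc m) n \<noteq> 0" for m n
  proof -
    have "fps_nth (?R * ?R ^ m) n \<noteq> 0"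
      using inverse_triangular_alternating alt
      by (intro signed_fps_mult_nth_pos[of _ _ n]) (auto simp: fps_power_zeroth triangular_fps_0)
    then show ?thesis by simp
  qed
  have e: "inverse (triangular_fps ^ 8) ^ (k + 1) = ?R ^ Suc (8 * k + 7)"
    by (simp only: fps_inverse_power power_mult[symmetric]) (simp add: algebra_simps)
  have "fps_nth (- fps_deriv phi_fps * ?R ^ Suc (8 * k + 7)) k \<noteq> 0"
  proof (rule signed_fps_mult_nth_pos[OF alternating_deriv_phi alt, of 1])
    show "1 \<le> k" using assms by simp
    show "fps_nth (- fps_deriv phi_fps) 1 \<noteq> 0"
      using fps_nth_eis4_1 by (simp add: phi_fps_def fps_spread_def)
  qed (rule nz)
  then show ?thesis unfolding e by simp
qed

lemma nonzero_coefficient_weight_4k: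
  assumes f: "f \<in> modular_forms 2 (4 * k)" and k: "k > 0"
    and A: "has_q_expansion f A" and A0: "fps_nth A 0 \<noteq> 0"
  shows "\<exists>n. 1 \<le> n \<and> n \<le> k + 1 \<and> fps_nth A n \<noteq> 0"
proof (rule ccontr)
  assume "\<not> ?thesis"
  then have gap: "fps_nth A n = 0" if "1 \<le> n" "n \<le> k + 1" for n using that by blast
  obtain c where "A = (\<Sum>i<4 * k div 4 + 1. fps_const (c i) * basis_fps (4 * k) i)"
    using modular_forms_expand[OF _ f A] by (metis dvd_mult2 even_numeral)
  then have "A = (\<Sum>i<k + 1. fps_const (c i) * (phi_fps ^ (k - i) * (fps_X * triangular_fps ^ 8) ^ i))"
    by (simp add: basis_fps_def psi_fps_def)
  moreover have "fps_nth (triangular_fps ^ 8) 0 \<noteq> 0" by (simp add: fps_power_zeroth triangular_fps_0)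
  ultimately have "fps_nth (fps_deriv phi_fps * inverse (triangular_fps ^ 8) ^ (k + 1)) k = 0"
    using residue_constraint[OF _ k _ gap A0] by blast
  then show False using phi_psi_residue_nonzero[OF k] by blast
qed

theorem theorem2p1:
  fixes h :: nat and f :: "complex \<Rightarrow> complex" and A :: "nat \<Rightarrow> complex"
  assumes "h > 0" and "even h"
    and "f \<in> modular_forms 2 h"
    and "\<And>z. z \<in> upper_half_plane \<Longrightarrow> (\<lambda>n. A n * exp (2 * of_real pi * \<i> * z) ^ n) sums f z"
    and "A 0 \<noteq> 0"
  shows "([h = 0] (mod 4) \<longrightarrow> (\<exists>n. 1 \<le> n \<and> n \<le> dim_modular_forms 2 h \<and> A n \<noteq> 0)) \<and>
         ([h = 2] (mod 4) \<longrightarrow> (\<exists>n. 1 \<le> n \<and> n \<le> 2 * dim_modular_forms 2 h \<and> A n \<noteq> 0))"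
proof -
  have q: "has_q_expansion f (Abs_fps A)"
    unfolding has_q_expansion_def
  proof (intro conjI ballI)
    show "fps_conv_radius (Abs_fps A) \<ge> 1"
    proof (rule fps_conv_radius_ge_1I)
      fix x :: complex assume "norm x < 1" "x \<noteq> 0"
      then obtain z where "z \<in> upper_half_plane" "exp (2 * of_real pi * \<i> * z / of_nat 1) = x"
        using exp_width_surj[of 1 x] by auto
      then show "summable (\<lambda>n. fps_nth (Abs_fps A) n * x ^ n)" using sums_summable[OF assms(4)] by auto
    qed
    show "f z = eval_fps (Abs_fps A) (exp (2 * of_real pi * \<i> * z))" if "z \<in> upper_half_plane" for z
      using assms(4)[OF that] by (simp add: eval_fps_def sums_iff)
  qed
  have "\<exists>n. 1 \<le> n \<and> n \<le> dim_modular_forms 2 h \<and> A n \<noteq> 0" if "h mod 4 = 0"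
  proof -
    have h: "h = 4 * (h div 4)" using that by auto
    moreover from this have "h div 4 > 0" using assms(1) by linarith
    ultimately show ?thesis
      using nonzero_coefficient_weight_4k[of f "h div 4" "Abs_fps A"] assms(3,5) q
      by (simp add: dim_modular_forms_even[OF assms(2)])
  qed
  moreover have "\<exists>n. 1 \<le> n \<and> n \<le> 2 * dim_modular_forms 2 h \<and> A n \<noteq> 0" if "h mod 4 = 2"
  proof -
    let ?k = "2 * (h div 4) + 1"
    have h: "2 * h = 4 * ?k" using that by presburger
    \<comment> \<open>The weight of \<open>f\<^sup>2\<close> is divisible by 4, and a gap after the constant term of \<open>f\<close> persists in \<open>f\<^sup>2\<close>.\<close>
    have "(\<lambda>z. f z ^ 2) \<in> modular_forms 2 (4 * ?k)"
      using modular_forms_power[OF assms(3), of 2] unfolding h by simp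
    moreover have "has_q_expansion (\<lambda>z. f z ^ 2) (Abs_fps A ^ 2)"
      by (rule has_q_expansion_power[OF q])
    moreover have "fps_nth (Abs_fps A ^ 2) 0 \<noteq> 0"
      using assms(5) by (simp add: fps_power_zeroth)
    ultimately obtain n where n: "1 \<le> n" "n \<le> ?k + 1" "fps_nth (Abs_fps A ^ 2) n \<noteq> 0"
      using nonzero_coefficient_weight_4k[of "\<lambda>z. f z ^ 2" ?k "Abs_fps A ^ 2"] by auto
    have "\<exists>m. 1 \<le> m \<and> m \<le> n \<and> A m \<noteq> 0"
    proof (rule ccontr)
      assume "\<not> ?thesis"
      then have z: "A m = 0" if "1 \<le> m" "m \<le> n" for m using that by blast
      have "A i * A (n - i) = 0" if "i \<le> n" for i
        using z[of i] z[of "n - i"] that n(1) by (cases "i = 0") auto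
      then have "fps_nth (Abs_fps A ^ 2) n = 0"
        by (auto simp: power2_eq_square fps_mult_nth intro!: sum.neutral)
      then show False using n(3) by simp
    qed
    then show ?thesis using n(2) by (force simp: dim_modular_forms_even[OF assms(2)])
  qed
  ultimately show ?thesis by (simp add: cong_def)
qed

end
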